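(* Let $X_1,\dots,X_n$ be independent random vectors in $\mathbb{R}^p$, $X_i=(X_{i1},\dots,X_{ip})^T$, with $\mathbb{E}[X_{ij}]=0$ and $\mathbb{E}[|X_{ij}|^3]<\infty$ for all $1\le i\le n$, $1\le j\le p$. Let $Z=\max_{1\le j\le p}\sum_{i=1}^n X_{ij}$. Let $Y_1,\dots,Y_n$ be independent random vectors in $\mathbb{R}^p$ with $Y_i\sim N(0,\mathbb{E}[X_iX_i^T])$, $1\le i\le n$. Then for every $\beta>0$ and $\delta>1/\beta$, there exists a random variable $\widetilde Z$, equal in distribution to $\max_{1\le j\le p}\sum_{i=1}^n Y_{ij}$, such that $$\mathbb{P}\big(|Z-\widetilde Z|>2\beta^{-1}\log p+3\delta\big)\le\frac{\varepsilon+C\beta\delta^{-1}\{B_1+\beta(B_2+B_3)\}}{1-\varepsilon},$$ where $C>0$ is a universal constant, $\varepsilon=\sqrt{e^{-\alpha}(1+\alpha)}<1$ with $\alpha=\beta^2\delta^2-1>0$, and $$\begin{aligned}B_1&=\mathbb{E}\Big[\max_{1\le j,k\le p}\Big|\sum_{i=1}^n(X_{ij}X_{ik}-\mathbb{E}[X_{ij}X_{ik}])\Big|\Big],\qquad B_2=\mathbb{E}\Big[\max_{1\le j\le p}\sum_{i=1}^n|X_{ij}|^3\Big],\\ B_3&=\sum_{i=1}^n\mathbb{E}\Big[\max_{1\le j\le p}|X_{ij}|^3\cdot 1\Big(\max_{1\le j\le p}|X_{ij}|>\beta^{-1}/2\Big)\Big].\end{aligned}$$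
   Context: The underlying probability space $(\Omega,\mathcal{A},\mathbb{P})$ on which $X_1,\dots,X_n$ are defined is assumed rich enough to admit a uniform random variable on $(0,1)$ independent of $X_1,\dots,X_n$; $\widetilde Z$ is defined on this space. $1(\cdot)$ denotes an indicator. *)

theory Defs
  imports "HOL-Probability.Probability"
begin

text \<open>
  The dimension \<open>p\<close> is quantified inside the statement, so \<open>\<real>\<^sup>p\<close> is the product of \<open>p\<close> copies of
  \<open>borel\<close>, with coordinates \<open>j < p\<close>. A random vector is \<open>V :: 'a \<Rightarrow> nat \<Rightarrow> real\<close> measurable into it.
  Sums and maxima over \<open>i < n\<close>, \<open>j < p\<close> correspond to the usual \<open>1 \<le> i \<le> n\<close>, \<open>1 \<le> j \<le> p\<close>.
\<close>

abbreviation borel_vec :: "nat \<Rightarrow> (nat \<Rightarrow> real) measure" where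
  "borel_vec p \<equiv> Pi\<^sub>M {..<p} (\<lambda>_. borel)"

text \<open>
  \<open>V \<sim> N(0, S)\<close>, by the characteristic function, because \<open>S\<close> may be singular (no density).
\<close>

definition centred_normal_vec ::
    "'a measure \<Rightarrow> nat \<Rightarrow> ('a \<Rightarrow> nat \<Rightarrow> real) \<Rightarrow> (nat \<Rightarrow> nat \<Rightarrow> real) \<Rightarrow> bool" where
  "centred_normal_vec M p V S \<longleftrightarrow>
     V \<in> measurable M (borel_vec p) \<and>
     (\<forall>t :: nat \<Rightarrow> real.
        (CLINT \<omega>|M. iexp (\<Sum>j<p. t j * V \<omega> j)) =
        complex_of_real (exp (- (\<Sum>j<p. \<Sum>k<p. t j * S j k * t k) / 2)))"

text \<open>
  \<open>M\<close> carries a uniform variable on \<open>(0,1)\<close> independent of the whole family \<open>X 0, \<dots>, X (n - 1)\<close>.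
  Independence is that of the generated sigma-algebras; \<open>indep_var\<close> is not applicable since it
  needs both variables to have the same value type.
\<close>

definition rich_enough :: "'a measure \<Rightarrow> nat \<Rightarrow> nat \<Rightarrow> (nat \<Rightarrow> 'a \<Rightarrow> nat \<Rightarrow> real) \<Rightarrow> bool" where
  "rich_enough M n p X \<longleftrightarrow>
     (\<exists>U :: 'a \<Rightarrow> real.
        U \<in> borel_measurable M \<and>
        distr M lborel U = uniform_measure lborel {0<..<1} \<and>
        prob_space.indep_set M
          (sets (vimage_algebra (space M) U borel))
          (sets (vimage_algebra (space M) (\<lambda>\<omega>. \<lambda>i\<in>{..<n}. X i \<omega>)
                   (Pi\<^sub>M {..<n} (\<lambda>_. borel_vec p)))))"

definition max_sum :: "nat \<Rightarrow> nat \<Rightarrow> (nat \<Rightarrow> 'a \<Rightarrow> nat \<Rightarrow> real) \<Rightarrow> 'a \<Rightarrow> real" where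
  "max_sum n p X \<omega> = (MAX j\<in>{..<p}. \<Sum>i<n. X i \<omega> j)"

definition B1 :: "'a measure \<Rightarrow> nat \<Rightarrow> nat \<Rightarrow> (nat \<Rightarrow> 'a \<Rightarrow> nat \<Rightarrow> real) \<Rightarrow> real" where
  "B1 M n p X =
     (LINT \<omega>|M. Max ((\<lambda>(j, k).
        \<bar>\<Sum>i<n. (X i \<omega> j * X i \<omega> k - (LINT \<omega>'|M. X i \<omega>' j * X i \<omega>' k))\<bar>)
          ` ({..<p} \<times> {..<p})))"

definition B2 :: "'a measure \<Rightarrow> nat \<Rightarrow> nat \<Rightarrow> (nat \<Rightarrow> 'a \<Rightarrow> nat \<Rightarrow> real) \<Rightarrow> real" where
  "B2 M n p X = (LINT \<omega>|M. (MAX j\<in>{..<p}. \<Sum>i<n. \<bar>X i \<omega> j\<bar> ^ 3))"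

definition B3 :: "'a measure \<Rightarrow> nat \<Rightarrow> nat \<Rightarrow> (nat \<Rightarrow> 'a \<Rightarrow> nat \<Rightarrow> real) \<Rightarrow> real \<Rightarrow> real" where
  "B3 M n p X \<beta> =
     (\<Sum>i<n. LINT \<omega>|M. ((MAX j\<in>{..<p}. \<bar>X i \<omega> j\<bar> ^ 3) *
        indicator {\<omega>'. (MAX j\<in>{..<p}. \<bar>X i \<omega>' j\<bar>) > inverse \<beta> / 2} \<omega>))"

text \<open>
  The assertion with constant \<open>C\<close>, for a sample space \<open>M\<close> carrying the \<open>X i\<close> and a possibly different
  probability space \<open>N\<close> carrying the Gaussian vectors \<open>Y i\<close>, which enter only through their law.
\<close>

definition coupling_bound :: "real \<Rightarrow> 'a measure \<Rightarrow> 'b measure \<Rightarrow> bool" where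
  "coupling_bound C M N \<longleftrightarrow>
     (\<forall>(n::nat) (p::nat) (X :: nat \<Rightarrow> 'a \<Rightarrow> nat \<Rightarrow> real) (Y :: nat \<Rightarrow> 'b \<Rightarrow> nat \<Rightarrow> real)
        (\<beta>::real) (\<delta>::real).
        n \<ge> 1 \<longrightarrow> p \<ge> 1 \<longrightarrow>
        prob_space.indep_vars M (\<lambda>_. borel_vec p) X {..<n} \<longrightarrow>
        (\<forall>i<n. \<forall>j<p. integrable M (\<lambda>\<omega>. \<bar>X i \<omega> j\<bar> ^ 3) \<and> (LINT \<omega>|M. X i \<omega> j) = 0) \<longrightarrow>
        rich_enough M n p X \<longrightarrow>
        prob_space.indep_vars N (\<lambda>_. borel_vec p) Y {..<n} \<longrightarrow>
        (\<forall>i<n. centred_normal_vec N p (Y i) (\<lambda>j k. LINT \<omega>|M. X i \<omega> j * X i \<omega> k)) \<longrightarrow>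
        \<beta> > 0 \<longrightarrow> \<delta> > 1 / \<beta> \<longrightarrow>
        (\<exists>Z' :: 'a \<Rightarrow> real.
           Z' \<in> borel_measurable M \<and>
           distr M borel Z' = distr N borel (max_sum n p Y) \<and>
           (let \<alpha> = \<beta>\<^sup>2 * \<delta>\<^sup>2 - 1;
                \<epsilon> = sqrt (exp (- \<alpha>) * (1 + \<alpha>))
            in measure M {\<omega> \<in> space M. \<bar>max_sum n p X \<omega> - Z' \<omega>\<bar> > 2 * inverse \<beta> * ln (real p) + 3 * \<delta>}
               \<le> (\<epsilon> + C * \<beta> * inverse \<delta> * (B1 M n p X + \<beta> * (B2 M n p X + B3 M n p X \<beta>)))
                  / (1 - \<epsilon>))))"

text \<open>
  A sample space type large enough to carry the joint law of any \<open>X 0, \<dots>, X (n - 1)\<close> together with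
  an independent uniform variable. HOL cannot quantify over types inside a formula, so
  \<open>\<exists>C. \<forall>M :: 'a measure. \<dots>\<close> would let the constant depend on \<open>'a\<close>. With this type one can say
  that a single constant serves all sample space types: some \<open>C > 0\<close> works on this type, and every
  \<open>C\<close> that works on it works on every other type.
\<close>

type_synonym canonical = "(nat \<Rightarrow> nat \<Rightarrow> real) \<times> real"

definition canonical_constant :: "real \<Rightarrow> bool" where
  "canonical_constant C \<longleftrightarrow> C > 0 \<and>
     (\<forall>(M :: canonical measure) (N :: canonical measure).
        prob_space M \<longrightarrow> prob_space N \<longrightarrow> coupling_bound C M N)"

end

theory Submission
  imports Defs
begin

text \<open>
  By Strassen's theorem the coupling exists once \<open>P(Z \<in> A) \<le> P(max T \<in> A\<^sup>r) + C\<close> for every union \<open>A\<close> of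
  cells of a grid of mesh \<open>\<delta> / 2\<close>, where \<open>S\<close> and \<open>T\<close> are the sums of the \<open>X\<^sub>i\<close> and of the \<open>Y\<^sub>i\<close>. The term
  \<open>\<epsilon> > 0\<close> is spent on truncating the grid to finitely many cells, so that only a finite form of
  Strassen's theorem, that is, Hall's theorem with weights, is needed. The maximum is replaced by
  \<open>\<beta>\<^sup>-\<^sup>1 ln \<Sum> exp (\<beta> x\<^sub>j)\<close> and the indicator of \<open>A\<close> by a compactly supported \<open>C\<^sup>3\<close> cutoff \<open>f\<close>; let \<open>h\<close> be the
  composition. Along \<open>u S + (1 - u\<^sup>2)\<^sup>1\<^sup>/\<^sup>2 T\<close>, \<open>u\<close> from 0 to 1, the expectation of \<open>h\<close> moves by the second-order
  Gaussian term, computed from the rotation invariance of \<open>T\<close> instead of integration by parts, against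
  \<open>E \<Sum>\<^sub>i X\<^sub>i \<cdot> \<nabla>h\<close>. Since \<open>X\<^sub>i\<close> is centred and independent of \<open>S - X\<^sub>i\<close>, subtracting the gradient at
  \<open>S - X\<^sub>i\<close> is free, and a Taylor expansion gives \<open>\<Sum>\<^sub>i X\<^sub>i X\<^sub>i\<^sup>T\<close>. Its deviation from the mean is \<open>B1\<close>,
  and the third-order remainder is \<open>B2\<close> when \<open>|X\<^sub>i| \<le> 1 / \<beta>\<close> and \<open>B3\<close> otherwise.
\<close>

section \<open>Strassen couplings on finitely many cells\<close>

definition transport_plan ::
  "'i set \<Rightarrow> 'j set \<Rightarrow> ('i \<times> 'j) set \<Rightarrow> ('i \<Rightarrow> real) \<Rightarrow> ('j \<Rightarrow> real) \<Rightarrow> ('i \<Rightarrow> 'j \<Rightarrow> real) \<Rightarrow> bool" where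
  "transport_plan I J R a b q \<longleftrightarrow>
     (\<forall>i j. 0 \<le> q i j) \<and> (\<forall>i j. q i j \<noteq> 0 \<longrightarrow> i \<in> I \<and> j \<in> J \<and> (i, j) \<in> R) \<and>
     (\<forall>i\<in>I. (\<Sum>j\<in>J. q i j) = a i) \<and> (\<forall>j\<in>J. (\<Sum>i\<in>I. q i j) \<le> b j)"

lemma transport_plan_shrink_sources:
  assumes "transport_plan (I - {i}) J R a b q" "finite I" "i \<in> I" "a i = 0"
  shows "transport_plan I J R a b q"
  unfolding transport_plan_def
proof (intro conjI allI impI ballI)
  note q = assms(1)[unfolded transport_plan_def]
  show "0 \<le> q i' j" for i' j using q by blast
  show "i' \<in> I" "j \<in> J" "(i', j) \<in> R" if "q i' j \<noteq> 0" for i' j using q that by blast+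
  have z: "q i j = 0" for j using q by blast
  show "(\<Sum>j\<in>J. q i' j) = a i'" if "i' \<in> I" for i'
    using q z that assms(4) by (cases "i' = i") auto
  show "(\<Sum>i\<in>I. q i j) \<le> b j" if "j \<in> J" for j
    using q z that assms(2,3) by (simp add: sum.remove)
qed

lemma transport_plan_shrink_targets:
  assumes "transport_plan I (J - {j}) R a b q" "finite J" "j \<in> J" "0 \<le> b j"
  shows "transport_plan I J R a b q"
  unfolding transport_plan_def
proof (intro conjI allI impI ballI)
  note q = assms(1)[unfolded transport_plan_def]
  show "0 \<le> q i j'" for i j' using q by blast
  show "i \<in> I" "j' \<in> J" "(i, j') \<in> R" if "q i j' \<noteq> 0" for i j' using q that by blast+
  have z: "q i j = 0" for i using q by blast
  show "(\<Sum>j\<in>J. q i j) = a i" if "i \<in> I" for i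
    using q z that assms(2,3) by (simp add: sum.remove)
  show "(\<Sum>i\<in>I. q i j') \<le> b j'" if "j' \<in> J" for j'
    using q z that assms(4) by (cases "j' = j") auto
qed

lemma transport_plan_union:
  assumes q1: "transport_plan A K R a b q1" and q2: "transport_plan (I - A) (J - K) R a b q2"
    and "finite I" "finite J" "A \<subseteq> I" "K \<subseteq> J"
  shows "transport_plan I J R a b (\<lambda>i j. q1 i j + q2 i j)"
proof -
  note q = q1[unfolded transport_plan_def] q2[unfolded transport_plan_def]
  have [simp]: "finite A" "finite K" using assms finite_subset by blast+
  have z1: "q1 i j = 0" if "i \<notin> A \<or> j \<notin> K" for i j using q that by blast
  have z2: "q2 i j = 0" if "i \<in> A \<or> j \<in> K" for i j using q that by blast
  have row: "i \<in> A \<Longrightarrow> (\<Sum>j\<in>K. q1 i j) = a i"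
    "i \<in> I - A \<Longrightarrow> (\<Sum>j\<in>J - K. q2 i j) = a i" for i using q by blast+
  have col: "j \<in> K \<Longrightarrow> (\<Sum>i\<in>A. q1 i j) \<le> b j"
    "j \<in> J - K \<Longrightarrow> (\<Sum>i\<in>I - A. q2 i j) \<le> b j" for j using q by blast+
  have rows: "(\<Sum>j\<in>J. q1 i j + q2 i j) = a i" if "i \<in> I" for i
  proof -
    have "(\<Sum>j\<in>J. q1 i j + q2 i j) = (\<Sum>j\<in>K. q1 i j) + (\<Sum>j\<in>J - K. q2 i j)"
      unfolding sum.distrib using assms(4,6) z1 z2
      by (intro arg_cong2[of _ _ _ _ "(+)"] sum.mono_neutral_right) auto
    also have "\<dots> = a i" using row that z1 z2 by (cases "i \<in> A") auto
    finally show ?thesis .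
  qed
  have cols: "(\<Sum>i\<in>I. q1 i j + q2 i j) \<le> b j" if "j \<in> J" for j
  proof -
    have "(\<Sum>i\<in>I. q1 i j + q2 i j) = (\<Sum>i\<in>A. q1 i j) + (\<Sum>i\<in>I - A. q2 i j)"
      unfolding sum.distrib using assms(3,5) z1 z2
      by (intro arg_cong2[of _ _ _ _ "(+)"] sum.mono_neutral_right) auto
    also have "\<dots> \<le> b j" using col that z1 z2 by (cases "j \<in> K") auto
    finally show ?thesis .
  qed
  show ?thesis unfolding transport_plan_def
  proof (intro conjI allI impI ballI)
    show "0 \<le> q1 i j + q2 i j" for i j using q by (simp add: add_nonneg_nonneg)
    show "i \<in> I" "j \<in> J" "(i, j) \<in> R" if "q1 i j + q2 i j \<noteq> 0" for i j
    proof -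
      have "q1 i j \<noteq> 0 \<or> q2 i j \<noteq> 0" using that by auto
      thus "i \<in> I" "j \<in> J" "(i, j) \<in> R" using q assms(5,6) by blast+
    qed
  qed (use rows cols in auto)
qed

lemma transport_plan_add_edge:
  assumes "transport_plan I J R (a(i := a i - t)) (b(j := b j - t)) q"
    and "finite I" "finite J" "i \<in> I" "j \<in> J" "(i, j) \<in> R" "0 \<le> t"
  shows "transport_plan I J R a b (\<lambda>i' j'. q i' j' + (if i' = i \<and> j' = j then t else 0))"
  unfolding transport_plan_def
proof (intro conjI allI impI ballI)
  note q = assms(1)[unfolded transport_plan_def]
  show "0 \<le> q i' j' + (if i' = i \<and> j' = j then t else 0)" for i' j'
    using q assms(7) by (simp add: add_nonneg_nonneg)
  show "i' \<in> I" "j' \<in> J" "(i', j') \<in> R" if "q i' j' + (if i' = i \<and> j' = j then t else 0) \<noteq> 0" for i' j'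
  proof -
    have "q i' j' \<noteq> 0 \<or> i' = i \<and> j' = j" using that by (auto split: if_splits)
    thus "i' \<in> I" "j' \<in> J" "(i', j') \<in> R" using q assms by blast+
  qed
  show "(\<Sum>j'\<in>J. q i' j' + (if i' = i \<and> j' = j then t else 0)) = a i'" if "i' \<in> I" for i'
    using q that assms by (cases "i' = i") (auto simp: sum.distrib)
  show "(\<Sum>i'\<in>I. q i' j' + (if i' = i \<and> j' = j then t else 0)) \<le> b j'" if "j' \<in> J" for j'
    using q that assms by (cases "j' = j") (auto simp: sum.distrib)
qed

lemma sum_fun_upd_diff:
  fixes a :: "'i \<Rightarrow> real"
  assumes "finite A"
  shows "sum (a(i := a i - t)) A = sum a A - (if i \<in> A then t else 0)"
proof (cases "i \<in> A")
  case True
  have "sum (a(i := a i - t)) (A - {i}) = sum a (A - {i})" by (intro sum.cong) auto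
  thus ?thesis using True assms sum.remove[of A i a] sum.remove[of A i "a(i := a i - t)"] by simp
next
  case False
  hence "sum (a(i := a i - t)) A = sum a A" by (intro sum.cong) auto
  thus ?thesis using False by simp
qed

text \<open>
  As much mass as Hall's condition permits is pushed along a single
  edge; then a source or a target is exhausted, or a tight set splits the problem in two.
\<close>

theorem weighted_hall:
  fixes a :: "'i \<Rightarrow> real" and b :: "'j \<Rightarrow> real"
  assumes "finite I" "finite J" "\<And>i. i \<in> I \<Longrightarrow> 0 \<le> a i" "\<And>j. j \<in> J \<Longrightarrow> 0 \<le> b j"
    and "\<And>A. A \<subseteq> I \<Longrightarrow> sum a A \<le> sum b (R `` A \<inter> J)"
  shows "\<exists>q. transport_plan I J R a b q"
  using assms
proof (induction "card I + card J" arbitrary: I J a b rule: less_induct)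
  case less
  note fin[simp] = less.prems(1,2) and a0 = less.prems(3) and b0 = less.prems(4) and hall = less.prems(5)
  show ?case
  proof (cases "I = {}")
    case True
    thus ?thesis using b0 by (intro exI[of _ "\<lambda>_ _. 0"]) (auto simp: transport_plan_def)
  next
    case False
    then obtain i where i: "i \<in> I" by blast
    have rem_source: "\<exists>q. transport_plan I J R a' b' q"
      if "a' i = 0" "\<And>i. i \<in> I \<Longrightarrow> 0 \<le> a' i" "\<And>j. j \<in> J \<Longrightarrow> 0 \<le> b' j"
         "\<And>A. A \<subseteq> I \<Longrightarrow> sum a' A \<le> sum b' (R `` A \<inter> J)" for a' b'
    proof -
      have "card (I - {i}) + card J < card I + card J"
        using card_Diff1_less[OF fin(1) i] by simp
      moreover have "sum a' A \<le> sum b' (R `` A \<inter> J)" if "A \<subseteq> I - {i}" for A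
        using that \<open>\<And>A. A \<subseteq> I \<Longrightarrow> sum a' A \<le> sum b' (R `` A \<inter> J)\<close> by blast
      ultimately have "\<exists>q. transport_plan (I - {i}) J R a' b' q"
        using that by (intro less.hyps) auto
      thus ?thesis using transport_plan_shrink_sources[of I i J R a' b'] i that(1) by auto
    qed
    show ?thesis
    proof (cases "a i = 0")
      case True
      thus ?thesis using rem_source[of a b] a0 b0 hall by blast
    next
      case False
      hence "0 < sum b (R `` {i} \<inter> J)" using hall[of "{i}"] a0[OF i] i by simp
      then obtain j where j: "j \<in> J" "(i, j) \<in> R"
        by (metis Image_singleton_iff Int_iff ex_in_conv less_irrefl sum.empty)
      define \<A> where "\<A> = {A. A \<subseteq> I - {i} \<and> j \<in> R `` A}"
      define T where "T = {a i, b j} \<union> (\<lambda>A. sum b (R `` A \<inter> J) - sum a A) ` \<A>"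
      define t where "t = Min T"
      have "finite \<A>" unfolding \<A>_def by simp
      hence finT: "finite T" "T \<noteq> {}" unfolding T_def by auto
      have t0: "0 \<le> t" unfolding t_def using finT a0[OF i] b0[OF j(1)] hall
        by (auto simp: T_def \<A>_def)
      have t_le: "t \<le> x" if "x \<in> T" for x unfolding t_def using finT that by simp
      have t_in: "t \<in> T" unfolding t_def using finT by (rule Min_in)
      define a' where "a' = a(i := a i - t)"
      define b' where "b' = b(j := b j - t)"
      have a'0: "0 \<le> a' i'" if "i' \<in> I" for i'
        using that a0 t_le[of "a i"] by (auto simp: a'_def T_def)
      have b'0: "0 \<le> b' j'" if "j' \<in> J" for j'
        using that b0 t_le[of "b j"] by (auto simp: b'_def T_def)
      have sum_a': "sum a' A = sum a A - (if i \<in> A then t else 0)" if "finite A" for A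
        unfolding a'_def by (rule sum_fun_upd_diff[OF that])
      have sum_b': "sum b' K = sum b K - (if j \<in> K then t else 0)" if "finite K" for K
        unfolding b'_def by (rule sum_fun_upd_diff[OF that])
      have hall': "sum a' A \<le> sum b' (R `` A \<inter> J)" if A: "A \<subseteq> I" for A
      proof -
        have fA: "finite A" "finite (R `` A \<inter> J)" using A finite_subset fin by blast+
        have "sum b (R `` A \<inter> J) - sum a A \<ge> t" if "i \<notin> A" "j \<in> R `` A"
          using that A by (intro t_le) (auto simp: T_def \<A>_def)
        moreover have "j \<in> R `` A" if "i \<in> A" using that j by blast
        ultimately show ?thesis
          unfolding sum_a'[OF fA(1)] sum_b'[OF fA(2)] using hall[OF A] j(1) t0
          by (cases "i \<in> A"; cases "j \<in> R `` A") simp_all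
      qed
      have "\<exists>q. transport_plan I J R a' b' q"
      proof -
        consider "t = a i" | "t = b j" | A where "A \<subseteq> I - {i}" "j \<in> R `` A"
          "t = sum b (R `` A \<inter> J) - sum a A"
          using t_in unfolding T_def \<A>_def by (elim UnE imageE insertE CollectE conjE emptyE) metis+
        thus ?thesis
        proof cases
          case 1
          thus ?thesis by (intro rem_source a'0 b'0 hall') (simp_all add: a'_def)
        next
          case 2
          have z: "b' j = 0" using 2 by (simp add: b'_def)
          have "card I + card (J - {j}) < card I + card J"
            using j by (metis add_less_cancel_left card_Diff1_less fin(2))
          moreover have "sum a' A \<le> sum b' (R `` A \<inter> (J - {j}))" if "A \<subseteq> I" for A
          proof -
            have "sum b' (R `` A \<inter> (J - {j})) = sum b' (R `` A \<inter> J)"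
              using z by (intro sum.mono_neutral_left) auto
            thus ?thesis using hall'[OF that] by simp
          qed
          ultimately have "\<exists>q. transport_plan I (J - {j}) R a' b' q"
            using a'0 b'0 by (intro less.hyps) auto
          thus ?thesis using transport_plan_shrink_targets[of I J j R a' b'] j(1) z by auto
        next
          case 3
          have A: "A \<subseteq> I" "A \<noteq> {}" "A \<noteq> I" using 3 i by auto
          have [simp]: "finite A" using A finite_subset fin by blast
          define K where "K = R `` A \<inter> J"
          have KJ: "K \<subseteq> J" "finite K" by (auto simp: K_def)
          have tight: "sum a' A = sum b' K"
            unfolding sum_a'[OF \<open>finite A\<close>] sum_b'[OF KJ(2)] using 3 j(1) by (auto simp: K_def)
          have c1: "card A < card I" "card K \<le> card J" using A KJ by (auto intro: psubset_card_mono card_mono)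
          have c2: "card (I - A) < card I" "card (J - K) \<le> card J"
            using A by (auto intro!: psubset_card_mono card_mono)
          have "\<exists>q. transport_plan A K R a' b' q"
          proof (rule less.hyps)
            show "sum a' A' \<le> sum b' (R `` A' \<inter> K)" if "A' \<subseteq> A" for A'
            proof -
              have "R `` A' \<inter> K = R `` A' \<inter> J" using that by (auto simp: K_def)
              thus ?thesis using hall'[of A'] that A by auto
            qed
          qed (use c1 A KJ a'0 b'0 in auto)
          then obtain q1 where q1: "transport_plan A K R a' b' q1" ..
          have "\<exists>q. transport_plan (I - A) (J - K) R a' b' q"
          proof (rule less.hyps)
            show "sum a' A' \<le> sum b' (R `` A' \<inter> (J - K))" if A': "A' \<subseteq> I - A" for A'
            proof -
              have fA': "finite A'" using A' fin finite_subset by blast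
              have "sum a' A' + sum a' A = sum a' (A' \<union> A)"
                using A' fA' by (intro sum.union_disjoint[symmetric]) auto
              also have "\<dots> \<le> sum b' (R `` (A' \<union> A) \<inter> J)" using A A' by (intro hall') auto
              also have "R `` (A' \<union> A) \<inter> J = (R `` A' \<inter> (J - K)) \<union> K" by (auto simp: K_def)
              also have "sum b' \<dots> = sum b' (R `` A' \<inter> (J - K)) + sum b' K"
                using KJ by (intro sum.union_disjoint) auto
              finally show ?thesis using tight by simp
            qed
          qed (use c2 a'0 b'0 in auto)
          then obtain q2 where "transport_plan (I - A) (J - K) R a' b' q2" ..
          from transport_plan_union[OF q1 this fin A(1) KJ(1)] show ?thesis
            by (rule exI[of "transport_plan I J R a' b'"])
        qed
      qed
      then obtain q where "transport_plan I J R a' b' q" ..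
      from transport_plan_add_edge[OF this[unfolded a'_def b'_def] fin i j t0] show ?thesis
        by (rule exI[of "transport_plan I J R a b"])
    qed
  qed
qed

text \<open>The extra target absorbs the defect \<open>\<eta>\<close>.\<close>

lemma finite_strassen:
  fixes a b :: "'k \<Rightarrow> real"
  assumes D: "finite D" and a0: "\<And>k. k \<in> D \<Longrightarrow> 0 \<le> a k" and b0: "\<And>k. k \<in> D \<Longrightarrow> 0 \<le> b k"
    and eq: "sum a D = sum b D" and \<eta>: "0 \<le> \<eta>"
    and hall: "\<And>A. A \<subseteq> D \<Longrightarrow> sum a A \<le> sum b (R `` A \<inter> D) + \<eta>"
  obtains w where "\<And>k l. k \<in> D \<Longrightarrow> l \<in> D \<Longrightarrow> 0 \<le> w k l" "\<And>k. k \<in> D \<Longrightarrow> (\<Sum>l\<in>D. w k l) = a k"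
    "\<And>l. l \<in> D \<Longrightarrow> (\<Sum>k\<in>D. w k l) = b l"
    "(\<Sum>(k, l)\<in>D \<times> D - R. w k l) \<le> \<eta>"
proof -
  define J where "J = insert None (Some ` D)"
  define b' where "b' = case_option \<eta> b"
  define R' where "R' = {(k, l). case l of None \<Rightarrow> True | Some l \<Rightarrow> (k, l) \<in> R}"
  have sumJ: "sum g J = g None + (\<Sum>l\<in>D. g (Some l))" for g :: "'k option \<Rightarrow> real"
    unfolding J_def using D by (subst sum.insert) (auto simp: sum.reindex)
  have "\<exists>q. transport_plan D J R' a b' q"
  proof (rule weighted_hall)
    show "sum a A \<le> sum b' (R' `` A \<inter> J)" if A: "A \<subseteq> D" for A
    proof (cases "A = {}")
      case False
      hence "R' `` A \<inter> J = insert None (Some ` (R `` A \<inter> D))" by (auto simp: R'_def J_def image_iff)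
      also have "sum b' \<dots> = \<eta> + sum b (R `` A \<inter> D)"
        using D by (subst sum.insert) (auto simp: sum.reindex b'_def)
      finally show ?thesis using hall[OF A] by simp
    qed simp
  qed (use D a0 b0 \<eta> in \<open>auto simp: J_def b'_def\<close>)
  then obtain q where "transport_plan D J R' a b' q" ..
  hence q0: "0 \<le> q k l" and supp: "q k l \<noteq> 0 \<Longrightarrow> k \<in> D \<and> l \<in> J \<and> (k, l) \<in> R'"
    and rows: "k \<in> D \<Longrightarrow> (\<Sum>l\<in>J. q k l) = a k" and cols: "l \<in> J \<Longrightarrow> (\<Sum>k\<in>D. q k l) \<le> b' l"
    for k l by (auto simp: transport_plan_def)
  define p where "p k l = q k (Some l)" for k l
  have p0: "0 \<le> p k l" for k l using q0 by (simp add: p_def)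
  have pR: "p k l = 0" if "(k, l) \<notin> R" for k l
    using supp[of k "Some l"] that by (auto simp: p_def R'_def)
  define d where "d k = q k None" for k
  have d0: "0 \<le> d k" for k using q0 by (simp add: d_def)
  have d: "(\<Sum>l\<in>D. p k l) = a k - d k" if "k \<in> D" for k
    using rows[OF that] by (simp add: sumJ p_def d_def)
  define e where "e l = b l - (\<Sum>k\<in>D. p k l)" for l
  have e0: "0 \<le> e l" if "l \<in> D" for l
    using cols[of "Some l"] that by (auto simp: e_def p_def b'_def J_def)
  define s where "s = sum d D"
  have s\<eta>: "s \<le> \<eta>" using cols[of None] by (simp add: s_def d_def b'_def J_def)
  have s0: "0 \<le> s" unfolding s_def using d0 by (rule sum_nonneg)
  have "sum e D = sum b D - (\<Sum>k\<in>D. \<Sum>l\<in>D. p k l)"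
    unfolding e_def sum_subtractf by (subst sum.swap) simp
  also have "(\<Sum>k\<in>D. \<Sum>l\<in>D. p k l) = sum a D - s" by (simp add: d sum_subtractf s_def)
  finally have es: "sum e D = s" using eq by simp
  have ds: "d k * s / s = d k" if "k \<in> D" for k
  proof (cases "s = 0")
    case True
    hence "d k = 0" using that D d0 sum_nonneg_eq_0_iff[of D d] by (simp add: s_def)
    thus ?thesis by simp
  qed simp
  have "e l * s / s = e l" if "l \<in> D" for l
  proof (cases "s = 0")
    case True
    hence "e l = 0" using that D e0 sum_nonneg_eq_0_iff[of D e] es by simp
    thus ?thesis by simp
  qed simp
  hence es': "s * e l / s = e l" if "l \<in> D" for l using that by (simp add: mult.commute)
  define w where "w k l = p k l + d k * e l / s" for k l
  show thesis
  proof (rule that[of w])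
    show "0 \<le> w k l" if "k \<in> D" "l \<in> D" for k l using that p0 d0 e0 s0 by (simp add: w_def)
    show "(\<Sum>l\<in>D. w k l) = a k" if "k \<in> D" for k
    proof -
      have "(\<Sum>l\<in>D. w k l) = a k - d k + d k * sum e D / s"
        by (simp add: w_def sum.distrib d that sum_distrib_left sum_divide_distrib)
      thus ?thesis using ds that es by simp
    qed
    show "(\<Sum>k\<in>D. w k l) = b l" if "l \<in> D" for l
    proof -
      have "(\<Sum>k\<in>D. w k l) = b l - e l + sum d D * e l / s"
        by (simp add: w_def sum.distrib e_def sum_distrib_right sum_divide_distrib)
      thus ?thesis using es' that by (simp add: s_def)
    qed
    have "(\<Sum>(k, l)\<in>D \<times> D - R. w k l) = (\<Sum>(k, l)\<in>D \<times> D - R. d k * e l / s)"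
      by (rule sum.cong) (auto simp: w_def pR)
    also have "\<dots> \<le> (\<Sum>(k, l)\<in>D \<times> D. d k * e l / s)"
      using D d0 e0 s0 by (intro sum_mono2) auto
    also have "\<dots> = (\<Sum>k\<in>D. d k * s / s)"
      by (simp flip: sum.cartesian_product sum_divide_distrib sum_distrib_left add: es)
    also have "\<dots> = s" unfolding s_def[symmetric] by (subst sum.cong[OF refl ds]) (simp_all add: s_def)
    also have "\<dots> \<le> \<eta>" by (rule s\<eta>)
    finally show "(\<Sum>(k, l)\<in>D \<times> D - R. w k l) \<le> \<eta>" .
  qed
qed

lemma quantile_transform:
  assumes U[measurable]: "U \<in> borel_measurable M"
    and unif: "distr M lborel U = uniform_measure lborel {0<..<1::real}"
    and "real_distribution \<nu>"
  obtains Q :: "real \<Rightarrow> real" where "Q \<in> borel_measurable borel" "distr M borel (\<lambda>\<omega>. Q (U \<omega>)) = \<nu>"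
proof -
  interpret cdf_distribution \<nu> unfolding cdf_distribution_def by fact
  define Q where "Q u = (if u \<in> {0<..<1} then I u else 0)" for u
  have Q[measurable]: "Q \<in> borel_measurable borel"
  proof -
    have "{x. x \<in> {0<..<1::real}} = {0<..<1}" by auto
    thus ?thesis unfolding Q_def
      by (subst measurable_If_restrict_space_iff) (simp_all add: measurable_CI)
  qed
  have I_meas: "I \<in> borel_measurable (restrict_space lborel {0<..<1})"
    using measurable_CI by (simp cong: measurable_cong_sets sets_restrict_space_cong)
  have "distr M borel (\<lambda>\<omega>. Q (U \<omega>)) = distr (distr M lborel U) borel Q"
    by (subst distr_distr) (auto simp: comp_def)
  also have "\<dots> = distr (restrict_space lborel {0<..<1::real}) borel I"
  proof (rule measure_eqI)
    fix A assume "A \<in> sets (distr (distr M lborel U) borel Q)"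
    hence A[measurable]: "A \<in> sets borel" by simp
    have m: "Q -` A \<in> sets borel" using measurable_sets[OF Q A] by simp
    have "emeasure (distr (distr M lborel U) borel Q) A = emeasure lborel ({0<..<1} \<inter> Q -` A)"
      unfolding unif by (subst emeasure_distr) (use m in \<open>auto simp: divide_ennreal_def\<close>)
    also have "{0<..<1} \<inter> Q -` A = I -` A \<inter> {0<..<1}" by (auto simp: Q_def)
    also have "emeasure lborel \<dots> = emeasure (distr (restrict_space lborel {0<..<1}) borel I) A"
      by (subst emeasure_distr[OF I_meas]) (auto simp: space_restrict_space emeasure_restrict_space)
    finally show "emeasure (distr (distr M lborel U) borel Q) A =
      emeasure (distr (restrict_space lborel {0<..<1}) borel I) A" .
  qed simp
  also have "\<dots> = \<nu>" by (rule distr_I_eq_M)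
  finally show ?thesis using Q that by blast
qed

lemma (in prob_space) prob_fiber_sum:
  assumes [measurable]: "g \<in> measurable M (count_space UNIV)" and "finite D" "\<And>\<omega>. \<omega> \<in> space M \<Longrightarrow> g \<omega> \<in> D"
    and "{\<omega> \<in> space M. P \<omega>} \<in> events"
  shows "prob {\<omega> \<in> space M. P \<omega>} = (\<Sum>k\<in>D. prob {\<omega> \<in> space M. g \<omega> = k \<and> P \<omega>})"
proof -
  have "{\<omega> \<in> space M. P \<omega>} = (\<Union>k\<in>D. {\<omega> \<in> space M. g \<omega> = k \<and> P \<omega>})" using assms by auto
  also have "prob \<dots> = (\<Sum>k\<in>D. prob {\<omega> \<in> space M. g \<omega> = k \<and> P \<omega>})"
  proof (rule finite_measure_finite_Union)
    show "(\<lambda>k. {\<omega> \<in> space M. g \<omega> = k \<and> P \<omega>}) ` D \<subseteq> events"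
    proof safe
      fix k
      have "{\<omega> \<in> space M. g \<omega> = k \<and> P \<omega>} = {\<omega> \<in> space M. g \<omega> = k} \<inter> {\<omega> \<in> space M. P \<omega>}" by auto
      also have "\<dots> \<in> events" using assms by (intro sets.Int) auto
      finally show "{\<omega> \<in> space M. g \<omega> = k \<and> P \<omega>} \<in> events" .
    qed
  qed (use assms in \<open>auto simp: disjoint_family_on_def\<close>)
  finally show ?thesis .
qed

text \<open>
  Given that \<open>Z\<close> lies in cell \<open>k\<close>, the coupled variable is drawn from \<open>\<nu>\<close> reweighted on each cell
  according to the finite transport plan, by a quantile transform of the independent \<open>U\<close>.
\<close>

theorem (in prob_space) strassen_coupling:
  fixes c :: "real \<Rightarrow> 'k" and U Z :: "'a \<Rightarrow> real"
  assumes U[measurable]: "U \<in> borel_measurable M"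
    and unif: "distr M lborel U = uniform_measure lborel {0<..<1::real}"
    and Z[measurable]: "Z \<in> borel_measurable M"
    and indep: "\<And>A B. A \<in> sets borel \<Longrightarrow> B \<in> sets borel \<Longrightarrow>
      prob {\<omega> \<in> space M. Z \<omega> \<in> A \<and> U \<omega> \<in> B} = prob {\<omega> \<in> space M. Z \<omega> \<in> A} * prob {\<omega> \<in> space M. U \<omega> \<in> B}"
    and \<nu>: "real_distribution \<nu>"
    and c[measurable]: "c \<in> measurable borel (count_space UNIV)" and D: "finite D" "\<And>x. c x \<in> D"
    and \<eta>: "0 \<le> \<eta>"
    and hall: "\<And>A. A \<subseteq> D \<Longrightarrow> prob {\<omega> \<in> space M. c (Z \<omega>) \<in> A} \<le> measure \<nu> {t. c t \<in> R `` A} + \<eta>"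
  shows "\<exists>Z'\<in>borel_measurable M. distr M borel Z' = \<nu> \<and>
    {\<omega> \<in> space M. (c (Z \<omega>), c (Z' \<omega>)) \<notin> R} \<in> events \<and>
    prob {\<omega> \<in> space M. (c (Z \<omega>), c (Z' \<omega>)) \<notin> R} \<le> \<eta>"
proof -
  interpret \<nu>: real_distribution \<nu> by fact
  have [simp]: "space \<nu> = UNIV" "sets \<nu> = sets borel" by simp_all
  have cm[measurable]: "c \<in> measurable \<nu> (count_space UNIV)"
    using c by (simp add: measurable_cong_sets[OF \<nu>.events_eq_borel refl])
  define a where "a k = prob {\<omega> \<in> space M. c (Z \<omega>) = k}" for k
  define b where "b k = measure \<nu> {t. c t = k}" for k
  have csets: "{t. P (c t)} \<in> sets borel" for P
    using measurable_sets[OF c, of "{k. P k}"] by (simp add: vimage_def)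
  have cZ[measurable]: "(\<lambda>\<omega>. c (Z \<omega>)) \<in> measurable M (count_space UNIV)" by measurable
  have sum_a: "prob {\<omega> \<in> space M. c (Z \<omega>) \<in> A} = sum a A" if "A \<subseteq> D" for A
  proof -
    have "prob {\<omega> \<in> space M. c (Z \<omega>) \<in> A} = (\<Sum>k\<in>D. prob {\<omega> \<in> space M. c (Z \<omega>) = k \<and> c (Z \<omega>) \<in> A})"
      using D measurable_sets[OF cZ, of A]
      by (intro prob_fiber_sum) (simp_all add: vimage_def Int_def conj_commute)
    also have "\<dots> = (\<Sum>k\<in>A. a k)"
    proof (intro sum.mono_neutral_cong_right)
      show "\<forall>k\<in>D - A. prob {\<omega> \<in> space M. c (Z \<omega>) = k \<and> c (Z \<omega>) \<in> A} = 0"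
      proof
        fix k assume "k \<in> D - A"
        hence "{\<omega> \<in> space M. c (Z \<omega>) = k \<and> c (Z \<omega>) \<in> A} = {}" by auto
        thus "prob {\<omega> \<in> space M. c (Z \<omega>) = k \<and> c (Z \<omega>) \<in> A} = 0" by (simp only: measure_empty)
      qed
    qed (use that D in \<open>auto simp: a_def intro!: arg_cong[of _ _ prob]\<close>)
    finally show ?thesis .
  qed
  have sum_b: "measure \<nu> {t. c t \<in> A} = sum b (A \<inter> D)" for A
  proof -
    have "\<nu>.prob {t \<in> space \<nu>. c t \<in> A} = (\<Sum>k\<in>D. \<nu>.prob {t \<in> space \<nu>. c t = k \<and> c t \<in> A})"
      using D csets by (intro \<nu>.prob_fiber_sum) auto
    also have "\<dots> = (\<Sum>k\<in>A \<inter> D. b k)"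
    proof (intro sum.mono_neutral_cong_right)
      show "\<forall>k\<in>D - A \<inter> D. \<nu>.prob {t \<in> space \<nu>. c t = k \<and> c t \<in> A} = 0"
      proof
        fix k assume "k \<in> D - A \<inter> D"
        hence "{t \<in> space \<nu>. c t = k \<and> c t \<in> A} = {}" by auto
        thus "\<nu>.prob {t \<in> space \<nu>. c t = k \<and> c t \<in> A} = 0" by (simp only: measure_empty)
      qed
    qed (use D in \<open>auto simp: b_def intro!: arg_cong[of _ _ \<nu>.prob]\<close>)
    finally show ?thesis by simp
  qed
  have a0: "0 \<le> a k" and b0: "0 \<le> b k" for k by (simp_all add: a_def b_def)
  have "sum a D = 1" using sum_a[of D] D by (simp add: prob_space)
  moreover have "sum b D = 1" using sum_b[of D] D \<nu>.prob_space by simp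
  moreover have "sum a A \<le> sum b (R `` A \<inter> D) + \<eta>" if "A \<subseteq> D" for A
    using hall[OF that] sum_a[OF that] sum_b[of "R `` A"] by simp
  ultimately obtain w where w0: "\<And>k l. k \<in> D \<Longrightarrow> l \<in> D \<Longrightarrow> 0 \<le> w k l"
    and wa: "\<And>k. k \<in> D \<Longrightarrow> (\<Sum>l\<in>D. w k l) = a k" and wb: "\<And>l. l \<in> D \<Longrightarrow> (\<Sum>k\<in>D. w k l) = b l"
    and wR: "(\<Sum>(k, l)\<in>D \<times> D - R. w k l) \<le> \<eta>"
    using finite_strassen[of D a b \<eta> R] D a0 b0 \<eta> by metis
  have wz: "w k l = 0" if "k \<in> D" "l \<in> D" "a k = 0 \<or> b l = 0" for k l
  proof -
    have "w k l \<le> a k"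
      unfolding wa[OF that(1), symmetric] by (rule member_le_sum) (use that w0 D in auto)
    moreover have "w k l \<le> b l"
      unfolding wb[OF that(2), symmetric]
      by (rule member_le_sum[of k D "\<lambda>k. w k l"]) (use that w0 D in auto)
    ultimately show ?thesis using that w0[of k l] by auto
  qed
  define g where "g k t = w k (c t) / (a k * b (c t))" for k t
  have g_meas[measurable]: "g k \<in> borel_measurable \<nu>" for k
    unfolding g_def using measurable_compose[OF cm, of "\<lambda>l. w k l / (a k * b l)" borel] by simp
  have g0: "0 \<le> g k t" if "k \<in> D" for k t using w0[OF that D(2)] a0 b0 by (simp add: g_def)
  have int_g: "(\<integral>\<^sup>+t. ennreal (g k t) * indicator B t \<partial>\<nu>) =
      ennreal (\<Sum>l\<in>D. w k l / (a k * b l) * measure \<nu> {t. c t = l \<and> t \<in> B})"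
    if k: "k \<in> D" and B: "B \<in> sets borel" for k B
  proof -
    have Bl: "{t. c t = l \<and> t \<in> B} \<in> sets borel" for l
      using sets.Int[OF csets[of "\<lambda>k. k = l"] B] by (simp add: Collect_conj_eq)
    have nn: "0 \<le> w k l / (a k * b l)" if "l \<in> D" for l using w0[OF k that] a0 b0 by simp
    have "ennreal (g k t) * indicator B t =
       (\<Sum>l\<in>D. ennreal (w k l / (a k * b l)) * indicator {t. c t = l \<and> t \<in> B} t)" for t
    proof -
      have "(\<Sum>l\<in>D. ennreal (w k l / (a k * b l)) * indicator {t. c t = l \<and> t \<in> B} t) =
        (\<Sum>l\<in>{c t}. ennreal (w k l / (a k * b l)) * indicator {t. c t = l \<and> t \<in> B} t)"
        using D by (intro sum.mono_neutral_right) (auto simp: indicator_def)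
      thus ?thesis by (simp add: g_def indicator_def)
    qed
    hence "(\<integral>\<^sup>+t. ennreal (g k t) * indicator B t \<partial>\<nu>) =
      (\<Sum>l\<in>D. ennreal (w k l / (a k * b l)) * emeasure \<nu> {t. c t = l \<and> t \<in> B})"
      using Bl by (simp add: nn_integral_sum nn_integral_cmult_indicator)
    also have "\<dots> = (\<Sum>l\<in>D. ennreal (w k l / (a k * b l) * measure \<nu> {t. c t = l \<and> t \<in> B}))"
      unfolding \<nu>.emeasure_eq_measure
      by (intro sum.cong refl ennreal_mult[symmetric]) (use nn in auto)
    also have "\<dots> = ennreal (\<Sum>l\<in>D. w k l / (a k * b l) * measure \<nu> {t. c t = l \<and> t \<in> B})"
      by (intro sum_ennreal mult_nonneg_nonneg nn) auto
    finally show ?thesis .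
  qed
  define \<kappa> where "\<kappa> k = (if a k = 0 then \<nu> else density \<nu> (\<lambda>t. ennreal (g k t)))" for k
  have \<kappa>_dist: "real_distribution (\<kappa> k)" if k: "k \<in> D" for k
  proof (cases "a k = 0")
    case False
    have "emeasure (density \<nu> (\<lambda>t. ennreal (g k t))) UNIV = (\<integral>\<^sup>+t. ennreal (g k t) * indicator UNIV t \<partial>\<nu>)"
      by (subst emeasure_density) auto
    also have "\<dots> = ennreal (\<Sum>l\<in>D. w k l / (a k * b l) * b l)"
      by (subst int_g[OF k]) (auto simp: b_def)
    also have "(\<Sum>l\<in>D. w k l / (a k * b l) * b l) = (\<Sum>l\<in>D. w k l / a k)"
      using wz[OF k] by (intro sum.cong) auto
    also have "\<dots> = 1" using False wa[OF k] by (simp flip: sum_divide_distrib)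
    finally have "prob_space (\<kappa> k)" using False by (intro prob_spaceI) (simp add: \<kappa>_def)
    thus ?thesis using False by (simp add: real_distribution_def real_distribution_axioms_def \<kappa>_def)
  qed (simp add: \<kappa>_def \<nu>)
  have "\<exists>Q. Q \<in> borel_measurable borel \<and> distr M borel (\<lambda>\<omega>. Q (U \<omega>)) = \<kappa> k" if "k \<in> D" for k
    using quantile_transform[OF U unif \<kappa>_dist[OF that]] by blast
  then obtain Q :: "'k \<Rightarrow> real \<Rightarrow> real" where Q: "\<And>k. k \<in> D \<Longrightarrow> Q k \<in> borel_measurable borel"
    and Qd: "\<And>k. k \<in> D \<Longrightarrow> distr M borel (\<lambda>\<omega>. Q k (U \<omega>)) = \<kappa> k" by metis
  define Z' where "Z' \<omega> = Q (c (Z \<omega>)) (U \<omega>)" for \<omega>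
  have [measurable]: "Z' \<in> borel_measurable M"
  proof -
    have "Z' = (\<lambda>\<omega>. \<Sum>k\<in>D. indicator {\<omega>. c (Z \<omega>) = k} \<omega> * Q k (U \<omega>))"
    proof
      fix \<omega>
      have "(\<Sum>k\<in>D. indicator {\<omega>. c (Z \<omega>) = k} \<omega> * Q k (U \<omega>)) =
        (\<Sum>k\<in>{c (Z \<omega>)}. indicator {\<omega>. c (Z \<omega>) = k} \<omega> * Q k (U \<omega>))"
        using D by (intro sum.mono_neutral_right) auto
      thus "Z' \<omega> = (\<Sum>k\<in>D. indicator {\<omega>. c (Z \<omega>) = k} \<omega> * Q k (U \<omega>))" by (simp add: Z'_def)
    qed
    moreover have "(\<lambda>\<omega>. Q k (U \<omega>)) \<in> borel_measurable M" if "k \<in> D" for k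
      using measurable_compose[OF U Q[OF that]] .
    ultimately show ?thesis by (auto intro!: borel_measurable_sum borel_measurable_times)
  qed
  have joint: "prob {\<omega> \<in> space M. c (Z \<omega>) = k \<and> Z' \<omega> \<in> B} =
      (\<Sum>l\<in>D. w k l / b l * measure \<nu> {t. c t = l \<and> t \<in> B})"
    if k: "k \<in> D" and B[measurable]: "B \<in> sets borel" for k B
  proof -
    have QB: "Q k -` B \<in> sets borel" using measurable_sets[OF Q[OF k] B] by simp
    have QU: "(\<lambda>\<omega>. Q k (U \<omega>)) \<in> borel_measurable M" using measurable_compose[OF U Q[OF k]] .
    have "{\<omega> \<in> space M. c (Z \<omega>) = k \<and> Z' \<omega> \<in> B} =
        {\<omega> \<in> space M. Z \<omega> \<in> {x. c x = k} \<and> U \<omega> \<in> Q k -` B}" by (auto simp: Z'_def)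
    also have "prob \<dots> = a k * prob {\<omega> \<in> space M. Q k (U \<omega>) \<in> B}"
      using indep[OF csets[of "\<lambda>x. x = k"] QB] by (simp add: a_def vimage_def)
    also have "prob {\<omega> \<in> space M. Q k (U \<omega>) \<in> B} = measure (\<kappa> k) B"
      unfolding Qd[OF k, symmetric] using QU
      by (subst measure_distr) (auto intro!: arg_cong[of _ _ prob])
    also have "a k * measure (\<kappa> k) B = (\<Sum>l\<in>D. w k l / b l * measure \<nu> {t. c t = l \<and> t \<in> B})"
    proof (cases "a k = 0")
      case True
      thus ?thesis using wz[OF k] by simp
    next
      case False
      have "measure (\<kappa> k) B = enn2real (\<integral>\<^sup>+t. ennreal (g k t) * indicator B t \<partial>\<nu>)"
        using False by (simp add: \<kappa>_def measure_def emeasure_density)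
      also have "\<dots> = (\<Sum>l\<in>D. w k l / (a k * b l) * measure \<nu> {t. c t = l \<and> t \<in> B})"
        unfolding int_g[OF k B] using w0[OF k] a0 b0 by (intro enn2real_ennreal sum_nonneg) auto
      finally show ?thesis using False by (simp add: sum_distrib_left)
    qed
    finally show ?thesis .
  qed
  have law: "distr M borel Z' = \<nu>"
  proof (rule measure_eqI)
    fix B assume "B \<in> sets (distr M borel Z')"
    hence B[measurable]: "B \<in> sets borel" by simp
    have "prob {\<omega> \<in> space M. Z' \<omega> \<in> B} = (\<Sum>k\<in>D. prob {\<omega> \<in> space M. c (Z \<omega>) = k \<and> Z' \<omega> \<in> B})"
      using D by (intro prob_fiber_sum) auto
    also have "\<dots> = (\<Sum>k\<in>D. \<Sum>l\<in>D. w k l / b l * measure \<nu> {t. c t = l \<and> t \<in> B})"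
      using joint[OF _ B] by simp
    also have "\<dots> = (\<Sum>l\<in>D. (\<Sum>k\<in>D. w k l) / b l * measure \<nu> {t. c t = l \<and> t \<in> B})"
      by (subst sum.swap) (simp add: sum_distrib_right sum_divide_distrib)
    also have "\<dots> = (\<Sum>l\<in>D. measure \<nu> {t. c t = l \<and> t \<in> B})"
    proof (rule sum.cong[OF refl])
      fix l assume l: "l \<in> D"
      have "measure \<nu> {t. c t = l \<and> t \<in> B} \<le> b l"
        unfolding b_def using csets[of "\<lambda>k. k = l"] by (intro \<nu>.finite_measure_mono) auto
      hence "b l = 0 \<Longrightarrow> measure \<nu> {t. c t = l \<and> t \<in> B} = 0" by (simp add: measure_le_0_iff)
      thus "(\<Sum>k\<in>D. w k l) / b l * measure \<nu> {t. c t = l \<and> t \<in> B} = measure \<nu> {t. c t = l \<and> t \<in> B}"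
        using wb[OF l] by auto
    qed
    also have "\<dots> = \<nu>.prob {t \<in> space \<nu>. t \<in> B}"
      using D B by (subst \<nu>.prob_fiber_sum[where g = c and D = D]) auto
    finally have "prob {\<omega> \<in> space M. Z' \<omega> \<in> B} = measure \<nu> B" by simp
    moreover have "Z' -` B \<inter> space M = {\<omega> \<in> space M. Z' \<omega> \<in> B}" by auto
    ultimately show "emeasure (distr M borel Z') B = emeasure \<nu> B"
      by (simp add: emeasure_distr emeasure_eq_measure \<nu>.emeasure_eq_measure)
  qed simp
  have "{\<omega> \<in> space M. (c (Z \<omega>), c (Z' \<omega>)) \<notin> R} =
      (\<Union>(k, l)\<in>D \<times> D - R. {\<omega> \<in> space M. c (Z \<omega>) = k} \<inter> {\<omega> \<in> space M. c (Z' \<omega>) = l})"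
    using D by auto
  also have "\<dots> \<in> events" using D by (intro sets.finite_UN) auto
  finally have ev: "{\<omega> \<in> space M. (c (Z \<omega>), c (Z' \<omega>)) \<notin> R} \<in> events" .
  have "prob {\<omega> \<in> space M. (c (Z \<omega>), c (Z' \<omega>)) \<notin> R} =
     (\<Sum>k\<in>D. prob {\<omega> \<in> space M. c (Z \<omega>) = k \<and> (c (Z \<omega>), c (Z' \<omega>)) \<notin> R})"
    using D ev by (intro prob_fiber_sum) auto
  also have "\<dots> = (\<Sum>k\<in>D. \<Sum>l\<in>D. if (k, l) \<notin> R then w k l else 0)"
  proof (rule sum.cong[OF refl])
    fix k assume k: "k \<in> D"
    have "{\<omega> \<in> space M. c (Z \<omega>) = k \<and> (c (Z \<omega>), c (Z' \<omega>)) \<notin> R} =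
      {\<omega> \<in> space M. c (Z \<omega>) = k \<and> Z' \<omega> \<in> {t. (k, c t) \<notin> R}}" by auto
    also have "prob \<dots> = (\<Sum>l\<in>D. w k l / b l * measure \<nu> {t. c t = l \<and> t \<in> {t. (k, c t) \<notin> R}})"
      using joint[OF k csets] .
    also have "\<dots> = (\<Sum>l\<in>D. if (k, l) \<notin> R then w k l else 0)"
    proof (rule sum.cong[OF refl])
      fix l assume l: "l \<in> D"
      have "{t. c t = l \<and> t \<in> {t. (k, c t) \<notin> R}} = (if (k, l) \<notin> R then {t. c t = l} else {})" by auto
      thus "w k l / b l * measure \<nu> {t. c t = l \<and> t \<in> {t. (k, c t) \<notin> R}} = (if (k, l) \<notin> R then w k l else 0)"
        using wz[OF k l] by (auto simp: b_def)
    qed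
    finally show "prob {\<omega> \<in> space M. c (Z \<omega>) = k \<and> (c (Z \<omega>), c (Z' \<omega>)) \<notin> R} =
      (\<Sum>l\<in>D. if (k, l) \<notin> R then w k l else 0)" .
  qed
  also have "\<dots> = (\<Sum>(k, l)\<in>D \<times> D. if (k, l) \<notin> R then w k l else 0)" by (rule sum.cartesian_product)
  also have "\<dots> = (\<Sum>(k, l)\<in>D \<times> D - R. w k l)"
    using D by (intro sum.mono_neutral_cong_right) auto
  finally have "prob {\<omega> \<in> space M. (c (Z \<omega>), c (Z' \<omega>)) \<notin> R} \<le> \<eta>" using wR by simp
  thus ?thesis using law ev by (intro bexI[of _ Z']) auto
qed

section \<open>Characteristic functions of random vectors\<close>

lemma weighted_char_uniqueness:
  fixes X w :: "'c \<Rightarrow> real" and Y v :: "'d \<Rightarrow> real"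
  assumes "prob_space \<mu>" "prob_space \<nu>"
    and X[measurable]: "X \<in> borel_measurable \<mu>" and Y[measurable]: "Y \<in> borel_measurable \<nu>"
    and w[measurable]: "w \<in> borel_measurable \<mu>" and v[measurable]: "v \<in> borel_measurable \<nu>"
    and wb: "\<And>x. w x \<in> {1..3}" and vb: "\<And>x. v x \<in> {1..3}"
    and eq: "\<And>s. (CLINT x|\<mu>. w x *\<^sub>R iexp (s * X x)) = (CLINT x|\<nu>. v x *\<^sub>R iexp (s * Y x))"
    and B[measurable]: "B \<in> sets borel"
  shows "(LINT x|\<mu>. w x * indicator B (X x)) = (LINT x|\<nu>. v x * indicator B (Y x))"
proof -
  interpret \<mu>: prob_space \<mu> by fact
  interpret \<nu>: prob_space \<nu> by fact
  have "\<bar>w x\<bar> \<le> 3" "\<bar>v y\<bar> \<le> 3" for x y using wb[of x] vb[of y] by auto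
  hence wi: "integrable \<mu> w" and vi: "integrable \<nu> v"
    by (auto intro!: \<mu>.integrable_const_bound[of _ 3] \<nu>.integrable_const_bound[of _ 3])
  define k where "k = integral\<^sup>L \<mu> w"
  have k': "k = integral\<^sup>L \<nu> v"
    using eq[of 0] by (simp add: k_def scaleR_conv_of_real)
  have "(LINT x|\<mu>. 1) \<le> k" unfolding k_def using wi wb by (intro integral_mono) auto
  hence k: "1 \<le> k" by (simp add: \<mu>.prob_space)
  have aux: "prob_space (density \<rho> (\<lambda>x. ennreal (u x / k))) \<and>
      char (distr (density \<rho> (\<lambda>x. ennreal (u x / k))) borel Z) s =
        (1 / k) *\<^sub>R (CLINT x|\<rho>. u x *\<^sub>R iexp (s * Z x)) \<and>
      measure (distr (density \<rho> (\<lambda>x. ennreal (u x / k))) borel Z) B =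
        (1 / k) * (LINT x|\<rho>. u x * indicator B (Z x))"
    if Z[measurable]: "Z \<in> borel_measurable \<rho>" and u[measurable]: "integrable \<rho> u"
      and ub: "\<And>x. u x \<in> {1..3}" and ik: "integral\<^sup>L \<rho> u = k" and "prob_space \<rho>"
    for \<rho> :: "'e measure" and Z u s
  proof (intro conjI)
    interpret \<rho>: prob_space \<rho> by fact
    have nn: "0 \<le> u x / k" for x using ub[of x] k by auto
    have [measurable]: "u \<in> borel_measurable \<rho>" using u by auto
    have "emeasure (density \<rho> (\<lambda>x. ennreal (u x / k))) (space \<rho>) = (\<integral>\<^sup>+x. ennreal (u x / k) \<partial>\<rho>)"
      by (subst emeasure_density) (auto intro!: nn_integral_cong)
    also have "\<dots> = ennreal (LINT x|\<rho>. u x / k)"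
      using nn u by (intro nn_integral_eq_integral) auto
    also have "\<dots> = 1" using ik k by simp
    finally show "prob_space (density \<rho> (\<lambda>x. ennreal (u x / k)))" by (intro prob_spaceI) simp
    then interpret d: prob_space "density \<rho> (\<lambda>x. ennreal (u x / k))" .
    have "char (distr (density \<rho> (\<lambda>x. ennreal (u x / k))) borel Z) s =
      (CLINT x|density \<rho> (\<lambda>x. ennreal (u x / k)). iexp (s * Z x))"
      unfolding char_def by (subst integral_distr) auto
    also have "\<dots> = (CLINT x|\<rho>. (u x / k) *\<^sub>R iexp (s * Z x))"
      using nn by (subst integral_density) auto
    also have "(\<lambda>x. (u x / k) *\<^sub>R iexp (s * Z x)) = (\<lambda>x. (1 / k) *\<^sub>R (u x *\<^sub>R iexp (s * Z x)))"
      by simp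
    also have "(CLINT x|\<rho>. (1 / k) *\<^sub>R (u x *\<^sub>R iexp (s * Z x))) =
      (1 / k) *\<^sub>R (CLINT x|\<rho>. u x *\<^sub>R iexp (s * Z x))" by (rule integral_scaleR_right)
    finally show "char (distr (density \<rho> (\<lambda>x. ennreal (u x / k))) borel Z) s =
        (1 / k) *\<^sub>R (CLINT x|\<rho>. u x *\<^sub>R iexp (s * Z x))" .
    have ev: "Z -` B \<inter> space \<rho> \<in> sets \<rho>" by simp
    have "measure (distr (density \<rho> (\<lambda>x. ennreal (u x / k))) borel Z) B =
      (LINT x|density \<rho> (\<lambda>x. ennreal (u x / k)). indicator (Z -` B \<inter> space \<rho>) x)"
      using ev by (subst measure_distr) auto
    also have "\<dots> = (LINT x|\<rho>. (u x / k) *\<^sub>R indicator (Z -` B \<inter> space \<rho>) x)"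
      using nn ev by (subst integral_density) auto
    also have "\<dots> = (LINT x|\<rho>. (1 / k) * (u x * indicator B (Z x)))"
      by (intro Bochner_Integration.integral_cong) (auto simp: indicator_def)
    finally show "measure (distr (density \<rho> (\<lambda>x. ennreal (u x / k))) borel Z) B =
        (1 / k) * (LINT x|\<rho>. u x * indicator B (Z x))" by simp
  qed
  let ?M = "distr (density \<mu> (\<lambda>x. ennreal (w x / k))) borel X"
  let ?N = "distr (density \<nu> (\<lambda>x. ennreal (v x / k))) borel Y"
  note M = aux[OF X wi wb k_def[symmetric] \<open>prob_space \<mu>\<close>]
  note N = aux[OF Y vi vb k'[symmetric] \<open>prob_space \<nu>\<close>]
  have "real_distribution ?M" "real_distribution ?N"
    using M N by (auto simp: real_distribution_def real_distribution_axioms_def intro!: prob_space.prob_space_distr)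
  moreover have "char ?M = char ?N" using M N eq by auto
  ultimately have "?M = ?N" by (rule Levy_uniqueness)
  hence "measure ?M B = measure ?N B" by simp
  thus ?thesis using M N k by simp
qed

lemma signed_char_uniqueness:
  fixes X w :: "'c \<Rightarrow> real" and Y v :: "'d \<Rightarrow> real"
  assumes \<mu>: "prob_space \<mu>" and \<nu>: "prob_space \<nu>"
    and X[measurable]: "X \<in> borel_measurable \<mu>" and Y[measurable]: "Y \<in> borel_measurable \<nu>"
    and w[measurable]: "w \<in> borel_measurable \<mu>" and v[measurable]: "v \<in> borel_measurable \<nu>"
    and wb: "\<And>x. \<bar>w x\<bar> \<le> 1" and vb: "\<And>x. \<bar>v x\<bar> \<le> 1"
    and eq1: "\<And>s. (CLINT x|\<mu>. iexp (s * X x)) = (CLINT x|\<nu>. iexp (s * Y x))"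
    and eq: "\<And>s. (CLINT x|\<mu>. w x *\<^sub>R iexp (s * X x)) = (CLINT x|\<nu>. v x *\<^sub>R iexp (s * Y x))"
    and B[measurable]: "B \<in> sets borel"
  shows "(LINT x|\<mu>. w x * indicator B (X x)) = (LINT x|\<nu>. v x * indicator B (Y x))"
proof -
  interpret \<mu>: prob_space \<mu> by fact
  interpret \<nu>: prob_space \<nu> by fact
  have i1: "integrable \<mu> (\<lambda>x. w x *\<^sub>R iexp (s * X x))" "integrable \<nu> (\<lambda>x. v x *\<^sub>R iexp (s * Y x))"
    "integrable \<mu> (\<lambda>x. 2 * iexp (s * X x))" "integrable \<nu> (\<lambda>x. 2 * iexp (s * Y x))" for s
    using order_trans[OF wb one_le_numeral[of "num.Bit0 num.One"]] order_trans[OF vb one_le_numeral[of "num.Bit0 num.One"]]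
    by (auto intro!: \<mu>.integrable_const_bound[of _ 2] \<nu>.integrable_const_bound[of _ 2] simp: norm_mult)
  have "(LINT x|\<mu>. (2 + w x) * indicator B (X x)) = (LINT x|\<nu>. (2 + v x) * indicator B (Y x))"
  proof (rule weighted_char_uniqueness[OF \<mu> \<nu> X Y])
    show "2 + w x \<in> {1..3}" for x using wb[of x] by auto
    show "2 + v x \<in> {1..3}" for x using vb[of x] by auto
    fix s
    have "(CLINT x|\<mu>. (2 + w x) *\<^sub>R iexp (s * X x)) = (CLINT x|\<mu>. 2 * iexp (s * X x) + w x *\<^sub>R iexp (s * X x))"
      by (simp add: scaleR_conv_of_real distrib_right)
    also have "\<dots> = (CLINT x|\<nu>. 2 * iexp (s * Y x) + v x *\<^sub>R iexp (s * Y x))"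
      using i1 eq1 eq by simp
    finally show "(CLINT x|\<mu>. (2 + w x) *\<^sub>R iexp (s * X x)) = (CLINT x|\<nu>. (2 + v x) *\<^sub>R iexp (s * Y x))"
      by (simp add: scaleR_conv_of_real distrib_right)
  qed auto
  moreover have "(LINT x|\<mu>. (2::real) * indicator B (X x)) = (LINT x|\<nu>. 2 * indicator B (Y x))"
  proof (rule weighted_char_uniqueness[OF \<mu> \<nu> X Y])
    fix s
    show "(CLINT x|\<mu>. (2::real) *\<^sub>R iexp (s * X x)) = (CLINT x|\<nu>. (2::real) *\<^sub>R iexp (s * Y x))"
      using eq1[of s] by simp
  qed auto
  moreover have "integrable \<mu> (\<lambda>x. (2::real) * indicator B (X x))" "integrable \<mu> (\<lambda>x. w x * indicator B (X x))"
    "integrable \<nu> (\<lambda>x. (2::real) * indicator B (Y x))" "integrable \<nu> (\<lambda>x. v x * indicator B (Y x))"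
    using order_trans[OF wb one_le_numeral[of "num.Bit0 num.One"]] order_trans[OF vb one_le_numeral[of "num.Bit0 num.One"]]
    by (auto intro!: \<mu>.integrable_const_bound[of _ 2] \<nu>.integrable_const_bound[of _ 2]
        simp: abs_mult indicator_def)
  ultimately show ?thesis by (simp add: distrib_right)
qed

lemma cos_iexp: "complex_of_real (cos (L + c)) = (iexp c * iexp L + iexp (- c) * iexp (- L)) / 2"
proof -
  have e: "iexp c * iexp L = iexp (L + c)" "iexp (- c) * iexp (- L) = iexp (- (L + c))"
    by (simp_all add: exp_add[symmetric] algebra_simps)
  have "iexp x + iexp (- x) = 2 * complex_of_real (cos x)" for x
    using cos_exp_eq[of "complex_of_real x"] by (simp add: cos_of_real mult.commute)
  from this[of "L + c"] show ?thesis unfolding e by simp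
qed

text \<open>
  Coordinates are converted one at a time from test functions \<open>exp (i s x)\<close> to indicators. The
  one-dimensional uniqueness theorem needs positive measures, hence the weights \<open>2 + cos\<close>.
\<close>

theorem char_vec_uniqueness:
  assumes \<mu>: "prob_space \<mu>" and \<nu>: "prob_space \<nu>"
    and s\<mu>[measurable_cong]: "sets \<mu> = sets (borel_vec p)" and s\<nu>[measurable_cong]: "sets \<nu> = sets (borel_vec p)"
    and eq: "\<And>t. (CLINT x|\<mu>. iexp (\<Sum>j<p. t j * x j)) = (CLINT x|\<nu>. iexp (\<Sum>j<p. t j * x j))"
  shows "\<mu> = \<nu>"
proof -
  interpret \<mu>: prob_space \<mu> by fact
  interpret \<nu>: prob_space \<nu> by fact
  define ind where "ind m A x = (\<Prod>j<m. indicator (A j) (x j) :: real)" for m :: nat and A and x :: "nat \<Rightarrow> real"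
  have ind_b: "\<bar>ind m A x\<bar> \<le> 1" for m A x
    unfolding ind_def abs_prod by (rule prod_le_1) (auto simp: indicator_def)
  have meas: "ind m A \<in> borel_measurable (borel_vec p)" if "\<And>j. j < m \<Longrightarrow> A j \<in> sets borel" "m \<le> p" for m A
    unfolding ind_def
  proof (rule borel_measurable_prod)
    fix j assume j: "j \<in> {..<m}"
    have "(\<lambda>x. x j) \<in> borel_measurable (borel_vec p)"
      using j that by (intro measurable_component_singleton) auto
    thus "(\<lambda>x. indicator (A j) (x j)) \<in> borel_measurable (borel_vec p)"
      using that(1)[of j] j by (intro measurable_compose[OF _ borel_measurable_indicator]) auto
  qed
  have lin: "(\<lambda>x. \<Sum>j\<in>J. t j * x j) \<in> borel_measurable (borel_vec p)"
    if "J \<subseteq> {..<p}" for J t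
    using that by (intro borel_measurable_sum borel_measurable_times borel_measurable_const
        measurable_component_singleton) auto
  have claim: "(CLINT x|\<mu>. ind m A x *\<^sub>R iexp (\<Sum>j\<in>{m..<p}. t j * x j)) =
               (CLINT x|\<nu>. ind m A x *\<^sub>R iexp (\<Sum>j\<in>{m..<p}. t j * x j))"
    if "m \<le> p" "\<And>j. j < m \<Longrightarrow> A j \<in> sets borel" for m A t
    using that
  proof (induction m arbitrary: t)
    case 0
    thus ?case using eq by (simp add: ind_def lessThan_atLeast0)
  next
    case (Suc m)
    define L where "L x = (\<Sum>j\<in>{Suc m..<p}. t j * x j)" for x :: "nat \<Rightarrow> real"
    have mp: "m < p" and A: "\<And>j. j < m \<Longrightarrow> A j \<in> sets borel" "A m \<in> sets borel"
      using Suc.prems by auto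
    have Lm[measurable]: "L \<in> borel_measurable (borel_vec p)" unfolding L_def by (rule lin) auto
    have im[measurable]: "ind m A \<in> borel_measurable (borel_vec p)" using A mp by (intro meas) auto
    have xm[measurable]: "(\<lambda>x. x m) \<in> borel_measurable (borel_vec p)"
      using mp by (intro measurable_component_singleton) auto
    have IH: "(CLINT x|\<mu>. ind m A x *\<^sub>R iexp (s * x m + r * L x)) =
        (CLINT x|\<nu>. ind m A x *\<^sub>R iexp (s * x m + r * L x))" for s r
    proof -
      have "(\<Sum>j\<in>{m..<p}. (if j = m then s else r * t j) * x j) = s * x m + r * L x" for x
        using mp by (subst sum.atLeast_Suc_lessThan)
          (auto simp: L_def sum_distrib_left mult.assoc intro!: sum.cong)
      thus ?thesis using Suc.IH[of "\<lambda>j. if j = m then s else r * t j"] A mp by simp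
    qed
    have int: "integrable \<mu> (\<lambda>x. ind m A x *\<^sub>R iexp (s * x m + r * L x))"
      "integrable \<nu> (\<lambda>x. ind m A x *\<^sub>R iexp (s * x m + r * L x))" for s r
      using ind_b by (auto intro!: \<mu>.integrable_const_bound[of _ 1] \<nu>.integrable_const_bound[of _ 1])
    have cs: "(LINT x|\<mu>. (ind m A x * cos (L x + c)) * indicator (A m) (x m)) =
        (LINT x|\<nu>. (ind m A x * cos (L x + c)) * indicator (A m) (x m))" for c
    proof (rule signed_char_uniqueness[OF \<mu> \<nu>])
      show "(\<lambda>x. x m) \<in> borel_measurable \<mu>" "(\<lambda>x. x m) \<in> borel_measurable \<nu>" by measurable
      show "(\<lambda>x. ind m A x * cos (L x + c)) \<in> borel_measurable \<mu>"
        "(\<lambda>x. ind m A x * cos (L x + c)) \<in> borel_measurable \<nu>" by measurable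
      show "\<bar>ind m A x * cos (L x + c)\<bar> \<le> 1" "\<bar>ind m A x * cos (L x + c)\<bar> \<le> 1" for x
        unfolding abs_mult using ind_b[of m A x] abs_cos_le_one[of "L x + c"] by (auto intro: mult_le_one)
      fix s
      have "(\<Sum>j<p. (if j = m then s else 0) * x j) = s * x m" for x :: "nat \<Rightarrow> real"
        using mp by (simp add: if_distrib[of "\<lambda>a. a * _"] cong: if_cong)
      thus "(CLINT x|\<mu>. iexp (s * x m)) = (CLINT x|\<nu>. iexp (s * x m))"
        using eq[of "\<lambda>j. if j = m then s else 0"] by simp
      have e: "(ind m A x * cos (L x + c)) *\<^sub>R iexp (s * x m) =
        (iexp c / 2) * (ind m A x *\<^sub>R iexp (s * x m + 1 * L x)) +
        (iexp (- c) / 2) * (ind m A x *\<^sub>R iexp (s * x m + (- 1) * L x))" for x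
      proof -
        have "iexp (s * x m + 1 * L x) = iexp (s * x m) * iexp (L x)"
          "iexp (s * x m + (- 1) * L x) = iexp (s * x m) * iexp (- L x)"
          by (simp_all add: exp_add[symmetric] algebra_simps)
        thus ?thesis by (simp add: scaleR_conv_of_real cos_iexp field_simps)
      qed
      show "(CLINT x|\<mu>. (ind m A x * cos (L x + c)) *\<^sub>R iexp (s * x m)) =
        (CLINT x|\<nu>. (ind m A x * cos (L x + c)) *\<^sub>R iexp (s * x m))"
        unfolding e using int IH
        by (simp only: Bochner_Integration.integral_add integrable_mult_right integral_mult_right_zero)
    qed (use A in auto)
    have split: "ind (Suc m) A x *\<^sub>R iexp (L x) =
      complex_of_real ((ind m A x * cos (L x + 0)) * indicator (A m) (x m)) +
      \<i> * complex_of_real ((ind m A x * cos (L x + (- pi / 2))) * indicator (A m) (x m))" for x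
    proof -
      have "cos (L x + (- pi / 2)) = sin (L x)" by (simp add: cos_diff)
      moreover have "iexp (L x) = cos (L x) + \<i> * sin (L x)"
        by (simp add: exp_Euler cos_of_real sin_of_real)
      ultimately show ?thesis by (simp add: ind_def scaleR_conv_of_real algebra_simps)
    qed
    have wb: "\<bar>ind m A x\<bar> * \<bar>cos (L x + c)\<bar> \<le> 1" for x c
      using ind_b[of m A x] abs_cos_le_one[of "L x + c"] by (auto intro: mult_le_one)
    have i\<mu>: "integrable \<mu> (\<lambda>x. (ind m A x * cos (L x + c)) * indicator (A m) (x m))" for c
      using wb A by (auto intro!: \<mu>.integrable_const_bound[of _ 1] AE_I2 simp: abs_mult indicator_def)
    have i\<nu>: "integrable \<nu> (\<lambda>x. (ind m A x * cos (L x + c)) * indicator (A m) (x m))" for c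
      using wb A by (auto intro!: \<nu>.integrable_const_bound[of _ 1] AE_I2 simp: abs_mult indicator_def)
    define F where "F c x = (ind m A x * cos (L x + c)) * indicator (A m) (x m)" for c x
    have "integrable \<mu> (F c)" "integrable \<nu> (F c)" "integral\<^sup>L \<mu> (F c) = integral\<^sup>L \<nu> (F c)" for c
      unfolding F_def by (rule i\<mu> i\<nu> cs)+
    thus ?case
      unfolding L_def[symmetric] split F_def[symmetric] by (simp add: integral_complex_of_real)
  qed
  show ?thesis
  proof (rule measure_eqI_PiM_finite[where I = "{..<p}" and M = "\<lambda>_. borel"])
    show "emeasure \<mu> (Pi\<^sub>E {..<p} A) = emeasure \<nu> (Pi\<^sub>E {..<p} A)"
      if A: "\<And>j. j \<in> {..<p} \<Longrightarrow> A j \<in> sets borel" for A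
    proof -
      have Am: "Pi\<^sub>E {..<p} A \<in> sets (borel_vec p)" using A by (intro sets_PiM_I_finite) auto
      have ind: "complex_of_real (indicator (Pi\<^sub>E {..<p} A) x) = ind p A x *\<^sub>R iexp (\<Sum>j\<in>{p..<p}. 0 * x j)"
        if xs: "x \<in> space (borel_vec p)" for x
      proof (cases "x \<in> Pi\<^sub>E {..<p} A")
        case True
        have "ind p A x = 1" unfolding ind_def
        proof (intro prod.neutral ballI)
          fix j assume "j \<in> {..<p}"
          thus "indicator (A j) (x j) = (1 :: real)" using True by (simp add: PiE_mem)
        qed
        thus ?thesis using True by simp
      next
        case False
        then obtain j where j: "j < p" "x j \<notin> A j" using xs by (auto simp: space_PiM PiE_iff)
        have "ind p A x = 0" unfolding ind_def
          by (rule prod_zero) (use j in \<open>auto intro!: bexI[of _ j]\<close>)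
        thus ?thesis using False by simp
      qed
      have "complex_of_real (measure \<mu> (Pi\<^sub>E {..<p} A)) = (CLINT x|\<mu>. complex_of_real (indicator (Pi\<^sub>E {..<p} A) x))"
        using Am by (simp add: integral_complex_of_real s\<mu>)
      also have "\<dots> = (CLINT x|\<mu>. ind p A x *\<^sub>R iexp (\<Sum>j\<in>{p..<p}. 0 * x j))"
        using ind sets_eq_imp_space_eq[OF s\<mu>] by (intro Bochner_Integration.integral_cong) auto
      also have "\<dots> = (CLINT x|\<nu>. ind p A x *\<^sub>R iexp (\<Sum>j\<in>{p..<p}. 0 * x j))"
        using A by (intro claim) auto
      also have "\<dots> = (CLINT x|\<nu>. complex_of_real (indicator (Pi\<^sub>E {..<p} A) x))"
        using ind sets_eq_imp_space_eq[OF s\<nu>] by (intro Bochner_Integration.integral_cong) auto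
      also have "\<dots> = complex_of_real (measure \<nu> (Pi\<^sub>E {..<p} A))"
        using Am by (simp add: integral_complex_of_real s\<nu>)
      finally show ?thesis by (simp add: \<mu>.emeasure_eq_measure \<nu>.emeasure_eq_measure)
    qed
    have "Pi\<^sub>E {..<p} (\<lambda>_. UNIV) \<in> prod_algebra {..<p} (\<lambda>_. borel :: real measure)"
      by (intro prod_algebraI_finite) auto
    thus "range (\<lambda>_::nat. Pi\<^sub>E {..<p} (\<lambda>_. UNIV)) \<subseteq> prod_algebra {..<p} (\<lambda>_. borel :: real measure)" by auto
  qed (auto simp: s\<mu> s\<nu> space_PiM)
qed

section \<open>Centred normal vectors\<close>

lemma sum_kronecker:
  fixes c :: "nat \<Rightarrow> real"
  assumes "j < p"
  shows "(\<Sum>i<p. (if i = j then 1 else 0) * c i) = c j" "(\<Sum>i<p. c i * (if i = j then 1 else 0)) = c j"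
  using assms by (simp_all add: if_distrib[of "\<lambda>a. a * _"] if_distrib[of "\<lambda>a. _ * a"] cong: if_cong)

locale centred_normal = prob_space \<nu> for \<nu> :: "(nat \<Rightarrow> real) measure" and p :: nat and S :: "nat \<Rightarrow> nat \<Rightarrow> real" +
  assumes sets_eq[measurable_cong]: "sets \<nu> = sets (borel_vec p)"
    and char_eq: "(CLINT x|\<nu>. iexp (\<Sum>j<p. t j * x j)) =
      complex_of_real (exp (- (\<Sum>j<p. \<Sum>k<p. t j * S j k * t k) / 2))"
    and sym: "j < p \<Longrightarrow> k < p \<Longrightarrow> S j k = S k j"
begin

lemma measurable_coord[measurable]: "j < p \<Longrightarrow> (\<lambda>x. x j) \<in> borel_measurable \<nu>"
  using measurable_component_singleton[of j "{..<p}" "\<lambda>_. borel :: real measure"]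
  by (simp cong: measurable_cong_sets add: sets_eq)

lemma measurable_linear_form[measurable]: "(\<lambda>x. \<Sum>j<p. t j * x j) \<in> borel_measurable \<nu>"
  by (intro borel_measurable_sum borel_measurable_times) auto

lemma quadratic_form_nonneg: "0 \<le> (\<Sum>j<p. \<Sum>k<p. t j * S j k * t k)"
proof -
  have "norm (CLINT x|\<nu>. iexp (\<Sum>j<p. t j * x j)) \<le> (LINT x|\<nu>. 1)"
    by (rule order_trans[OF integral_norm_bound]) (simp add: prob_space)
  thus ?thesis unfolding char_eq by (simp add: prob_space)
qed

lemma linear_form_law:
  "distr \<nu> borel (\<lambda>x. \<Sum>j<p. t j * x j) =
   distr std_normal_distribution borel (\<lambda>z. sqrt (\<Sum>j<p. \<Sum>k<p. t j * S j k * t k) * z)"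
proof (rule Levy_uniqueness)
  let ?q = "\<Sum>j<p. \<Sum>k<p. t j * S j k * t k"
  interpret N: real_distribution std_normal_distribution by (rule real_dist_normal_dist)
  show "real_distribution (distr \<nu> borel (\<lambda>x. \<Sum>j<p. t j * x j))"
    by (auto simp: real_distribution_def real_distribution_axioms_def intro!: prob_space_distr)
  show "real_distribution (distr std_normal_distribution borel (\<lambda>z. sqrt ?q * z))"
    by (auto simp: real_distribution_def real_distribution_axioms_def intro!: N.prob_space_distr)
  show "char (distr \<nu> borel (\<lambda>x. \<Sum>j<p. t j * x j)) = char (distr std_normal_distribution borel (\<lambda>z. sqrt ?q * z))"
  proof
    fix s
    have "char (distr \<nu> borel (\<lambda>x. \<Sum>j<p. t j * x j)) s = (CLINT x|\<nu>. iexp (s * (\<Sum>j<p. t j * x j)))"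
      unfolding char_def by (subst integral_distr) auto
    also have "\<dots> = (CLINT x|\<nu>. iexp (\<Sum>j<p. (s * t j) * x j))"
      by (simp only: sum_distrib_left mult.assoc)
    also have "\<dots> = complex_of_real (exp (- (\<Sum>j<p. \<Sum>k<p. (s * t j) * S j k * (s * t k)) / 2))"
      by (rule char_eq)
    also have "(\<Sum>j<p. \<Sum>k<p. (s * t j) * S j k * (s * t k)) = (s * sqrt ?q)\<^sup>2"
      using quadratic_form_nonneg[of t]
      by (simp add: power_mult_distrib sum_distrib_left power2_eq_square mult_ac)
    also have "complex_of_real (exp (- (s * sqrt ?q)\<^sup>2 / 2)) = char std_normal_distribution (s * sqrt ?q)"
      by (simp add: char_std_normal_distribution)
    also have "\<dots> = char (distr std_normal_distribution borel (\<lambda>z. sqrt ?q * z)) s"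
      unfolding char_def by (subst integral_distr) (auto simp: mult.assoc)
    finally show "char (distr \<nu> borel (\<lambda>x. \<Sum>j<p. t j * x j)) s =
      char (distr std_normal_distribution borel (\<lambda>z. sqrt ?q * z)) s" .
  qed
qed

lemma linear_form_moments:
  "integrable \<nu> (\<lambda>x. \<bar>\<Sum>j<p. t j * x j\<bar> ^ k)"
  "integrable \<nu> (\<lambda>x. (\<Sum>j<p. t j * x j) ^ k)"
  "(LINT x|\<nu>. (\<Sum>j<p. t j * x j)) = 0"
  "(LINT x|\<nu>. (\<Sum>j<p. t j * x j)\<^sup>2) = (\<Sum>j<p. \<Sum>k<p. t j * S j k * t k)"
proof -
  let ?q = "\<Sum>j<p. \<Sum>k<p. t j * S j k * t k"
  have int: "integrable \<nu> (\<lambda>x. g (\<Sum>j<p. t j * x j)) \<longleftrightarrow> integrable std_normal_distribution (\<lambda>z. g (sqrt ?q * z))"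
    and eq: "(LINT x|\<nu>. g (\<Sum>j<p. t j * x j)) = (LINT z|std_normal_distribution. g (sqrt ?q * z))"
    if [measurable]: "g \<in> borel_measurable borel" for g :: "real \<Rightarrow> real"
  proof -
    have "integrable \<nu> (\<lambda>x. g (\<Sum>j<p. t j * x j)) \<longleftrightarrow> integrable (distr \<nu> borel (\<lambda>x. \<Sum>j<p. t j * x j)) g"
      by (subst integrable_distr_eq) auto
    also have "\<dots> \<longleftrightarrow> integrable std_normal_distribution (\<lambda>z. g (sqrt ?q * z))"
      unfolding linear_form_law by (subst integrable_distr_eq) auto
    finally show "integrable \<nu> (\<lambda>x. g (\<Sum>j<p. t j * x j)) \<longleftrightarrow> integrable std_normal_distribution (\<lambda>z. g (sqrt ?q * z))" .
    have "(LINT x|\<nu>. g (\<Sum>j<p. t j * x j)) = (LINT y|distr \<nu> borel (\<lambda>x. \<Sum>j<p. t j * x j). g y)"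
      by (subst integral_distr) auto
    also have "\<dots> = (LINT z|std_normal_distribution. g (sqrt ?q * z))"
      unfolding linear_form_law by (subst integral_distr) auto
    finally show "(LINT x|\<nu>. g (\<Sum>j<p. t j * x j)) = (LINT z|std_normal_distribution. g (sqrt ?q * z))" .
  qed
  note m = integrable_std_normal_distribution_moment
  have "integrable std_normal_distribution (\<lambda>z. \<bar>sqrt ?q\<bar> ^ k * norm (z ^ k))"
    by (intro integrable_mult_right integrable_norm m)
  thus "integrable \<nu> (\<lambda>x. \<bar>\<Sum>j<p. t j * x j\<bar> ^ k)"
    by (subst int[of "\<lambda>y. \<bar>y\<bar> ^ k"]) (auto simp: abs_mult power_mult_distrib power_abs)
  show "integrable \<nu> (\<lambda>x. (\<Sum>j<p. t j * x j) ^ k)"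
    using m by (subst int[of "\<lambda>y. y ^ k"]) (auto simp: power_mult_distrib)
  show "(LINT x|\<nu>. (\<Sum>j<p. t j * x j)) = 0"
    using integral_std_normal_distribution_moment_odd[of 1] eq[of "\<lambda>y. y"] by simp
  show "(LINT x|\<nu>. (\<Sum>j<p. t j * x j)\<^sup>2) = ?q"
    using std_normal_distribution_even_moments[of 1] quadratic_form_nonneg[of t]
    by (subst eq[of "\<lambda>y. y\<^sup>2"]) (auto simp: power_mult_distrib)
qed

lemma coord_moments:
  assumes j: "j < p"
  shows "integrable \<nu> (\<lambda>x. \<bar>x j\<bar> ^ m)" "(LINT x|\<nu>. x j) = 0"
  using linear_form_moments(1,3)[of "\<lambda>i. if i = j then 1 else 0"] by (simp_all add: sum_kronecker j)

lemma covariance: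
  assumes j: "j < p" and k: "k < p"
  shows "integrable \<nu> (\<lambda>x. x j * x k)" "(LINT x|\<nu>. x j * x k) = S j k"
proof -
  define e where "e j i = (if i = j then 1 else 0 :: real)" for i j :: nat
  have e: "(\<Sum>i<p. e j i * c i) = c j" "(\<Sum>i<p. c i * e j i) = c j" if "j < p" for c j
    unfolding e_def using sum_kronecker that by blast+
  have lin: "(\<Sum>i<p. (e j i + e k i) * x i) = x j + x k" for x :: "nat \<Rightarrow> real"
    by (simp add: distrib_right sum.distrib e j k)
  have q1: "integrable \<nu> (\<lambda>x. (x j)\<^sup>2) \<and> (LINT x|\<nu>. (x j)\<^sup>2) = S j j" if "j < p" for j
  proof -
    have "(\<Sum>i<p. \<Sum>l<p. e j i * S i l * e j l) = S j j"
      by (simp only: e that mult.assoc sum_distrib_left[symmetric])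
    thus ?thesis using linear_form_moments(2,4)[of "e j"] by (simp add: e that)
  qed
  have "(\<Sum>i<p. \<Sum>l<p. (e j i + e k i) * S i l * (e j l + e k l)) = S j j + 2 * S j k + S k k"
    using sym[OF j k]
    by (simp only: e j k mult.assoc sum_distrib_left[symmetric] distrib_left distrib_right sum.distrib)
  hence q2: "integrable \<nu> (\<lambda>x. (x j + x k)\<^sup>2)" "(LINT x|\<nu>. (x j + x k)\<^sup>2) = S j j + 2 * S j k + S k k"
    using linear_form_moments(2,4)[of "\<lambda>i. e j i + e k i"] unfolding lin by auto
  have eq: "x j * x k = ((x j + x k)\<^sup>2 - (x j)\<^sup>2 - (x k)\<^sup>2) / 2" for x :: "nat \<Rightarrow> real"
    by (simp add: power2_eq_square algebra_simps)
  show "integrable \<nu> (\<lambda>x. x j * x k)" "(LINT x|\<nu>. x j * x k) = S j k"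
    unfolding eq using q1[OF j] q1[OF k] q2 by simp_all
qed

lemma rotation_law:
  assumes abc: "a\<^sup>2 + b\<^sup>2 = c\<^sup>2"
  shows "distr (\<nu> \<Otimes>\<^sub>M \<nu>) (borel_vec p) (\<lambda>(x, y). \<lambda>j\<in>{..<p}. a * x j + b * y j) =
    distr \<nu> (borel_vec p) (\<lambda>x. \<lambda>j\<in>{..<p}. c * x j)"
proof (rule char_vec_uniqueness[where p = p])
  interpret P: pair_prob_space \<nu> \<nu> ..
  have m1: "(\<lambda>(x, y). \<lambda>j\<in>{..<p}. a * x j + b * y j) \<in> measurable (\<nu> \<Otimes>\<^sub>M \<nu>) (borel_vec p)"
    by (subst split_beta', rule measurable_restrict) auto
  have m2: "(\<lambda>x. \<lambda>j\<in>{..<p}. c * x j) \<in> measurable \<nu> (borel_vec p)"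
    by (rule measurable_restrict) auto
  show "prob_space (distr (\<nu> \<Otimes>\<^sub>M \<nu>) (borel_vec p) (\<lambda>(x, y). \<lambda>j\<in>{..<p}. a * x j + b * y j))"
    by (rule P.prob_space_distr[OF m1])
  show "prob_space (distr \<nu> (borel_vec p) (\<lambda>x. \<lambda>j\<in>{..<p}. c * x j))"
    by (rule prob_space_distr[OF m2])
  fix t
  have lm: "(\<lambda>x. iexp (\<Sum>j<p. t j * x j)) \<in> borel_measurable (borel_vec p)"
  proof -
    have [measurable]: "(\<lambda>x. \<Sum>j<p. t j * x j) \<in> borel_measurable (borel_vec p)"
      by (intro borel_measurable_sum borel_measurable_times measurable_component_singleton) auto
    show ?thesis by measurable
  qed
  let ?q = "\<Sum>j<p. \<Sum>k<p. t j * S j k * t k"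
  have char_scaled: "(CLINT x|\<nu>. iexp (a * (\<Sum>j<p. t j * x j))) = complex_of_real (exp (- (a\<^sup>2 * ?q) / 2))" for a
  proof -
    have "(\<Sum>j<p. \<Sum>k<p. (a * t j) * S j k * (a * t k)) = a\<^sup>2 * ?q"
      by (simp add: sum_distrib_left power2_eq_square mult_ac)
    moreover have "(\<Sum>j<p. (a * t j) * x j) = a * (\<Sum>j<p. t j * x j)" for x
      by (simp add: sum_distrib_left mult_ac)
    ultimately show ?thesis using char_eq[of "\<lambda>j. a * t j"] by simp
  qed
  have "(CLINT x|distr (\<nu> \<Otimes>\<^sub>M \<nu>) (borel_vec p) (\<lambda>(x, y). \<lambda>j\<in>{..<p}. a * x j + b * y j). iexp (\<Sum>j<p. t j * x j)) =
    (CLINT z|(\<nu> \<Otimes>\<^sub>M \<nu>). iexp (a * (\<Sum>j<p. t j * fst z j)) * iexp (b * (\<Sum>j<p. t j * snd z j)))"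
    by (subst integral_distr[OF m1 lm])
      (auto intro!: Bochner_Integration.integral_cong arg_cong[of _ _ exp]
        simp: sum_distrib_left exp_add[symmetric] sum.distrib[symmetric] algebra_simps split: prod.split)
  also have "\<dots> = (CLINT x|\<nu>. CLINT y|\<nu>. iexp (a * (\<Sum>j<p. t j * x j)) * iexp (b * (\<Sum>j<p. t j * y j)))"
    by (subst P.integral_fst'[symmetric])
      (auto intro!: P.integrable_const_bound[of _ 1] simp: norm_mult)
  also have "\<dots> = complex_of_real (exp (- (a\<^sup>2 * ?q) / 2)) * complex_of_real (exp (- (b\<^sup>2 * ?q) / 2))"
    by (simp only: integral_mult_left_zero integral_mult_right_zero char_scaled)
  also have "\<dots> = complex_of_real (exp (- (c\<^sup>2 * ?q) / 2))"
    unfolding abc[symmetric] by (simp add: exp_add[symmetric] algebra_simps add_divide_distrib flip: of_real_mult)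
  also have "\<dots> = (CLINT x|\<nu>. iexp (c * (\<Sum>j<p. t j * x j)))" by (rule char_scaled[symmetric])
  also have "\<dots> = (CLINT x|distr \<nu> (borel_vec p) (\<lambda>x. \<lambda>j\<in>{..<p}. c * x j). iexp (\<Sum>j<p. t j * x j))"
    by (subst integral_distr[OF m2 lm])
      (auto intro!: Bochner_Integration.integral_cong simp: sum_distrib_left mult_ac)
  finally show "(CLINT x|distr (\<nu> \<Otimes>\<^sub>M \<nu>) (borel_vec p) (\<lambda>(x, y). \<lambda>j\<in>{..<p}. a * x j + b * y j). iexp (\<Sum>j<p. t j * x j)) =
    (CLINT x|distr \<nu> (borel_vec p) (\<lambda>x. \<lambda>j\<in>{..<p}. c * x j). iexp (\<Sum>j<p. t j * x j))" .
qed auto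

lemma integral_rotation:
  fixes g :: "(nat \<Rightarrow> real) \<Rightarrow> real"
  assumes abc: "a\<^sup>2 + b\<^sup>2 = c\<^sup>2"
    and g[measurable]: "g \<in> borel_measurable (borel_vec p)" and gb: "\<And>x. \<bar>g x\<bar> \<le> B"
    and gr: "\<And>x. g (restrict x {..<p}) = g x"
  shows "(LINT x|\<nu>. LINT y|\<nu>. g (\<lambda>j. a * x j + b * y j)) = (LINT x|\<nu>. g (\<lambda>j. c * x j))"
proof -
  interpret P: pair_prob_space \<nu> \<nu> ..
  have m1: "(\<lambda>(x, y). \<lambda>j\<in>{..<p}. a * x j + b * y j) \<in> measurable (\<nu> \<Otimes>\<^sub>M \<nu>) (borel_vec p)"
    by (subst split_beta', rule measurable_restrict) auto
  have m2: "(\<lambda>x. \<lambda>j\<in>{..<p}. c * x j) \<in> measurable \<nu> (borel_vec p)"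
    by (rule measurable_restrict) auto
  have "(LINT x|\<nu>. g (\<lambda>j. c * x j)) = (LINT x|distr \<nu> (borel_vec p) (\<lambda>x. \<lambda>j\<in>{..<p}. c * x j). g x)"
    by (subst integral_distr[OF m2 g]) (simp add: gr)
  also have "\<dots> = (LINT z|(\<nu> \<Otimes>\<^sub>M \<nu>). g (\<lambda>j\<in>{..<p}. a * fst z j + b * snd z j))"
    unfolding rotation_law[OF abc, symmetric]
    by (subst integral_distr[OF m1 g]) (simp add: split_beta')
  also have "\<dots> = (LINT x|\<nu>. LINT y|\<nu>. g (\<lambda>j\<in>{..<p}. a * x j + b * y j))"
    using measurable_compose[OF m1 g] gb
    by (subst P.integral_fst'[symmetric])
      (auto intro!: P.integrable_const_bound[of _ B] simp: split_beta')
  finally show ?thesis by (simp add: gr)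
qed

end

lemma (in prob_space) centred_normal_sum:
  assumes indep: "indep_vars (\<lambda>_. borel_vec p) Y {..<n::nat}"
    and norm: "\<And>i. i < n \<Longrightarrow> centred_normal_vec M p (Y i) (S i)"
    and sym: "\<And>i j k. i < n \<Longrightarrow> j < p \<Longrightarrow> k < p \<Longrightarrow> S i j k = S i k j"
  shows "(\<lambda>\<omega>. \<lambda>j\<in>{..<p}. \<Sum>i<n. Y i \<omega> j) \<in> measurable M (borel_vec p)"
    and "centred_normal (distr M (borel_vec p) (\<lambda>\<omega>. \<lambda>j\<in>{..<p}. \<Sum>i<n. Y i \<omega> j)) p (\<lambda>j k. \<Sum>i<n. S i j k)"
proof -
  have Ym[measurable]: "(\<lambda>\<omega>. Y i \<omega> j) \<in> borel_measurable M" if "i < n" "j < p" for i j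
  proof -
    have "Y i \<in> measurable M (borel_vec p)" using norm[OF that(1)] by (simp add: centred_normal_vec_def)
    from measurable_compose[OF this measurable_component_singleton[of j]] show ?thesis using that by simp
  qed
  show m: "(\<lambda>\<omega>. \<lambda>j\<in>{..<p}. \<Sum>i<n. Y i \<omega> j) \<in> measurable M (borel_vec p)"
    by (intro measurable_restrict borel_measurable_sum) (use Ym in auto)
  interpret D: prob_space "distr M (borel_vec p) (\<lambda>\<omega>. \<lambda>j\<in>{..<p}. \<Sum>i<n. Y i \<omega> j)"
    by (rule prob_space_distr[OF m])
  show "centred_normal (distr M (borel_vec p) (\<lambda>\<omega>. \<lambda>j\<in>{..<p}. \<Sum>i<n. Y i \<omega> j)) p (\<lambda>j k. \<Sum>i<n. S i j k)"
  proof
    fix t :: "nat \<Rightarrow> real"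
    let ?L = "\<lambda>x. \<Sum>j<p. t j * x j :: real"
    have lin: "?L \<in> borel_measurable (borel_vec p)"
      by (intro borel_measurable_sum borel_measurable_times measurable_component_singleton) auto
    hence lm: "(\<lambda>x. iexp (?L x)) \<in> borel_measurable (borel_vec p)" by measurable
    have Lm: "(\<lambda>\<omega>. ?L (Y i \<omega>)) \<in> borel_measurable M" if "i < n" for i
      using that Ym by (intro borel_measurable_sum borel_measurable_times) auto
    have "(CLINT x|distr M (borel_vec p) (\<lambda>\<omega>. \<lambda>j\<in>{..<p}. \<Sum>i<n. Y i \<omega> j). iexp (?L x)) =
      (CLINT \<omega>|M. iexp (\<Sum>i<n. ?L (Y i \<omega>)))"
    proof -
      have "(\<Sum>i<n. ?L (Y i \<omega>)) = (\<Sum>j<p. t j * (\<Sum>i<n. Y i \<omega> j))" for \<omega>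
        unfolding sum_distrib_left by (rule sum.swap)
      thus ?thesis by (subst integral_distr[OF m lm]) simp
    qed
    also have "\<dots> = char (distr M borel (\<lambda>\<omega>. \<Sum>i<n. ?L (Y i \<omega>))) 1"
      unfolding char_def using Lm by (subst integral_distr) auto
    also have "\<dots> = (\<Prod>i<n. char (distr M borel (\<lambda>\<omega>. ?L (Y i \<omega>))) 1)"
      by (rule char_distr_sum) (rule indep_vars_compose2[OF indep], rule lin)
    also have "\<dots> = (\<Prod>i<n. complex_of_real (exp (- (\<Sum>j<p. \<Sum>k<p. t j * S i j k * t k) / 2)))"
    proof (rule prod.cong[OF refl])
      fix i assume "i \<in> {..<n}"
      hence i: "i < n" by simp
      have "char (distr M borel (\<lambda>\<omega>. ?L (Y i \<omega>))) 1 = (CLINT \<omega>|M. iexp (?L (Y i \<omega>)))"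
        unfolding char_def using Lm[OF i] by (subst integral_distr) auto
      thus "char (distr M borel (\<lambda>\<omega>. ?L (Y i \<omega>))) 1 =
        complex_of_real (exp (- (\<Sum>j<p. \<Sum>k<p. t j * S i j k * t k) / 2))"
        using norm[OF i] by (simp add: centred_normal_vec_def)
    qed
    also have "\<dots> = complex_of_real (exp (\<Sum>i<n. - (\<Sum>j<p. \<Sum>k<p. t j * S i j k * t k) / 2))"
      by (simp add: exp_sum)
    also have "(\<Sum>i<n. - (\<Sum>j<p. \<Sum>k<p. t j * S i j k * t k) / 2) =
      - (\<Sum>j<p. \<Sum>k<p. t j * (\<Sum>i<n. S i j k) * t k) / 2"
    proof -
      have "(\<Sum>j<p. \<Sum>k<p. t j * (\<Sum>i<n. S i j k) * t k) = (\<Sum>j<p. \<Sum>k<p. \<Sum>i<n. t j * S i j k * t k)"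
        by (simp add: sum_distrib_left sum_distrib_right)
      also have "\<dots> = (\<Sum>j<p. \<Sum>i<n. \<Sum>k<p. t j * S i j k * t k)"
        by (intro sum.cong refl sum.swap)
      also have "\<dots> = (\<Sum>i<n. \<Sum>j<p. \<Sum>k<p. t j * S i j k * t k)" by (rule sum.swap)
      finally show ?thesis by (simp add: sum_negf sum_divide_distrib)
    qed
    finally show "(CLINT x|distr M (borel_vec p) (\<lambda>\<omega>. \<lambda>j\<in>{..<p}. \<Sum>i<n. Y i \<omega> j). iexp (?L x)) =
      complex_of_real (exp (- (\<Sum>j<p. \<Sum>k<p. t j * (\<Sum>i<n. S i j k) * t k) / 2))" .
  qed (use sym in \<open>auto intro!: sum.cong\<close>)
qed

section \<open>A smooth cutoff\<close>

definition clamp01 :: "real \<Rightarrow> real" where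
  "clamp01 y = max 0 (min 1 y)"

lemma clamp01_simps: "y \<le> 0 \<Longrightarrow> clamp01 y = 0" "1 \<le> y \<Longrightarrow> clamp01 y = 1"
  "0 \<le> y \<Longrightarrow> y \<le> 1 \<Longrightarrow> clamp01 y = y"
  by (auto simp: clamp01_def)

lemma clamp01_bounds: "0 \<le> clamp01 y" "clamp01 y \<le> 1"
  by (auto simp: clamp01_def)

lemma DERIV_glue:
  fixes f g h :: "real \<Rightarrow> real"
  assumes f: "(f has_real_derivative D) (at a)" and g: "(g has_real_derivative D) (at a)"
    and ev: "\<forall>\<^sub>F x in at_left a. h x = f x" "\<forall>\<^sub>F x in at_right a. h x = g x" "h a = f a" "h a = g a"
  shows "(h has_real_derivative D) (at a)"
  unfolding has_field_derivative_iff
proof (rule filterlim_split_at)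
  have lim: "((\<lambda>x. (f x - f a) / (x - a)) \<longlongrightarrow> D) (at_left a)"
    "((\<lambda>x. (g x - g a) / (x - a)) \<longlongrightarrow> D) (at_right a)"
    using f g unfolding has_field_derivative_iff by (auto simp: filterlim_at_split)
  have "\<forall>\<^sub>F x in at_left a. (f x - f a) / (x - a) = (h x - h a) / (x - a)"
    using ev(1) by eventually_elim (simp add: ev(3))
  from Lim_transform_eventually[OF lim(1) this]
  show "((\<lambda>x. (h x - h a) / (x - a)) \<longlongrightarrow> D) (at_left a)" .
  have "\<forall>\<^sub>F x in at_right a. (g x - g a) / (x - a) = (h x - h a) / (x - a)"
    using ev(2) by eventually_elim (simp add: ev(4))
  from Lim_transform_eventually[OF lim(2) this]
  show "((\<lambda>x. (h x - h a) / (x - a)) \<longlongrightarrow> D) (at_right a)" .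
qed

lemma DERIV_clamp01:
  assumes q: "\<And>y. (q has_real_derivative q' y) (at y)" and q': "q' 0 = 0" "q' 1 = 0"
  shows "((\<lambda>y. q (clamp01 y)) has_real_derivative q' (clamp01 y)) (at y)"
proof -
  consider "y < 0" | "y = 0" | "0 < y" "y < 1" | "y = 1" | "1 < y" by linarith
  thus ?thesis
  proof cases
    case 1
    have "((\<lambda>y. q 0) has_real_derivative 0) (at y)" by simp
    moreover have "\<forall>\<^sub>F x in nhds y. q (clamp01 x) = q 0"
      using eventually_nhds_in_open[of "{..<0}" y] 1 by (auto elim!: eventually_mono simp: clamp01_simps)
    ultimately show ?thesis using 1 q' by (simp add: DERIV_cong_ev[OF refl _ refl] clamp01_simps)
  next
    case 5
    have "((\<lambda>y. q 1) has_real_derivative 0) (at y)" by simp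
    moreover have "\<forall>\<^sub>F x in nhds y. q (clamp01 x) = q 1"
      using eventually_nhds_in_open[of "{1<..}" y] 5 by (auto elim!: eventually_mono simp: clamp01_simps)
    ultimately show ?thesis using 5 q' by (simp add: DERIV_cong_ev[OF refl _ refl] clamp01_simps)
  next
    case 3
    have "\<forall>\<^sub>F x in nhds y. q (clamp01 x) = q x"
      using eventually_nhds_in_open[of "{0<..<1}" y] 3 by (auto elim!: eventually_mono simp: clamp01_simps)
    thus ?thesis using 3 q[of y] by (simp add: DERIV_cong_ev[OF refl _ refl] clamp01_simps)
  next
    case 2
    have d: "(q has_real_derivative 0) (at 0)" using q[of 0] q' by simp
    have l: "\<forall>\<^sub>F x in at_left 0. q (clamp01 x) = q 0"
      by (rule eventually_at_leftI[of "-1"]) (simp_all add: clamp01_simps)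
    have r: "\<forall>\<^sub>F x in at_right 0. q (clamp01 x) = q x"
      by (rule eventually_at_rightI[of _ "1"]) (simp_all add: clamp01_simps)
    have "((\<lambda>y. q (clamp01 y)) has_real_derivative 0) (at 0)"
      by (rule DERIV_glue[OF _ d l r]) (simp_all add: clamp01_simps)
    thus ?thesis using 2 q' by (simp add: clamp01_simps)
  next
    case 4
    have d: "(q has_real_derivative 0) (at 1)" using q[of 1] q' by simp
    have l: "\<forall>\<^sub>F x in at_left 1. q (clamp01 x) = q x"
      by (rule eventually_at_leftI[of "0"]) (simp_all add: clamp01_simps)
    have r: "\<forall>\<^sub>F x in at_right 1. q (clamp01 x) = q 1"
      by (rule eventually_at_rightI[of _ "2"]) (simp_all add: clamp01_simps)
    have "((\<lambda>y. q (clamp01 y)) has_real_derivative 0) (at 1)"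
      by (rule DERIV_glue[OF d _ l r]) (simp_all add: clamp01_simps)
    thus ?thesis using 4 q' by (simp add: clamp01_simps)
  qed
qed

text \<open>\<open>smoothstep 0\<close> is the \<open>C\<^sup>3\<close> smoothstep and \<open>smoothstep r\<close> its derivative of order \<open>r\<close>.\<close>

definition smoothstep :: "nat \<Rightarrow> real \<Rightarrow> real" where
  "smoothstep r y = (let c = clamp01 y in
     if r = 0 then 35 * c ^ 4 - 84 * c ^ 5 + 70 * c ^ 6 - 20 * c ^ 7
     else if r = 1 then 140 * (c - c\<^sup>2) ^ 3
     else if r = 2 then 420 * (c - c\<^sup>2)\<^sup>2 * (1 - 2 * c)
     else 840 * (c - c\<^sup>2) * (1 - 5 * (c - c\<^sup>2)))"

lemma DERIV_smoothstep:
  assumes "r < 3"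
  shows "(smoothstep r has_real_derivative smoothstep (Suc r) y) (at y)"
proof -
  consider "r = 0" | "r = 1" | "r = 2" using assms by linarith
  thus ?thesis
  proof cases
    case 1
    have "((\<lambda>y. (\<lambda>c. 35 * c ^ 4 - 84 * c ^ 5 + 70 * c ^ 6 - 20 * c ^ 7) (clamp01 y)) has_real_derivative
      (\<lambda>c. 140 * (c - c\<^sup>2) ^ 3) (clamp01 y)) (at y)"
      by (rule DERIV_clamp01)
        (auto intro!: derivative_eq_intros simp: algebra_simps power2_eq_square power3_eq_cube power_numeral_reduce)
    thus ?thesis using 1 by (simp add: smoothstep_def[abs_def] Let_def)
  next
    case 2
    have "((\<lambda>y. (\<lambda>c. 140 * (c - c\<^sup>2) ^ 3) (clamp01 y)) has_real_derivative
      (\<lambda>c. 420 * (c - c\<^sup>2)\<^sup>2 * (1 - 2 * c)) (clamp01 y)) (at y)"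
      by (rule DERIV_clamp01)
        (auto intro!: derivative_eq_intros simp: algebra_simps power2_eq_square power3_eq_cube power_numeral_reduce)
    thus ?thesis using 2 by (simp add: smoothstep_def[abs_def] Let_def)
  next
    case 3
    have "((\<lambda>y. (\<lambda>c. 420 * (c - c\<^sup>2)\<^sup>2 * (1 - 2 * c)) (clamp01 y)) has_real_derivative
      (\<lambda>c. 840 * (c - c\<^sup>2) * (1 - 5 * (c - c\<^sup>2))) (clamp01 y)) (at y)"
      by (rule DERIV_clamp01)
        (auto intro!: derivative_eq_intros simp: algebra_simps power2_eq_square power3_eq_cube power_numeral_reduce)
    thus ?thesis using 3 by (simp add: smoothstep_def[abs_def] Let_def)
  qed
qed

lemma smoothstep_eq: "y \<le> 0 \<Longrightarrow> smoothstep r y = 0" "1 \<le> y \<Longrightarrow> smoothstep r y = (if r = 0 then 1 else 0)"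
  by (auto simp: smoothstep_def clamp01_simps)

lemma smoothstep_range: "0 \<le> smoothstep 0 y" "smoothstep 0 y \<le> 1"
proof -
  have nn: "0 \<le> smoothstep 1 x" for x
    using clamp01_bounds[of x] by (simp add: smoothstep_def Let_def power2_eq_square mult_left_le)
  have mono: "smoothstep 0 x \<le> smoothstep 0 z" if "x \<le> z" for x z
    using that DERIV_smoothstep[of 0] nn by (intro DERIV_nonneg_imp_nondecreasing[OF that]) auto
  show "0 \<le> smoothstep 0 y" using mono[of "min 0 y" y] by (simp add: smoothstep_eq)
  show "smoothstep 0 y \<le> 1" using mono[of y "max 1 y"] by (simp add: smoothstep_eq)
qed

lemma smoothstep_bound: "\<bar>smoothstep r y\<bar> \<le> 840"
proof -
  define c where "c = clamp01 y"
  define b where "b = c - c\<^sup>2"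
  have c: "0 \<le> c" "c \<le> 1" unfolding c_def by (rule clamp01_bounds)+
  have "0 \<le> (c - 1 / 2)\<^sup>2" by simp
  hence b: "0 \<le> b" "b \<le> 1 / 4" using c by (auto simp: b_def power2_eq_square algebra_simps mult_left_le)
  have b3: "0 \<le> b ^ 3" "b ^ 3 \<le> 1" using b by (auto intro: power_le_one)
  have b2: "0 \<le> b\<^sup>2" "b\<^sup>2 \<le> 1" using b by (auto intro: power_le_one)
  have "\<bar>b\<^sup>2 * (1 - 2 * c)\<bar> \<le> 1 * 1"
    unfolding abs_mult using b2 c by (intro mult_mono) auto
  moreover have "\<bar>b * (1 - 5 * b)\<bar> \<le> 1 * 1"
    unfolding abs_mult using b by (intro mult_mono) auto
  moreover have "\<bar>smoothstep r y\<bar> = (if r = 0 then \<bar>smoothstep 0 y\<bar> else if r = 1 then 140 * b ^ 3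
      else if r = 2 then 420 * \<bar>b\<^sup>2 * (1 - 2 * c)\<bar> else 840 * \<bar>b * (1 - 5 * b)\<bar>)"
    using b by (simp add: smoothstep_def Let_def c_def[symmetric] b_def[symmetric] abs_mult)
  ultimately show ?thesis using smoothstep_range[of y] b3 by (auto simp del: abs_mult_self_eq)
qed

definition cutoff :: "int set \<Rightarrow> real \<Rightarrow> nat \<Rightarrow> real \<Rightarrow> real" where
  "cutoff B \<eta> r x = (\<Sum>k\<in>B. smoothstep r (x / \<eta> - of_int k) - smoothstep r (x / \<eta> - of_int k - 1)) / \<eta> ^ r"

lemma DERIV_cutoff:
  assumes "r < 3" "\<eta> \<noteq> 0"
  shows "(cutoff B \<eta> r has_real_derivative cutoff B \<eta> (Suc r) x) (at x)"
proof -
  have "((\<lambda>x. smoothstep r (x / \<eta> - a)) has_real_derivative smoothstep (Suc r) (x / \<eta> - a) * (1 / \<eta>)) (at x)" for a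
    by (rule DERIV_chain2[OF DERIV_smoothstep[OF assms(1)]]) (use assms(2) in \<open>auto intro!: derivative_eq_intros\<close>)
  hence d: "((\<lambda>x. smoothstep r (x / \<eta> - of_int k) - smoothstep r (x / \<eta> - of_int k - 1)) has_real_derivative
      smoothstep (Suc r) (x / \<eta> - of_int k) * (1 / \<eta>) - smoothstep (Suc r) (x / \<eta> - of_int k - 1) * (1 / \<eta>)) (at x)" for k
    by (intro DERIV_diff) (simp_all add: diff_diff_eq)
  have "((\<lambda>x. \<Sum>k\<in>B. smoothstep r (x / \<eta> - of_int k) - smoothstep r (x / \<eta> - of_int k - 1)) has_real_derivative
      (\<Sum>k\<in>B. smoothstep (Suc r) (x / \<eta> - of_int k) * (1 / \<eta>) - smoothstep (Suc r) (x / \<eta> - of_int k - 1) * (1 / \<eta>))) (at x)"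
    by (intro DERIV_sum d)
  from DERIV_cdivide[OF this, of "\<eta> ^ r"] show ?thesis
    by (simp add: cutoff_def[abs_def] sum_divide_distrib diff_divide_distrib mult.commute)
qed

text \<open>Only the cells of index \<open>\<lfloor>x / \<eta>\<rfloor>\<close> and \<open>\<lfloor>x / \<eta>\<rfloor> - 1\<close> contribute at \<open>x\<close>.\<close>

lemma cutoff_eq:
  assumes "finite B"
  shows "cutoff B \<eta> r x = ((if \<lfloor>x / \<eta>\<rfloor> \<in> B then smoothstep r (frac (x / \<eta>)) else 0) +
    (if \<lfloor>x / \<eta>\<rfloor> - 1 \<in> B then (if r = 0 then 1 else 0) - smoothstep r (frac (x / \<eta>)) else 0)) / \<eta> ^ r"
proof -
  define m where "m = \<lfloor>x / \<eta>\<rfloor>"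
  define u where "u = frac (x / \<eta>)"
  have y: "x / \<eta> = of_int m + u" by (simp add: m_def u_def frac_def)
  have u: "0 \<le> u" "u < 1" by (auto simp: u_def frac_lt_1)
  have e: "smoothstep r (x / \<eta> - of_int k) - smoothstep r (x / \<eta> - of_int k - 1) =
    (if k = m then smoothstep r u else 0) + (if k = m - 1 then (if r = 0 then 1 else 0) - smoothstep r u else 0)" for k
  proof -
    consider "k = m" | "k = m - 1" | "m + 1 \<le> k" | "k + 2 \<le> m" by linarith
    thus ?thesis
    proof cases
      case 3
      hence "of_int m + 1 \<le> (of_int k :: real)" by linarith
      thus ?thesis using 3 u by (simp add: y smoothstep_eq)
    next
      case 4
      hence "of_int k + 2 \<le> (of_int m :: real)" by linarith
      thus ?thesis using 4 u by (simp add: y smoothstep_eq)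
    qed (use u in \<open>auto simp: y smoothstep_eq\<close>)
  qed
  show ?thesis unfolding cutoff_def e m_def[symmetric] u_def[symmetric] sum.distrib
    using assms by simp
qed

lemma cutoff_bound: "finite B \<Longrightarrow> 0 < \<eta> \<Longrightarrow> \<bar>cutoff B \<eta> r x\<bar> \<le> 2000 / \<eta> ^ r"
  using smoothstep_bound[of r "frac (x / \<eta>)"]
  by (auto simp: cutoff_eq abs_div intro!: divide_right_mono)

lemma cutoff_range: "finite B \<Longrightarrow> 0 \<le> cutoff B \<eta> 0 x" "finite B \<Longrightarrow> cutoff B \<eta> 0 x \<le> 1"
  using smoothstep_range[of "frac (x / \<eta>)"] by (auto simp: cutoff_eq)

lemma cutoff_eq_1: "finite B \<Longrightarrow> \<lfloor>x / \<eta>\<rfloor> \<in> B \<Longrightarrow> \<lfloor>x / \<eta>\<rfloor> - 1 \<in> B \<Longrightarrow> cutoff B \<eta> 0 x = 1"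
  by (simp add: cutoff_eq)

lemma cutoff_neq_0: "finite B \<Longrightarrow> cutoff B \<eta> r x \<noteq> 0 \<Longrightarrow> \<lfloor>x / \<eta>\<rfloor> \<in> B \<or> \<lfloor>x / \<eta>\<rfloor> - 1 \<in> B"
  by (auto simp: cutoff_eq split: if_splits)

section \<open>The smooth maximum and its derivatives\<close>

locale smooth_max =
  fixes \<beta> :: real and p :: nat and f f1 f2 f3 :: "real \<Rightarrow> real" and c1 c2 c3 :: real
  assumes \<beta>: "0 < \<beta>" and p: "1 \<le> p"
    and f1: "(f has_real_derivative f1 y) (at y)" and f2: "(f1 has_real_derivative f2 y) (at y)"
    and f3: "(f2 has_real_derivative f3 y) (at y)"
    and c1: "\<bar>f1 y\<bar> \<le> c1" and c2: "\<bar>f2 y\<bar> \<le> c2" and c3: "\<bar>f3 y\<bar> \<le> c3"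
begin

definition expsum :: "(nat \<Rightarrow> real) \<Rightarrow> real" where "expsum x = (\<Sum>j<p. exp (\<beta> * x j))"
definition smax :: "(nat \<Rightarrow> real) \<Rightarrow> real" where "smax x = ln (expsum x) / \<beta>"
definition weight :: "(nat \<Rightarrow> real) \<Rightarrow> nat \<Rightarrow> real" where "weight x j = exp (\<beta> * x j) / expsum x"
definition h :: "(nat \<Rightarrow> real) \<Rightarrow> real" where "h x = f (smax x)"
definition G :: "(nat \<Rightarrow> real) \<Rightarrow> nat \<Rightarrow> real" where "G x j = f1 (smax x) * weight x j"
definition H :: "(nat \<Rightarrow> real) \<Rightarrow> nat \<Rightarrow> nat \<Rightarrow> real" where
  "H x j k = f2 (smax x) * weight x j * weight x k +
     \<beta> * f1 (smax x) * ((if j = k then weight x j else 0) - weight x j * weight x k)"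

definition A2 :: real where "A2 = c2 + 2 * \<beta> * c1"
definition A3 :: real where "A3 = c3 + 3 * \<beta> * c2 + 6 * \<beta>\<^sup>2 * c1"

lemma expsum_pos: "0 < expsum x"
  unfolding expsum_def using p by (intro sum_pos) (auto simp: lessThan_empty_iff)

lemma weight_nonneg: "0 \<le> weight x j"
  using expsum_pos[of x] by (simp add: weight_def)

lemma sum_weight: "(\<Sum>j<p. weight x j) = 1"
  using expsum_pos[of x] by (simp add: weight_def flip: sum_divide_distrib) (simp add: expsum_def)

lemma c_nonneg: "0 \<le> c1" "0 \<le> c2" "0 \<le> c3"
  using c1[of 0] c2[of 0] c3[of 0] by auto

lemma A_nonneg: "0 \<le> A2" "0 \<le> A3"
  using c_nonneg \<beta> by (auto simp: A2_def A3_def)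

lemma smax_ge: "j < p \<Longrightarrow> x j \<le> smax x"
proof -
  assume "j < p"
  hence "exp (\<beta> * x j) \<le> expsum x"
    unfolding expsum_def by (intro member_le_sum[of j "{..<p}" "\<lambda>j. exp (\<beta> * x j)"]) auto
  hence "\<beta> * x j \<le> ln (expsum x)" using expsum_pos[of x] by (simp add: ln_ge_iff)
  thus "x j \<le> smax x" using \<beta> by (simp add: smax_def field_simps)
qed

lemma smax_le:
  assumes "\<And>j. j < p \<Longrightarrow> x j \<le> m"
  shows "smax x \<le> m + ln (real p) / \<beta>"
proof -
  have "expsum x \<le> (\<Sum>j<p. exp (\<beta> * m))"
    unfolding expsum_def using assms \<beta> by (intro sum_mono) auto
  also have "\<dots> = real p * exp (\<beta> * m)" by simp
  finally have "ln (expsum x) \<le> ln (real p * exp (\<beta> * m))"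
    using expsum_pos[of x] p by simp
  also have "\<dots> = ln (real p) + \<beta> * m" using p by (simp add: ln_mult)
  finally show ?thesis using \<beta> by (simp add: smax_def field_simps)
qed

lemma expsum_cong: "(\<And>j. j < p \<Longrightarrow> x j = y j) \<Longrightarrow> expsum x = expsum y"
  unfolding expsum_def by (intro sum.cong) auto

lemma h_cong: "(\<And>j. j < p \<Longrightarrow> x j = y j) \<Longrightarrow> h x = h y"
  using expsum_cong[of x y] by (simp add: h_def smax_def)

lemma measurable_f[measurable]: "f \<in> borel_measurable borel" "f1 \<in> borel_measurable borel" "f2 \<in> borel_measurable borel"
  using DERIV_isCont[OF f1] DERIV_isCont[OF f2] DERIV_isCont[OF f3]
  by (simp_all add: borel_measurable_continuous_onI continuous_at_imp_continuous_on)

lemma measurable_smax: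
  assumes "\<And>j. j < p \<Longrightarrow> (\<lambda>\<omega>. X \<omega> j) \<in> borel_measurable M"
  shows "(\<lambda>\<omega>. smax (X \<omega>)) \<in> borel_measurable M"
  unfolding smax_def expsum_def
  by (intro borel_measurable_divide borel_measurable_const borel_measurable_ln borel_measurable_sum
      borel_measurable_exp borel_measurable_times) (use assms in auto)

lemma measurable_weight:
  assumes "\<And>j. j < p \<Longrightarrow> (\<lambda>\<omega>. X \<omega> j) \<in> borel_measurable M" and "j < p"
  shows "(\<lambda>\<omega>. weight (X \<omega>) j) \<in> borel_measurable M"
  unfolding weight_def expsum_def
  by (intro borel_measurable_divide borel_measurable_sum borel_measurable_const
      borel_measurable_exp borel_measurable_times) (use assms in auto)

lemma measurable_h:
  assumes "\<And>j. j < p \<Longrightarrow> (\<lambda>\<omega>. X \<omega> j) \<in> borel_measurable M"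
  shows "(\<lambda>\<omega>. h (X \<omega>)) \<in> borel_measurable M"
  unfolding h_def using measurable_compose[OF measurable_smax[OF assms] measurable_f(1)] .

lemma measurable_G:
  assumes "\<And>j. j < p \<Longrightarrow> (\<lambda>\<omega>. X \<omega> j) \<in> borel_measurable M" and "j < p"
  shows "(\<lambda>\<omega>. G (X \<omega>) j) \<in> borel_measurable M"
  unfolding G_def using measurable_compose[OF measurable_smax[OF assms(1)] measurable_f(2)]
    measurable_weight[OF assms] by simp

lemma measurable_H:
  assumes "\<And>j. j < p \<Longrightarrow> (\<lambda>\<omega>. X \<omega> j) \<in> borel_measurable M" and "j < p" "k < p"
  shows "(\<lambda>\<omega>. H (X \<omega>) j k) \<in> borel_measurable M"
proof -
  have [measurable]: "(\<lambda>\<omega>. f1 (smax (X \<omega>))) \<in> borel_measurable M" "(\<lambda>\<omega>. f2 (smax (X \<omega>))) \<in> borel_measurable M"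
    "(\<lambda>\<omega>. weight (X \<omega>) j) \<in> borel_measurable M" "(\<lambda>\<omega>. weight (X \<omega>) k) \<in> borel_measurable M"
    using measurable_compose[OF measurable_smax[OF assms(1)] measurable_f(2)]
     measurable_compose[OF measurable_smax[OF assms(1)] measurable_f(3)]
     measurable_weight[OF assms(1)] assms(2,3) by simp_all
  show ?thesis unfolding H_def by (cases "j = k") simp_all
qed

lemma weight_le_1: "j < p \<Longrightarrow> weight x j \<le> 1"
  using member_le_sum[of j "{..<p}" "weight x"] weight_nonneg by (simp add: sum_weight)

lemma G_bound: "j < p \<Longrightarrow> \<bar>G x j\<bar> \<le> c1"
  using mult_mono[OF c1[of "smax x"] weight_le_1[of j x]] weight_nonneg[of x j] c_nonneg
  by (simp add: G_def abs_mult)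

lemma sum_abs_H: "(\<Sum>j<p. \<Sum>k<p. \<bar>H x j k\<bar>) \<le> A2"
proof -
  have ww: "(\<Sum>j<p. \<Sum>k<p. weight x j * weight x k) = 1"
    by (simp add: sum_weight flip: sum_distrib_left)
  have "\<bar>H x j k\<bar> \<le> c2 * (weight x j * weight x k) +
     \<beta> * c1 * ((if j = k then weight x j else 0) + weight x j * weight x k)" for j k
  proof -
    have w: "0 \<le> weight x j * weight x k" "0 \<le> (if j = k then weight x j else 0)"
      using weight_nonneg by auto
    have "\<bar>H x j k\<bar> \<le> \<bar>f2 (smax x)\<bar> * (weight x j * weight x k) +
       \<beta> * \<bar>f1 (smax x)\<bar> * \<bar>(if j = k then weight x j else 0) - weight x j * weight x k\<bar>"
      unfolding H_def using \<beta> w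
      by (intro order_trans[OF abs_triangle_ineq]) (simp add: abs_mult weight_nonneg mult.assoc)
    also have "\<dots> \<le> c2 * (weight x j * weight x k) +
       \<beta> * c1 * ((if j = k then weight x j else 0) + weight x j * weight x k)"
    proof (intro add_mono mult_mono mult_left_mono mult_nonneg_nonneg)
      show "\<bar>(if j = k then weight x j else 0) - weight x j * weight x k\<bar> \<le>
        (if j = k then weight x j else 0) + weight x j * weight x k"
        using w by linarith
    qed (use \<beta> w c1 c2 c_nonneg weight_nonneg in auto)
    finally show ?thesis .
  qed
  hence "(\<Sum>j<p. \<Sum>k<p. \<bar>H x j k\<bar>) \<le> (\<Sum>j<p. \<Sum>k<p. c2 * (weight x j * weight x k) +
     \<beta> * c1 * ((if j = k then weight x j else 0) + weight x j * weight x k))"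
    by (intro sum_mono)
  also have "\<dots> = A2"
    by (simp add: sum.distrib ww sum_weight A2_def flip: sum_distrib_left)
  finally show ?thesis .
qed

lemma sum_H_bound:
  assumes "\<And>j k. j < p \<Longrightarrow> k < p \<Longrightarrow> \<bar>V j k\<bar> \<le> B"
  shows "\<bar>\<Sum>j<p. \<Sum>k<p. H x j k * V j k\<bar> \<le> A2 * B"
proof -
  have "0 \<le> B" using assms[of 0 0] p by auto
  have "\<bar>\<Sum>j<p. \<Sum>k<p. H x j k * V j k\<bar> \<le> (\<Sum>j<p. \<Sum>k<p. \<bar>H x j k\<bar> * B)"
    by (intro order_trans[OF sum_abs] sum_mono) (auto simp: abs_mult intro!: mult_left_mono assms)
  also have "\<dots> = (\<Sum>j<p. \<Sum>k<p. \<bar>H x j k\<bar>) * B" by (simp add: sum_distrib_right)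
  also have "\<dots> \<le> A2 * B" using sum_abs_H \<open>0 \<le> B\<close> by (rule mult_right_mono)
  finally show ?thesis .
qed

definition moment :: "nat \<Rightarrow> (nat \<Rightarrow> real) \<Rightarrow> (nat \<Rightarrow> real) \<Rightarrow> real" where
  "moment k v x = (\<Sum>j<p. weight x j * v j ^ k)"

lemma DERIV_smax: "((\<lambda>s. smax (\<lambda>j. x j + s * v j)) has_real_derivative moment 1 v (\<lambda>j. x j + s * v j)) (at s)"
proof -
  let ?y = "\<lambda>s j. x j + s * v j"
  have "((\<lambda>s. expsum (?y s)) has_real_derivative (\<Sum>j<p. exp (\<beta> * ?y s j) * (\<beta> * v j))) (at s)"
    unfolding expsum_def by (auto intro!: derivative_eq_intros sum.cong)
  hence "((\<lambda>s. smax (?y s)) has_real_derivative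
      inverse (expsum (?y s)) * (\<Sum>j<p. exp (\<beta> * ?y s j) * (\<beta> * v j)) / \<beta>) (at s)"
    unfolding smax_def using expsum_pos by (intro DERIV_cdivide DERIV_chain2[OF DERIV_ln]) auto
  also have "inverse (expsum (?y s)) * (\<Sum>j<p. exp (\<beta> * ?y s j) * (\<beta> * v j)) / \<beta> = moment 1 v (?y s)"
    using \<beta> expsum_pos[of "?y s"]
    by (simp add: moment_def weight_def sum_distrib_left sum_divide_distrib field_simps)
  finally show ?thesis .
qed

lemma DERIV_moment:
  "((\<lambda>s. moment k v (\<lambda>j. x j + s * v j)) has_real_derivative
    \<beta> * (moment (Suc k) v (\<lambda>j. x j + s * v j) - moment k v (\<lambda>j. x j + s * v j) * moment 1 v (\<lambda>j. x j + s * v j))) (at s)"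
proof -
  let ?y = "\<lambda>s j. x j + s * v j"
  let ?N = "\<lambda>k s. \<Sum>j<p. exp (\<beta> * ?y s j) * v j ^ k"
  have dN: "((?N k) has_real_derivative \<beta> * ?N (Suc k) s) (at s)" for k
    by (auto intro!: derivative_eq_intros sum.cong simp: sum_distrib_left mult_ac)
  have dE: "((\<lambda>s. expsum (?y s)) has_real_derivative \<beta> * ?N 1 s) (at s)"
    using dN[of 0] by (simp add: expsum_def)
  have m: "moment k v (?y s) = ?N k s / expsum (?y s)" for k s
    by (simp add: moment_def weight_def sum_divide_distrib)
  have E: "expsum (?y s) \<noteq> 0" using expsum_pos[of "?y s"] by simp
  show ?thesis unfolding m
    by (rule DERIV_cong[OF DERIV_divide[OF dN dE E]]) (use E in \<open>simp add: field_simps\<close>)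
qed

definition psi1 :: "(nat \<Rightarrow> real) \<Rightarrow> (nat \<Rightarrow> real) \<Rightarrow> real" where
  "psi1 v x = f1 (smax x) * moment 1 v x"
definition psi2 :: "(nat \<Rightarrow> real) \<Rightarrow> (nat \<Rightarrow> real) \<Rightarrow> real" where
  "psi2 v x = f2 (smax x) * (moment 1 v x)\<^sup>2 + \<beta> * f1 (smax x) * (moment 2 v x - (moment 1 v x)\<^sup>2)"
definition psi3 :: "(nat \<Rightarrow> real) \<Rightarrow> (nat \<Rightarrow> real) \<Rightarrow> real" where
  "psi3 v x = f3 (smax x) * moment 1 v x ^ 3 + 3 * \<beta> * f2 (smax x) * moment 1 v x * (moment 2 v x - (moment 1 v x)\<^sup>2) +
     \<beta>\<^sup>2 * f1 (smax x) * (moment 3 v x - 3 * moment 1 v x * moment 2 v x + 2 * moment 1 v x ^ 3)"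

lemma psi1_eq: "psi1 v x = (\<Sum>j<p. G x j * v j)"
  by (simp add: psi1_def moment_def G_def sum_distrib_left mult_ac)

lemma psi2_eq: "psi2 v x = (\<Sum>j<p. \<Sum>k<p. H x j k * (v j * v k))"
proof -
  have a: "(\<Sum>j<p. \<Sum>k<p. weight x j * weight x k * (v j * v k)) = (moment 1 v x)\<^sup>2"
    unfolding moment_def power2_eq_square sum_product by (simp add: mult_ac)
  have "(\<Sum>k<p. (if j = k then weight x j else 0) * (v j * v k)) = weight x j * v j ^ 2" if "j < p" for j
    using that by (simp add: if_distrib[of "\<lambda>a. a * _"] power2_eq_square cong: if_cong)
  hence b: "(\<Sum>j<p. \<Sum>k<p. (if j = k then weight x j else 0) * (v j * v k)) = moment 2 v x"
    by (simp add: moment_def)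
  have "H x j k * (v j * v k) = f2 (smax x) * (weight x j * weight x k * (v j * v k)) +
     \<beta> * f1 (smax x) * ((if j = k then weight x j else 0) * (v j * v k)) -
     \<beta> * f1 (smax x) * (weight x j * weight x k * (v j * v k))" for j k
    by (simp add: H_def algebra_simps)
  thus ?thesis
    by (simp add: sum.distrib sum_subtractf a b flip: sum_distrib_left) (simp add: psi2_def algebra_simps)
qed

lemma DERIV_psi:
  "((\<lambda>s. h (\<lambda>j. x j + s * v j)) has_real_derivative psi1 v (\<lambda>j. x j + s * v j)) (at s)"
  "((\<lambda>s. psi1 v (\<lambda>j. x j + s * v j)) has_real_derivative psi2 v (\<lambda>j. x j + s * v j)) (at s)"
  "((\<lambda>s. psi2 v (\<lambda>j. x j + s * v j)) has_real_derivative psi3 v (\<lambda>j. x j + s * v j)) (at s)"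
proof -
  let ?y = "\<lambda>s j. x j + s * v j"
  note d = DERIV_chain2[OF f1 DERIV_smax[of x v s]] DERIV_chain2[OF f2 DERIV_smax[of x v s]]
    DERIV_chain2[OF f3 DERIV_smax[of x v s]]
  note dm = DERIV_moment[of 1 v x s] DERIV_moment[of 2 v x s]
  show "((\<lambda>s. h (?y s)) has_real_derivative psi1 v (?y s)) (at s)"
    unfolding h_def psi1_def by (rule d)
  show "((\<lambda>s. psi1 v (?y s)) has_real_derivative psi2 v (?y s)) (at s)"
    unfolding psi1_def
    by (rule DERIV_cong[OF DERIV_mult[OF d(2) dm(1)]])
      (simp add: psi2_def numeral_2_eq_2 power2_eq_square algebra_simps)
  show "((\<lambda>s. psi2 v (?y s)) has_real_derivative psi3 v (?y s)) (at s)"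
    unfolding psi2_def
    by (rule DERIV_cong[OF DERIV_add[OF DERIV_mult[OF d(3) DERIV_power[OF dm(1), of 2]]
         DERIV_mult[OF DERIV_cmult[OF d(2), of \<beta>] DERIV_diff[OF dm(2) DERIV_power[OF dm(1), of 2]]]]])
      (simp add: psi3_def power2_eq_square power3_eq_cube algebra_simps eval_nat_numeral)
qed

lemma psi2_bound:
  assumes "\<And>j. j < p \<Longrightarrow> \<bar>v j\<bar> \<le> L"
  shows "\<bar>psi2 v x\<bar> \<le> A2 * L\<^sup>2"
  unfolding psi2_eq power2_eq_square
  by (rule sum_H_bound) (auto simp: abs_mult intro!: mult_mono assms order_trans[OF abs_ge_zero assms])

lemma psi3_bound: "\<bar>psi3 v x\<bar> \<le> A3 * moment 3 (\<lambda>j. \<bar>v j\<bar>) x"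
proof -
  define a where "a k = moment k (\<lambda>j. \<bar>v j\<bar>) x" for k
  have a0: "0 \<le> a k" for k unfolding a_def moment_def by (intro sum_nonneg mult_nonneg_nonneg weight_nonneg) auto
  have mb: "\<bar>moment k v x\<bar> \<le> a k" for k
    unfolding a_def moment_def
    by (intro order_trans[OF sum_abs] sum_mono) (simp add: abs_mult weight_nonneg power_abs)
  have m2: "moment 2 v x = a 2" by (simp add: a_def moment_def)
  have var: "0 \<le> moment 2 v x - (moment 1 v x)\<^sup>2"
  proof -
    have "0 \<le> (\<Sum>j<p. weight x j * (v j - moment 1 v x)\<^sup>2)"
      by (intro sum_nonneg mult_nonneg_nonneg weight_nonneg) auto
    also have "\<dots> = (\<Sum>j<p. weight x j * v j ^ 2 - 2 * moment 1 v x * (weight x j * v j) + (moment 1 v x)\<^sup>2 * weight x j)"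
      by (intro sum.cong refl) (simp add: power2_eq_square algebra_simps)
    also have "\<dots> = moment 2 v x - 2 * moment 1 v x * (\<Sum>j<p. weight x j * v j) + (moment 1 v x)\<^sup>2 * (\<Sum>j<p. weight x j)"
      by (simp add: sum.distrib sum_subtractf moment_def[of 2] flip: sum_distrib_left)
    also have "(\<Sum>j<p. weight x j * v j) = moment 1 v x" by (simp add: moment_def)
    finally show ?thesis by (simp add: sum_weight power2_eq_square)
  qed
  have a12: "a 1 * a 2 \<le> a 3"
  proof -
    have ineq: "s * t\<^sup>2 \<le> (s ^ 3 + 2 * t ^ 3) / 3" if "0 \<le> s" "0 \<le> t" for s t :: real
    proof -
      have "0 \<le> (s - t)\<^sup>2 * (s + 2 * t)" using that by simp
      thus ?thesis by (simp add: power2_eq_square power3_eq_cube algebra_simps)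
    qed
    have "a 1 * a 2 = (\<Sum>j<p. \<Sum>k<p. weight x j * weight x k * (\<bar>v j\<bar> * \<bar>v k\<bar>\<^sup>2))"
      unfolding a_def moment_def sum_product by (simp add: mult_ac)
    also have "\<dots> \<le> (\<Sum>j<p. \<Sum>k<p. weight x j * weight x k * ((\<bar>v j\<bar> ^ 3 + 2 * \<bar>v k\<bar> ^ 3) / 3))"
      by (intro sum_mono mult_left_mono ineq mult_nonneg_nonneg weight_nonneg) auto
    also have "\<dots> = (a 3 * (\<Sum>k<p. weight x k) + 2 * ((\<Sum>j<p. weight x j) * a 3)) / 3"
      unfolding a_def moment_def sum_product
      by (simp add: sum.distrib sum_distrib_left sum_divide_distrib add_divide_distrib distrib_left mult_ac)
    finally show ?thesis by (simp add: sum_weight)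
  qed
  have m1sq: "(moment 1 v x)\<^sup>2 \<le> a 2" using var m2 by simp
  have m13: "\<bar>moment 1 v x\<bar> ^ 3 \<le> a 3"
  proof -
    have "\<bar>moment 1 v x\<bar> ^ 3 = \<bar>moment 1 v x\<bar> * (moment 1 v x)\<^sup>2" by (simp add: power3_eq_cube power2_eq_square)
    also have "\<dots> \<le> a 1 * a 2" using mb m1sq a0 by (intro mult_mono) auto
    finally show ?thesis using a12 by simp
  qed
  have m12: "\<bar>moment 1 v x\<bar> * moment 2 v x \<le> a 3"
    using mult_right_mono[OF mb[of 1] a0[of 2]] a12 m2 by simp
  have m1v: "\<bar>moment 1 v x\<bar> * (moment 2 v x - (moment 1 v x)\<^sup>2) \<le> a 3"
    using m12 mult_left_mono[of "moment 2 v x - (moment 1 v x)\<^sup>2" "moment 2 v x" "\<bar>moment 1 v x\<bar>"] by simp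
  have t1: "\<bar>f3 (smax x) * moment 1 v x ^ 3\<bar> \<le> c3 * a 3"
    unfolding abs_mult power_abs using c3 m13 c_nonneg by (intro mult_mono) auto
  have t2: "\<bar>3 * \<beta> * f2 (smax x) * moment 1 v x * (moment 2 v x - (moment 1 v x)\<^sup>2)\<bar> \<le> 3 * \<beta> * (c2 * a 3)"
  proof -
    have "\<bar>3 * \<beta> * f2 (smax x) * moment 1 v x * (moment 2 v x - (moment 1 v x)\<^sup>2)\<bar> =
      3 * \<beta> * (\<bar>f2 (smax x)\<bar> * (\<bar>moment 1 v x\<bar> * (moment 2 v x - (moment 1 v x)\<^sup>2)))"
      using \<beta> var by (simp add: abs_mult)
    also have "\<dots> \<le> 3 * \<beta> * (c2 * a 3)"
      using \<beta> c2 m1v c_nonneg var by (intro mult_left_mono mult_mono) auto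
    finally show ?thesis .
  qed
  have t3: "\<bar>\<beta>\<^sup>2 * f1 (smax x) * (moment 3 v x - 3 * moment 1 v x * moment 2 v x + 2 * moment 1 v x ^ 3)\<bar> \<le>
     \<beta>\<^sup>2 * (c1 * (6 * a 3))"
  proof -
    have "\<bar>moment 3 v x - 3 * moment 1 v x * moment 2 v x + 2 * moment 1 v x ^ 3\<bar> \<le>
      \<bar>moment 3 v x\<bar> + 3 * (\<bar>moment 1 v x\<bar> * \<bar>moment 2 v x\<bar>) + 2 * \<bar>moment 1 v x\<bar> ^ 3"
    proof -
      have tri: "\<bar>r - 3 * s * t + 2 * s ^ 3\<bar> \<le> \<bar>r\<bar> + 3 * (\<bar>s\<bar> * \<bar>t\<bar>) + 2 * \<bar>s\<bar> ^ 3" for r s t :: real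
      proof -
        have "\<bar>3 * s * t\<bar> = 3 * (\<bar>s\<bar> * \<bar>t\<bar>)" "\<bar>2 * s ^ 3\<bar> = 2 * \<bar>s\<bar> ^ 3"
          by (simp_all add: abs_mult power_abs)
        thus ?thesis by linarith
      qed
      show ?thesis by (rule tri)
    qed
    also have "\<dots> \<le> a 3 + 3 * a 3 + 2 * a 3"
      using mb[of 3] m12 m13 a0[of 2] m2 by (intro add_mono mult_left_mono) auto
    finally have "\<bar>moment 3 v x - 3 * moment 1 v x * moment 2 v x + 2 * moment 1 v x ^ 3\<bar> \<le> 6 * a 3" by simp
    thus ?thesis unfolding abs_mult mult.assoc using c1 c_nonneg by (intro mult_mono) auto
  qed
  have "\<bar>psi3 v x\<bar> \<le> c3 * a 3 + 3 * \<beta> * (c2 * a 3) + \<beta>\<^sup>2 * (c1 * (6 * a 3))"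
    unfolding psi3_def using t1 t2 t3 by linarith
  also have "\<dots> = A3 * a 3" by (simp add: A3_def algebra_simps)
  finally show ?thesis by (simp add: a_def)
qed

lemma moment3_le:
  assumes "\<And>j. j < p \<Longrightarrow> \<bar>v j\<bar> \<le> L"
  shows "moment 3 (\<lambda>j. \<bar>v j\<bar>) x \<le> L ^ 3"
proof -
  have "moment 3 (\<lambda>j. \<bar>v j\<bar>) x \<le> (\<Sum>j<p. weight x j * L ^ 3)"
    unfolding moment_def by (intro sum_mono mult_left_mono power_mono weight_nonneg) (auto intro: assms)
  thus ?thesis by (simp add: sum_weight flip: sum_distrib_right)
qed

text \<open>
  The softmax weights change by at most a constant factor under perturbations of size \<open>1 / \<beta>\<close>; this
  is what puts the sum over \<open>i\<close> inside the maximum in \<open>B2\<close>.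
\<close>

lemma weight_stable:
  assumes v: "\<And>j. j < p \<Longrightarrow> \<beta> * \<bar>v j\<bar> \<le> 1" and j: "j < p"
  shows "weight (\<lambda>j. x j + v j) j \<le> exp 2 * weight x j"
proof -
  have v': "\<beta> * v j \<le> 1" "- 1 \<le> \<beta> * v j" if "j < p" for j
  proof -
    have "\<bar>\<beta> * v j\<bar> \<le> 1" using v[OF that] \<beta> by (simp add: abs_mult)
    thus "\<beta> * v j \<le> 1" "- 1 \<le> \<beta> * v j" by auto
  qed
  have "exp (\<beta> * (x j + v j)) \<le> exp 1 * exp (\<beta> * x j)"
    using v'[OF j] by (simp add: distrib_left flip: exp_add)
  moreover have "exp (- 1) * expsum x \<le> expsum (\<lambda>j. x j + v j)"
    unfolding expsum_def sum_distrib_left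
    by (intro sum_mono) (use v' in \<open>simp add: distrib_left flip: exp_add\<close>)
  ultimately have "weight (\<lambda>j. x j + v j) j \<le> (exp 1 * exp (\<beta> * x j)) / (exp (- 1) * expsum x)"
    unfolding weight_def using expsum_pos by (intro frac_le) auto
  also have "\<dots> = exp 2 * weight x j"
    by (simp add: weight_def exp_minus field_simps flip: exp_add)
  finally show ?thesis .
qed

lemma taylor_1:
  assumes L: "\<And>j. j < p \<Longrightarrow> \<bar>v j\<bar> \<le> L"
  shows "\<bar>h (\<lambda>j. x j + v j) - h x - (\<Sum>j<p. G x j * v j)\<bar> \<le> A2 * L\<^sup>2"
proof -
  let ?y = "\<lambda>s j. x j + s * v j"
  define d where "d m = (if m = 0 then (\<lambda>s. h (?y s)) else if m = 1 then (\<lambda>s. psi1 v (?y s)) else (\<lambda>s. psi2 v (?y s)))" for m :: nat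
  have "\<exists>t>0. t < 1 \<and> h (?y 1) = (\<Sum>m<2. d m 0 / fact m * 1 ^ m) + d 2 t / fact 2 * 1 ^ 2"
    by (rule Maclaurin) (auto simp: d_def less_2_cases_iff DERIV_psi)
  then obtain t where "h (?y 1) = h (?y 0) + psi1 v (?y 0) + psi2 v (?y t) / 2"
    by (auto simp: d_def numeral_2_eq_2)
  hence "h (\<lambda>j. x j + v j) - h x - (\<Sum>j<p. G x j * v j) = psi2 v (?y t) / 2" by (simp add: psi1_eq)
  moreover have "\<bar>psi2 v (?y t)\<bar> \<le> A2 * L\<^sup>2" by (rule psi2_bound[OF L])
  ultimately show ?thesis by simp
qed

lemma taylor_2:
  assumes L: "\<And>j. j < p \<Longrightarrow> \<bar>v j\<bar> \<le> L"
  shows "\<bar>h (\<lambda>j. x j + v j) - h x - (\<Sum>j<p. G x j * v j) - (\<Sum>j<p. \<Sum>k<p. H x j k * (v j * v k)) / 2\<bar> \<le> A3 * L ^ 3"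
proof -
  let ?y = "\<lambda>s j. x j + s * v j"
  define d where "d m = (if m = 0 then (\<lambda>s. h (?y s)) else if m = 1 then (\<lambda>s. psi1 v (?y s)) else if m = 2 then (\<lambda>s. psi2 v (?y s)) else (\<lambda>s. psi3 v (?y s)))" for m :: nat
  have "\<exists>t>0. t < 1 \<and> h (?y 1) = (\<Sum>m<3. d m 0 / fact m * 1 ^ m) + d 3 t / fact 3 * 1 ^ 3"
    by (rule Maclaurin) (auto simp: d_def less_Suc_eq numeral_3_eq_3 DERIV_psi)
  then obtain t where "h (?y 1) = h (?y 0) + psi1 v (?y 0) + psi2 v (?y 0) / 2 + psi3 v (?y t) / 6"
    by (auto simp: d_def numeral_3_eq_3 fact_numeral)
  hence "h (\<lambda>j. x j + v j) - h x - (\<Sum>j<p. G x j * v j) - (\<Sum>j<p. \<Sum>k<p. H x j k * (v j * v k)) / 2 = psi3 v (?y t) / 6"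
    by (simp add: psi1_eq psi2_eq)
  moreover have "\<bar>psi3 v (?y t)\<bar> \<le> A3 * L ^ 3"
    using order_trans[OF psi3_bound mult_left_mono[OF moment3_le[OF L] A_nonneg(2)]] .
  ultimately show ?thesis by simp
qed

lemma taylor_gradient:
  assumes u: "0 \<le> u" "u \<le> 1" and L: "\<And>j. j < p \<Longrightarrow> \<bar>v j\<bar> \<le> L"
  shows "\<bar>(\<Sum>j<p. G x j * v j) - (\<Sum>j<p. G (\<lambda>j. x j - u * v j) j * v j) - u * (\<Sum>j<p. \<Sum>k<p. H x j k * (v j * v k))\<bar>
    \<le> A3 * (if \<beta> * L \<le> 1 then exp 2 * (\<Sum>j<p. weight x j * \<bar>v j\<bar> ^ 3) else L ^ 3)"
proof -
  let ?y = "\<lambda>s j. x j + s * v j"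
  define d where "d m = (if m = 0 then (\<lambda>s. psi1 v (?y (- u * s))) else if m = 1 then (\<lambda>s. - u * psi2 v (?y (- u * s))) else (\<lambda>s. u\<^sup>2 * psi3 v (?y (- u * s))))" for m :: nat
  have ds: "((\<lambda>s. - u * s) has_real_derivative - u) (at t)" for t by (auto intro!: derivative_eq_intros)
  have d1: "((\<lambda>s. psi1 v (?y (- u * s))) has_real_derivative - u * psi2 v (?y (- u * t))) (at t)" for t
    using DERIV_chain2[OF DERIV_psi(2) ds, of v x t] by (simp add: mult.commute)
  have d2: "((\<lambda>s. - u * psi2 v (?y (- u * s))) has_real_derivative u\<^sup>2 * psi3 v (?y (- u * t))) (at t)" for t
    using DERIV_cmult[OF DERIV_chain2[OF DERIV_psi(3) ds], of "- u" v x t] by (simp add: power2_eq_square mult_ac)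
  have "\<exists>t>0. t < 1 \<and> psi1 v (?y (- u * 1)) = (\<Sum>m<2. d m 0 / fact m * 1 ^ m) + d 2 t / fact 2 * 1 ^ 2"
  proof (rule Maclaurin)
    show "\<forall>m t. m < 2 \<and> 0 \<le> t \<and> t \<le> 1 \<longrightarrow> (d m has_real_derivative d (Suc m) t) (at t)"
      using d1 d2 by (auto simp: d_def less_2_cases_iff)
  qed (auto simp: d_def)
  then obtain t where t: "0 < t" "t < 1"
    "psi1 v (?y (- u)) = psi1 v (?y 0) - u * psi2 v (?y 0) + u\<^sup>2 * psi3 v (?y (- u * t)) / 2"
    by (auto simp: d_def numeral_2_eq_2)
  define z where "z = ?y (- u * t)"
  have "(\<Sum>j<p. G x j * v j) - (\<Sum>j<p. G (\<lambda>j. x j - u * v j) j * v j) - u * (\<Sum>j<p. \<Sum>k<p. H x j k * (v j * v k)) =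
     - (u\<^sup>2 * psi3 v z / 2)"
    using t(3) by (simp add: psi1_eq psi2_eq z_def)
  moreover have "\<bar>psi3 v z\<bar> \<le> A3 * (if \<beta> * L \<le> 1 then exp 2 * (\<Sum>j<p. weight x j * \<bar>v j\<bar> ^ 3) else L ^ 3)"
  proof (cases "\<beta> * L \<le> 1")
    case True
    have ut: "\<bar>- u * t\<bar> \<le> 1" using u t by (simp add: abs_mult mult_le_one)
    have "moment 3 (\<lambda>j. \<bar>v j\<bar>) z \<le> (\<Sum>j<p. (exp 2 * weight x j) * \<bar>v j\<bar> ^ 3)"
      unfolding moment_def z_def
    proof (intro sum_mono mult_right_mono weight_stable)
      fix j k assume "k < p"
      have "\<bar>- u * t * v k\<bar> \<le> 1 * L"
        unfolding abs_mult[of "- u * t"] using ut L[OF \<open>k < p\<close>] by (intro mult_mono) auto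
      hence "\<beta> * \<bar>- u * t * v k\<bar> \<le> \<beta> * L" using \<beta> by simp
      thus "\<beta> * \<bar>- u * t * v k\<bar> \<le> 1" using True by linarith
    qed auto
    hence "moment 3 (\<lambda>j. \<bar>v j\<bar>) z \<le> exp 2 * (\<Sum>j<p. weight x j * \<bar>v j\<bar> ^ 3)"
      by (simp add: sum_distrib_left mult.assoc)
    thus ?thesis using True order_trans[OF psi3_bound mult_left_mono[OF _ A_nonneg(2)]] by simp
  next
    case False
    thus ?thesis using order_trans[OF psi3_bound mult_left_mono[OF moment3_le[OF L] A_nonneg(2)]] by simp
  qed
  moreover have "u\<^sup>2 * \<bar>psi3 v z\<bar> \<le> \<bar>psi3 v z\<bar>" using u by (intro mult_left_le_one_le) (auto simp: power_le_one)
  ultimately show ?thesis by (simp add: abs_mult)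
qed

end

section \<open>Comparison with the normal law\<close>

lemma le_one_plus_cube:
  fixes a b :: real
  assumes "0 \<le> a"
  shows "a \<le> 1 + a ^ 3" "a\<^sup>2 \<le> 1 + a ^ 3"
proof -
  have "a \<le> 1 + a ^ 3 \<and> a\<^sup>2 \<le> 1 + a ^ 3"
  proof (cases "a \<le> 1")
    case True
    have "a\<^sup>2 \<le> 1" "0 \<le> a ^ 3" using assms True by (auto intro: power_le_one)
    thus ?thesis using True by linarith
  next
    case False
    hence "a ^ 1 \<le> a ^ 3" "a ^ 2 \<le> a ^ 3" by (intro power_increasing; simp)+
    thus ?thesis by simp
  qed
  thus "a \<le> 1 + a ^ 3" "a\<^sup>2 \<le> 1 + a ^ 3" by auto
qed

lemma abs_mult_le_cubes:
  fixes a b :: real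
  shows "\<bar>a * b\<bar> \<le> 2 + \<bar>a\<bar> ^ 3 + \<bar>b\<bar> ^ 3"
proof -
  have "\<bar>a * b\<bar> \<le> \<bar>a\<bar>\<^sup>2 + \<bar>b\<bar>\<^sup>2"
  proof -
    have "2 * (\<bar>a\<bar> * \<bar>b\<bar>) \<le> \<bar>a\<bar>\<^sup>2 + \<bar>b\<bar>\<^sup>2" using sum_squares_bound[of "\<bar>a\<bar>" "\<bar>b\<bar>"] by simp
    moreover have "0 \<le> \<bar>a\<bar> * \<bar>b\<bar>" by simp
    ultimately show ?thesis unfolding abs_mult by linarith
  qed
  also have "\<dots> \<le> (1 + \<bar>a\<bar> ^ 3) + (1 + \<bar>b\<bar> ^ 3)"
    by (intro add_mono le_one_plus_cube) auto
  finally show ?thesis by simp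
qed

text \<open>The library versions of this bound ask for a Euclidean domain.\<close>

lemma abs_integral_le:
  fixes f g :: "'a \<Rightarrow> real"
  assumes f: "integrable M f" and g: "integrable M g" and le: "\<And>x. x \<in> space M \<Longrightarrow> \<bar>f x\<bar> \<le> g x"
  shows "\<bar>integral\<^sup>L M f\<bar> \<le> integral\<^sup>L M g"
  by (rule order_trans[OF integral_abs_bound]) (intro integral_mono integrable_abs f g le)

locale comparison = smooth_max \<beta> p f f1 f2 f3 c1 c2 c3 + prob_space M
  for \<beta> :: real and p :: nat and f f1 f2 f3 :: "real \<Rightarrow> real" and c1 c2 c3 :: real and M :: "'a measure" +
  fixes n :: nat and X :: "nat \<Rightarrow> 'a \<Rightarrow> nat \<Rightarrow> real" and \<nu> :: "(nat \<Rightarrow> real) measure"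
  assumes indep: "indep_vars (\<lambda>_. borel_vec p) X {..<n}"
    and X3: "i < n \<Longrightarrow> j < p \<Longrightarrow> integrable M (\<lambda>\<omega>. \<bar>X i \<omega> j\<bar> ^ 3)"
    and X0: "i < n \<Longrightarrow> j < p \<Longrightarrow> (LINT \<omega>|M. X i \<omega> j) = 0"
    and normal: "centred_normal \<nu> p (\<lambda>j k. \<Sum>i<n. LINT \<omega>|M. X i \<omega> j * X i \<omega> k)"
    and f_bound: "\<bar>f y\<bar> \<le> 1"
begin

definition Sig :: "nat \<Rightarrow> nat \<Rightarrow> real" where "Sig j k = (\<Sum>i<n. LINT \<omega>|M. X i \<omega> j * X i \<omega> k)"
definition S :: "'a \<Rightarrow> nat \<Rightarrow> real" where "S \<omega> j = (\<Sum>i<n. X i \<omega> j)"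
definition vmax :: "(nat \<Rightarrow> real) \<Rightarrow> real" where "vmax v = (MAX j\<in>{..<p}. \<bar>v j\<bar>)"

sublocale N: centred_normal \<nu> p Sig
  unfolding Sig_def by (rule normal)

lemma p_nonempty: "{..<p} \<noteq> {}"
  using p by (auto simp: lessThan_empty_iff)

lemma measurable_X[measurable]: "i < n \<Longrightarrow> j < p \<Longrightarrow> (\<lambda>\<omega>. X i \<omega> j) \<in> borel_measurable M"
  using indep measurable_compose[of "X i" M "borel_vec p" "\<lambda>x. x j" borel] measurable_component_singleton[of j "{..<p}" "\<lambda>_. borel"]
  by (auto simp: indep_vars_def)

lemma measurable_S[measurable]: "j < p \<Longrightarrow> (\<lambda>\<omega>. S \<omega> j) \<in> borel_measurable M"
  unfolding S_def by (intro borel_measurable_sum) auto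

lemma h_bound: "\<bar>h x\<bar> \<le> 1"
  by (simp add: h_def f_bound)

lemma vmax_ge: "j < p \<Longrightarrow> \<bar>v j\<bar> \<le> vmax v"
  unfolding vmax_def by (intro Max_ge) auto

lemma vmax_attained: "\<exists>j<p. vmax v = \<bar>v j\<bar>"
proof -
  have "Max ((\<lambda>j. \<bar>v j\<bar>) ` {..<p}) \<in> (\<lambda>j. \<bar>v j\<bar>) ` {..<p}"
    by (rule Max_in) (use p_nonempty in blast)+
  thus ?thesis by (auto simp: vmax_def)
qed

lemma vmax_nonneg: "0 \<le> vmax v"
  using vmax_attained[of v] by auto

lemma vmax_power: "vmax v ^ k = (MAX j\<in>{..<p}. \<bar>v j\<bar> ^ k)"
proof (rule Max_eqI[symmetric])
  show "y \<le> vmax v ^ k" if "y \<in> (\<lambda>j. \<bar>v j\<bar> ^ k) ` {..<p}" for y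
    using that vmax_ge by (auto intro: power_mono)
  show "vmax v ^ k \<in> (\<lambda>j. \<bar>v j\<bar> ^ k) ` {..<p}"
    using vmax_attained[of v] by auto
qed auto

lemma vmax_scale: "0 \<le> c \<Longrightarrow> j < p \<Longrightarrow> \<bar>c * v j\<bar> \<le> c * vmax v"
  by (simp add: abs_mult mult_left_mono vmax_ge)

lemma integrable_XX: "i < n \<Longrightarrow> i' < n \<Longrightarrow> j < p \<Longrightarrow> k < p \<Longrightarrow> integrable M (\<lambda>\<omega>. X i \<omega> j * X i' \<omega> k)"
proof -
  assume a: "i < n" "i' < n" "j < p" "k < p"
  have "integrable M (\<lambda>\<omega>. 2 + \<bar>X i \<omega> j\<bar> ^ 3 + \<bar>X i' \<omega> k\<bar> ^ 3)" using X3 a by simp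
  thus ?thesis
    by (rule Bochner_Integration.integrable_bound) (use a abs_mult_le_cubes in \<open>auto intro!: AE_I2 order_trans[OF _ abs_ge_self]\<close>)
qed

lemma integrable_X: "i < n \<Longrightarrow> j < p \<Longrightarrow> integrable M (\<lambda>\<omega>. X i \<omega> j)"
proof -
  assume a: "i < n" "j < p"
  have "integrable M (\<lambda>\<omega>. 1 + \<bar>X i \<omega> j\<bar> ^ 3)" using X3 a by simp
  thus ?thesis
    by (rule Bochner_Integration.integrable_bound) (use a le_one_plus_cube in \<open>auto intro!: AE_I2 order_trans[OF _ abs_ge_self]\<close>)
qed

lemma integrable_vmax_S: "integrable M (\<lambda>\<omega>. (vmax (S \<omega>))\<^sup>2)"
proof -
  have "integrable M (\<lambda>\<omega>. \<bar>S \<omega> j\<bar>\<^sup>2)" if "j < p" for j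
  proof -
    have "\<bar>S \<omega> j\<bar>\<^sup>2 = (\<Sum>i<n. \<Sum>i'<n. X i \<omega> j * X i' \<omega> j)" for \<omega>
      unfolding power2_abs by (simp add: S_def power2_eq_square sum_product)
    moreover have "integrable M (\<lambda>\<omega>. \<Sum>i<n. \<Sum>i'<n. X i \<omega> j * X i' \<omega> j)"
      using integrable_XX that by (intro Bochner_Integration.integrable_sum) auto
    ultimately show ?thesis by simp
  qed
  thus ?thesis unfolding vmax_power using p_nonempty by (intro integrable_MAX) auto
qed

lemma integrable_vmax_normal: "integrable \<nu> (\<lambda>x. vmax x ^ 3)"
  unfolding vmax_power using p_nonempty N.coord_moments by (intro integrable_MAX) auto

definition V :: "'a \<Rightarrow> real" where
  "V \<omega> = Max ((\<lambda>(j, k). \<bar>\<Sum>i<n. (X i \<omega> j * X i \<omega> k - (LINT \<omega>'|M. X i \<omega>' j * X i \<omega>' k))\<bar>) ` ({..<p} \<times> {..<p}))"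
definition T :: "'a \<Rightarrow> real" where
  "T \<omega> = (MAX j\<in>{..<p}. \<Sum>i<n. \<bar>X i \<omega> j\<bar> ^ 3)"
definition R :: "nat \<Rightarrow> 'a \<Rightarrow> real" where
  "R i \<omega> = (MAX j\<in>{..<p}. \<bar>X i \<omega> j\<bar> ^ 3) * indicator {\<omega>'. (MAX j\<in>{..<p}. \<bar>X i \<omega>' j\<bar>) > inverse \<beta> / 2} \<omega>"

definition err :: real where
  "err = A2 * B1 M n p X + A3 * (exp 2 * B2 M n p X + B3 M n p X \<beta>)"

lemma integrable_V: "integrable M V"
proof -
  have "integrable M (\<lambda>\<omega>. MAX jk\<in>{..<p} \<times> {..<p}. \<bar>\<Sum>i<n. (X i \<omega> (fst jk) * X i \<omega> (snd jk) -
      (LINT \<omega>'|M. X i \<omega>' (fst jk) * X i \<omega>' (snd jk)))\<bar>)"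
    using p_nonempty integrable_XX by (intro integrable_MAX integrable_abs Bochner_Integration.integrable_sum) auto
  thus ?thesis by (simp add: V_def[abs_def] split_beta')
qed

lemma integrable_T: "integrable M T"
  unfolding T_def[abs_def] using p_nonempty X3
  by (intro integrable_MAX Bochner_Integration.integrable_sum) auto

lemma integrable_R: "i < n \<Longrightarrow> integrable M (R i)"
proof -
  assume i: "i < n"
  have I: "integrable M (\<lambda>\<omega>. MAX j\<in>{..<p}. \<bar>X i \<omega> j\<bar> ^ 3)"
    using p_nonempty X3 i by (intro integrable_MAX) auto
  have m: "(\<lambda>\<omega>. MAX j\<in>{..<p}. \<bar>X i \<omega> j\<bar>) \<in> borel_measurable M"
    using i by (intro borel_measurable_Max) auto
  have "{\<omega> \<in> space M. (MAX j\<in>{..<p}. \<bar>X i \<omega> j\<bar>) > inverse \<beta> / 2} \<in> events"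
    using m by measurable
  from integrable_mult_indicator[OF this I] show ?thesis
    by (rule Bochner_Integration.integrable_cong[THEN iffD1, OF refl, rotated])
      (auto simp: R_def indicator_def)
qed

lemma R_nonneg: "0 \<le> R i \<omega>"
  using vmax_nonneg[of "X i \<omega>"] by (simp add: R_def vmax_power[symmetric])

lemma integral_bounds: "integral\<^sup>L M V = B1 M n p X" "integral\<^sup>L M T = B2 M n p X"
  "(\<Sum>i<n. integral\<^sup>L M (R i)) = B3 M n p X \<beta>"
  by (simp_all add: V_def[abs_def] B1_def T_def[abs_def] B2_def R_def[abs_def] B3_def)

lemma integrable_bounded:
  assumes "prob_space P" "g \<in> borel_measurable P" "\<And>x. \<bar>g x\<bar> \<le> (B::real)"
  shows "integrable P g"
proof -
  interpret P: prob_space P by fact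
  show ?thesis using assms by (intro P.integrable_const_bound[of _ B]) auto
qed

text \<open>
  The leave-one-out terms \<open>G (W - u X\<^sub>i)\<close> make the first-order part have mean zero; the Taylor
  expansion of the gradient then produces \<open>X\<^sub>i X\<^sub>i\<^sup>T\<close> itself, to be compared with its mean.
\<close>

lemma pointwise_expansion:
  fixes w :: "nat \<Rightarrow> real" and \<omega> :: 'a and u d :: real
  assumes u: "0 \<le> u" "u \<le> 1" and d: "0 \<le> d"
  defines "W \<equiv> \<lambda>j. u * S \<omega> j + w j"
  shows "\<bar>h (\<lambda>j. (u + d) * S \<omega> j + w j) - h W - d * (\<Sum>i<n. \<Sum>j<p. G (\<lambda>l. W l - u * X i \<omega> l) j * X i \<omega> j)
      - d * u * (\<Sum>j<p. \<Sum>k<p. H W j k * Sig j k)\<bar>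
    \<le> d * (A2 * V \<omega> + A3 * (exp 2 * T \<omega> + (\<Sum>i<n. R i \<omega>))) + d\<^sup>2 * A2 * (vmax (S \<omega>))\<^sup>2"
proof -
  define g where "g i = (\<Sum>j<p. G W j * X i \<omega> j)" for i
  define l where "l i = (\<Sum>j<p. G (\<lambda>l. W l - u * X i \<omega> l) j * X i \<omega> j)" for i
  define q where "q i = (\<Sum>j<p. \<Sum>k<p. H W j k * (X i \<omega> j * X i \<omega> k))" for i
  have "\<bar>h (\<lambda>j. W j + d * S \<omega> j) - h W - (\<Sum>j<p. G W j * (d * S \<omega> j))\<bar> \<le> A2 * (d * vmax (S \<omega>))\<^sup>2"
    by (rule taylor_1) (rule vmax_scale[OF d])
  moreover have "(\<lambda>j. W j + d * S \<omega> j) = (\<lambda>j. (u + d) * S \<omega> j + w j)"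
    by (simp add: W_def algebra_simps)
  moreover have "(\<Sum>j<p. G W j * (d * S \<omega> j)) = d * (\<Sum>i<n. g i)"
    unfolding g_def S_def by (subst sum.swap) (simp add: sum_distrib_left mult_ac)
  ultimately have t1: "\<bar>h (\<lambda>j. (u + d) * S \<omega> j + w j) - h W - d * (\<Sum>i<n. g i)\<bar> \<le> d\<^sup>2 * A2 * (vmax (S \<omega>))\<^sup>2"
    by (simp add: power_mult_distrib mult_ac)
  have "\<bar>g i - l i - u * q i\<bar> \<le> A3 * (exp 2 * (\<Sum>j<p. weight W j * \<bar>X i \<omega> j\<bar> ^ 3) + R i \<omega>)" for i
  proof -
    let ?m = "vmax (X i \<omega>)"
    have "\<bar>g i - l i - u * q i\<bar> \<le> A3 * (if \<beta> * ?m \<le> 1 then exp 2 * (\<Sum>j<p. weight W j * \<bar>X i \<omega> j\<bar> ^ 3) else ?m ^ 3)"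
      unfolding g_def l_def q_def by (rule taylor_gradient[OF u]) (rule vmax_ge)
    also have "\<dots> \<le> A3 * (exp 2 * (\<Sum>j<p. weight W j * \<bar>X i \<omega> j\<bar> ^ 3) + R i \<omega>)"
    proof (intro mult_left_mono A_nonneg)
      have nn: "0 \<le> exp 2 * (\<Sum>j<p. weight W j * \<bar>X i \<omega> j\<bar> ^ 3)"
        by (intro mult_nonneg_nonneg sum_nonneg weight_nonneg) auto
      have "R i \<omega> = ?m ^ 3" if "\<not> \<beta> * ?m \<le> 1"
      proof -
        have "?m > inverse \<beta> / 2" using that \<beta> by (simp add: field_simps)
        thus ?thesis by (simp add: R_def vmax_power vmax_def[symmetric])
      qed
      thus "(if \<beta> * ?m \<le> 1 then exp 2 * (\<Sum>j<p. weight W j * \<bar>X i \<omega> j\<bar> ^ 3) else ?m ^ 3)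
        \<le> exp 2 * (\<Sum>j<p. weight W j * \<bar>X i \<omega> j\<bar> ^ 3) + R i \<omega>" using nn R_nonneg[of i \<omega>] by auto
    qed
    finally show ?thesis .
  qed
  hence "\<bar>\<Sum>i<n. g i - l i - u * q i\<bar> \<le> (\<Sum>i<n. A3 * (exp 2 * (\<Sum>j<p. weight W j * \<bar>X i \<omega> j\<bar> ^ 3) + R i \<omega>))"
    by (intro order_trans[OF sum_abs] sum_mono)
  also have "\<dots> = A3 * (exp 2 * (\<Sum>i<n. \<Sum>j<p. weight W j * \<bar>X i \<omega> j\<bar> ^ 3) + (\<Sum>i<n. R i \<omega>))"
    by (simp add: sum_distrib_left sum.distrib distrib_left)
  also have "(\<Sum>i<n. \<Sum>j<p. weight W j * \<bar>X i \<omega> j\<bar> ^ 3) = (\<Sum>j<p. weight W j * (\<Sum>i<n. \<bar>X i \<omega> j\<bar> ^ 3))"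
    unfolding sum_distrib_left by (rule sum.swap)
  also have "A3 * (exp 2 * (\<Sum>j<p. weight W j * (\<Sum>i<n. \<bar>X i \<omega> j\<bar> ^ 3)) + (\<Sum>i<n. R i \<omega>)) \<le>
      A3 * (exp 2 * T \<omega> + (\<Sum>i<n. R i \<omega>))"
  proof (intro mult_left_mono add_mono A_nonneg order_refl)
    have "(\<Sum>j<p. weight W j * (\<Sum>i<n. \<bar>X i \<omega> j\<bar> ^ 3)) \<le> (\<Sum>j<p. weight W j * T \<omega>)"
      unfolding T_def by (intro sum_mono mult_left_mono weight_nonneg Max_ge) auto
    thus "(\<Sum>j<p. weight W j * (\<Sum>i<n. \<bar>X i \<omega> j\<bar> ^ 3)) \<le> T \<omega>"
      by (simp add: sum_weight flip: sum_distrib_right)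
  qed auto
  finally have t2: "\<bar>(\<Sum>i<n. g i) - (\<Sum>i<n. l i) - u * (\<Sum>i<n. q i)\<bar> \<le> A3 * (exp 2 * T \<omega> + (\<Sum>i<n. R i \<omega>))"
    by (simp add: sum_subtractf sum_distrib_left)
  let ?h = "\<Sum>j<p. \<Sum>k<p. H W j k * Sig j k"
  have "(\<Sum>i<n. q i) = (\<Sum>j<p. \<Sum>i<n. \<Sum>k<p. H W j k * (X i \<omega> j * X i \<omega> k))"
    unfolding q_def by (rule sum.swap)
  also have "\<dots> = (\<Sum>j<p. \<Sum>k<p. \<Sum>i<n. H W j k * (X i \<omega> j * X i \<omega> k))"
    by (intro sum.cong refl sum.swap)
  finally have "(\<Sum>i<n. q i) - ?h = (\<Sum>j<p. \<Sum>k<p. H W j k *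
      (\<Sum>i<n. (X i \<omega> j * X i \<omega> k - (LINT \<omega>'|M. X i \<omega>' j * X i \<omega>' k))))"
    by (simp add: Sig_def sum_subtractf sum_distrib_left right_diff_distrib)
  also have "\<bar>\<dots>\<bar> \<le> A2 * V \<omega>"
  proof (rule sum_H_bound)
    fix j k assume "j < p" "k < p"
    thus "\<bar>\<Sum>i<n. (X i \<omega> j * X i \<omega> k - (LINT \<omega>'|M. X i \<omega>' j * X i \<omega>' k))\<bar> \<le> V \<omega>"
      unfolding V_def by (intro Max_ge finite_imageI image_eqI[of _ _ "(j, k)"]) auto
  qed
  finally have t3: "\<bar>(\<Sum>i<n. q i) - ?h\<bar> \<le> A2 * V \<omega>" .
  have "\<bar>u * ((\<Sum>i<n. q i) - ?h)\<bar> \<le> \<bar>(\<Sum>i<n. q i) - ?h\<bar>"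
    unfolding abs_mult using u by (intro mult_left_le_one_le) auto
  hence "\<bar>(\<Sum>i<n. g i) - (\<Sum>i<n. l i) - u * ?h\<bar> \<le> A2 * V \<omega> + A3 * (exp 2 * T \<omega> + (\<Sum>i<n. R i \<omega>))"
    using t2 t3 by (simp add: right_diff_distrib)
  hence "\<bar>d * ((\<Sum>i<n. g i) - (\<Sum>i<n. l i) - u * ?h)\<bar> \<le> d * (A2 * V \<omega> + A3 * (exp 2 * T \<omega> + (\<Sum>i<n. R i \<omega>)))"
    unfolding abs_mult using d by (simp add: mult_left_mono)
  with t1 show ?thesis unfolding l_def[symmetric] right_diff_distrib mult.assoc[symmetric] by linarith
qed

lemma leave_one_out:
  assumes i: "i < n" and j: "j < p"
  shows "integrable M (\<lambda>\<omega>. G (\<lambda>l. u * S \<omega> l + w l - u * X i \<omega> l) j * X i \<omega> j)"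
    and "(LINT \<omega>|M. G (\<lambda>l. u * S \<omega> l + w l - u * X i \<omega> l) j * X i \<omega> j) = 0"
proof -
  let ?B = "{..<n} - {i}"
  let ?Q = "\<lambda>\<omega>. G (\<lambda>l. u * S \<omega> l + w l - u * X i \<omega> l) j"
  have ind: "indep_var (PiM {i} (\<lambda>_. borel_vec p)) (\<lambda>\<omega>. restrict (\<lambda>i. X i \<omega>) {i})
      (PiM ?B (\<lambda>_. borel_vec p)) (\<lambda>\<omega>. restrict (\<lambda>i. X i \<omega>) ?B)"
    using i by (intro indep_var_restrict[OF indep]) auto
  have c: "(\<lambda>F. F i' l) \<in> borel_measurable (PiM J (\<lambda>_. borel_vec p))" if "i' \<in> J" "l < p" for i' l J
    using measurable_compose[OF measurable_component_singleton[OF that(1)] measurable_component_singleton[of l "{..<p}"]] that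
    by auto
  have m1: "(\<lambda>F. F i j) \<in> borel_measurable (PiM {i} (\<lambda>_. borel_vec p))" using j by (intro c) auto
  have m2: "(\<lambda>F. G (\<lambda>l. u * (\<Sum>i'\<in>?B. F i' l) + w l) j) \<in> borel_measurable (PiM ?B (\<lambda>_. borel_vec p))"
    by (rule measurable_G[OF _ j]) (intro borel_measurable_add borel_measurable_times borel_measurable_const
        borel_measurable_sum c, auto)
  have S_eq: "u * (\<Sum>i'\<in>?B. X i' \<omega> l) + w l = u * S \<omega> l + w l - u * X i \<omega> l" for \<omega> l
    using i by (simp add: S_def sum.remove[of "{..<n}" i] algebra_simps)
  have iv: "indep_var borel (\<lambda>\<omega>. X i \<omega> j) borel ?Q"
  proof -
    have "(\<Sum>i'\<in>?B. restrict (\<lambda>i. X i \<omega>) ?B i' l) = (\<Sum>i'\<in>?B. X i' \<omega> l)" for \<omega> l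
      by (intro sum.cong) auto
    hence "(\<lambda>F. G (\<lambda>l. u * (\<Sum>i'\<in>?B. F i' l) + w l) j) \<circ> (\<lambda>\<omega>. restrict (\<lambda>i. X i \<omega>) ?B) = ?Q"
      by (simp only: comp_def S_eq)
    moreover have "(\<lambda>F. F i j) \<circ> (\<lambda>\<omega>. restrict (\<lambda>i. X i \<omega>) {i}) = (\<lambda>\<omega>. X i \<omega> j)" by auto
    ultimately show ?thesis
      using indep_var_compose[OF ind m1 m2] by simp
  qed
  have Qi: "integrable M ?Q"
  proof (rule integrable_bounded[OF prob_space_axioms])
    show "?Q \<in> borel_measurable M" using i j by (intro measurable_G) auto
    show "\<bar>?Q \<omega>\<bar> \<le> c1" for \<omega> by (rule G_bound[OF j])
  qed
  show "integrable M (\<lambda>\<omega>. ?Q \<omega> * X i \<omega> j)"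
    using indep_var_integrable[OF iv integrable_X[OF i j] Qi] by (simp add: mult.commute)
  show "(LINT \<omega>|M. ?Q \<omega> * X i \<omega> j) = 0"
    using indep_var_lebesgue_integral[OF iv integrable_X[OF i j] Qi] X0 i j by (simp add: mult.commute)
qed

definition K :: real where "K = (\<Sum>j<p. \<Sum>k<p. \<bar>Sig j k\<bar>)"

lemma Sig_le_K: "j < p \<Longrightarrow> k < p \<Longrightarrow> \<bar>Sig j k\<bar> \<le> K"
proof -
  assume j: "j < p" and k: "k < p"
  have "\<bar>Sig j k\<bar> \<le> (\<Sum>k<p. \<bar>Sig j k\<bar>)" using k by (intro member_le_sum[of k]) auto
  also have "\<dots> \<le> K" unfolding K_def using j
    by (intro member_le_sum[of j _ "\<lambda>j. \<Sum>k<p. \<bar>Sig j k\<bar>"]) (auto intro: sum_nonneg)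
  finally show ?thesis .
qed

lemma integrable_h:
  assumes "prob_space P" "\<And>j. j < p \<Longrightarrow> (\<lambda>x. Y x j) \<in> borel_measurable P"
  shows "integrable P (\<lambda>x. h (Y x))"
  by (rule integrable_bounded[OF assms(1) measurable_h h_bound]) (rule assms(2))

lemma HSig_bound: "\<bar>\<Sum>j<p. \<Sum>k<p. H x j k * Sig j k\<bar> \<le> A2 * K"
  by (rule sum_H_bound) (rule Sig_le_K)

lemma integrable_HSig:
  assumes "prob_space P" "\<And>j. j < p \<Longrightarrow> (\<lambda>x. Y x j) \<in> borel_measurable P"
  shows "integrable P (\<lambda>x. \<Sum>j<p. \<Sum>k<p. H (Y x) j k * Sig j k)"
proof (rule integrable_bounded[OF assms(1) _ HSig_bound])
  show "(\<lambda>x. \<Sum>j<p. \<Sum>k<p. H (Y x) j k * Sig j k) \<in> borel_measurable P"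
    by (intro borel_measurable_sum borel_measurable_times borel_measurable_const measurable_H assms(2)) auto
qed

lemma step_sum:
  fixes w :: "nat \<Rightarrow> real"
  assumes u: "0 \<le> u" "u \<le> 1" and d: "0 \<le> d"
  shows "\<bar>(LINT \<omega>|M. h (\<lambda>j. (u + d) * S \<omega> j + w j)) - (LINT \<omega>|M. h (\<lambda>j. u * S \<omega> j + w j))
      - d * u * (LINT \<omega>|M. (\<Sum>j<p. \<Sum>k<p. H (\<lambda>j. u * S \<omega> j + w j) j k * Sig j k))\<bar>
    \<le> d * err + d\<^sup>2 * A2 * (LINT \<omega>|M. (vmax (S \<omega>))\<^sup>2)"
proof -
  let ?L = "\<lambda>\<omega>. \<Sum>i<n. \<Sum>j<p. G (\<lambda>l. u * S \<omega> l + w l - u * X i \<omega> l) j * X i \<omega> j"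
  let ?h = "\<lambda>\<omega>. \<Sum>j<p. \<Sum>k<p. H (\<lambda>j. u * S \<omega> j + w j) j k * Sig j k"
  let ?D = "\<lambda>\<omega>. h (\<lambda>j. (u + d) * S \<omega> j + w j) - h (\<lambda>j. u * S \<omega> j + w j) - d * ?L \<omega> - d * u * ?h \<omega>"
  let ?E = "\<lambda>\<omega>. d * (A2 * V \<omega> + A3 * (exp 2 * T \<omega> + (\<Sum>i<n. R i \<omega>))) + d\<^sup>2 * A2 * (vmax (S \<omega>))\<^sup>2"
  have L: "integrable M ?L"
    by (intro Bochner_Integration.integrable_sum leave_one_out) auto
  have L0: "integral\<^sup>L M ?L = 0"
  proof -
    have "integral\<^sup>L M ?L = (\<Sum>i<n. LINT \<omega>|M. (\<Sum>j<p. G (\<lambda>l. u * S \<omega> l + w l - u * X i \<omega> l) j * X i \<omega> j))"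
      by (intro Bochner_Integration.integral_sum Bochner_Integration.integrable_sum leave_one_out) auto
    also have "\<dots> = (\<Sum>i<n. \<Sum>j<p. LINT \<omega>|M. G (\<lambda>l. u * S \<omega> l + w l - u * X i \<omega> l) j * X i \<omega> j)"
      by (intro sum.cong refl Bochner_Integration.integral_sum leave_one_out) auto
    also have "\<dots> = 0" by (intro sum.neutral ballI leave_one_out) auto
    finally show ?thesis .
  qed
  have i1: "integrable M (\<lambda>\<omega>. h (\<lambda>j. a * S \<omega> j + w j))" for a
    by (rule integrable_h[OF prob_space_axioms]) auto
  have i2: "integrable M ?h" by (rule integrable_HSig[OF prob_space_axioms]) auto
  have D: "integrable M ?D" using L i1 i2 by (intro Bochner_Integration.integrable_diff integrable_mult_right) auto
  have E: "integrable M ?E"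
    using integrable_V integrable_T integrable_R integrable_vmax_S
    by (intro Bochner_Integration.integrable_add integrable_mult_right Bochner_Integration.integrable_sum) auto
  have "\<bar>integral\<^sup>L M ?D\<bar> \<le> integral\<^sup>L M ?E"

    by (rule abs_integral_le[OF D E]) (rule pointwise_expansion[OF u d])
  also have "integral\<^sup>L M ?E = d * err + d\<^sup>2 * A2 * (LINT \<omega>|M. (vmax (S \<omega>))\<^sup>2)"
  proof -
    have "integrable M (\<lambda>\<omega>. \<Sum>i<n. R i \<omega>)"
      by (intro Bochner_Integration.integrable_sum integrable_R) auto
    moreover have "(LINT \<omega>|M. (\<Sum>i<n. R i \<omega>)) = B3 M n p X \<beta>"
      unfolding integral_bounds(3)[symmetric]
      by (intro Bochner_Integration.integral_sum integrable_R) auto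
    ultimately show ?thesis
      using integrable_V integrable_T integrable_vmax_S by (simp add: integral_bounds err_def)
  qed
  also have "integral\<^sup>L M ?D = (LINT \<omega>|M. h (\<lambda>j. (u + d) * S \<omega> j + w j)) - (LINT \<omega>|M. h (\<lambda>j. u * S \<omega> j + w j))
      - d * u * (LINT \<omega>|M. ?h \<omega>)"
    using L L0 i1 i2 by simp
  finally show ?thesis .
qed

lemma step_normal:
  assumes \<tau>: "0 \<le> \<tau>"
  shows "\<bar>(LINT t|\<nu>. h (\<lambda>j. x j + \<tau> * t j)) - h x - \<tau>\<^sup>2 / 2 * (\<Sum>j<p. \<Sum>k<p. H x j k * Sig j k)\<bar>
    \<le> A3 * \<tau> ^ 3 * (LINT t|\<nu>. vmax t ^ 3)"
proof -
  let ?g = "\<lambda>t. \<Sum>j<p. G x j * (\<tau> * t j)"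
  let ?q = "\<lambda>t. \<Sum>j<p. \<Sum>k<p. H x j k * ((\<tau> * t j) * (\<tau> * t k))"
  let ?D = "\<lambda>t. h (\<lambda>j. x j + \<tau> * t j) - h x - ?g t - ?q t / 2"
  have i1: "integrable \<nu> (\<lambda>t. h (\<lambda>j. x j + \<tau> * t j))"
    by (rule integrable_h[OF N.prob_space_axioms]) auto
  have c1: "integrable \<nu> (\<lambda>t. t j)" if "j < p" for j
  proof -
    have "integrable \<nu> (\<lambda>t. norm (t j))" using N.coord_moments(1)[OF that, of 1] by simp
    thus ?thesis using that by (subst (asm) integrable_norm_iff) auto
  qed
  have g: "integrable \<nu> ?g" "integral\<^sup>L \<nu> ?g = 0"
    using c1 N.coord_moments(2) by (auto simp: Bochner_Integration.integral_sum)
  have q_eq: "?q t = \<tau>\<^sup>2 * (\<Sum>j<p. \<Sum>k<p. H x j k * (t j * t k))" for t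
    by (simp add: sum_distrib_left power2_eq_square mult_ac)
  have q: "integrable \<nu> ?q" "integral\<^sup>L \<nu> ?q = \<tau>\<^sup>2 * (\<Sum>j<p. \<Sum>k<p. H x j k * Sig j k)"
  proof -
    have "integrable \<nu> (\<lambda>t. \<Sum>j<p. \<Sum>k<p. H x j k * (t j * t k))"
      by (intro Bochner_Integration.integrable_sum integrable_mult_right N.covariance) auto
    moreover have "(LINT t|\<nu>. (\<Sum>j<p. \<Sum>k<p. H x j k * (t j * t k))) = (\<Sum>j<p. LINT t|\<nu>. (\<Sum>k<p. H x j k * (t j * t k)))"
      by (intro Bochner_Integration.integral_sum Bochner_Integration.integrable_sum integrable_mult_right N.covariance) auto
    moreover have "\<dots> = (\<Sum>j<p. \<Sum>k<p. LINT t|\<nu>. H x j k * (t j * t k))"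
      by (intro sum.cong refl Bochner_Integration.integral_sum integrable_mult_right N.covariance) auto
    moreover have "\<dots> = (\<Sum>j<p. \<Sum>k<p. H x j k * Sig j k)"
      by (intro sum.cong refl) (simp add: N.covariance)
    ultimately show "integrable \<nu> ?q" "integral\<^sup>L \<nu> ?q = \<tau>\<^sup>2 * (\<Sum>j<p. \<Sum>k<p. H x j k * Sig j k)"
      unfolding q_eq by simp_all
  qed
  have "\<bar>integral\<^sup>L \<nu> ?D\<bar> \<le> (LINT t|\<nu>. A3 * \<tau> ^ 3 * vmax t ^ 3)"

  proof (rule abs_integral_le)
    show "integrable \<nu> ?D" using i1 g q by auto
    show "integrable \<nu> (\<lambda>t. A3 * \<tau> ^ 3 * vmax t ^ 3)" using integrable_vmax_normal by simp
    fix t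
    have "\<bar>?D t\<bar> \<le> A3 * (\<tau> * vmax t) ^ 3" by (rule taylor_2) (rule vmax_scale[OF \<tau>])
    thus "\<bar>?D t\<bar> \<le> A3 * \<tau> ^ 3 * vmax t ^ 3" by (simp add: power_mult_distrib mult.assoc)
  qed
  moreover have "integral\<^sup>L \<nu> ?D = (LINT t|\<nu>. h (\<lambda>j. x j + \<tau> * t j)) - h x - \<tau>\<^sup>2 / 2 * (\<Sum>j<p. \<Sum>k<p. H x j k * Sig j k)"
    using i1 g q by (simp add: N.prob_space)
  ultimately show ?thesis by simp
qed

definition \<phi> :: "real \<Rightarrow> real" where
  "\<phi> u = (LINT \<omega>|M. LINT t|\<nu>. h (\<lambda>j. u * S \<omega> j + sqrt (1 - u\<^sup>2) * t j))"

definition m2 :: real where "m2 = A2 * (LINT \<omega>|M. (vmax (S \<omega>))\<^sup>2) + A2 * K"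
definition m3 :: real where "m3 = A3 * (LINT t|\<nu>. vmax t ^ 3)"

lemma m_nonneg: "0 \<le> m2" "0 \<le> m3"
proof -
  have "0 \<le> K" unfolding K_def by (intro sum_nonneg) auto
  thus "0 \<le> m2" "0 \<le> m3"
    unfolding m2_def m3_def using A_nonneg vmax_nonneg
    by (auto intro!: add_nonneg_nonneg mult_nonneg_nonneg Bochner_Integration.integral_nonneg)
qed

lemma phi_step:
  fixes u d :: real
  assumes u: "0 \<le> u" and d: "0 \<le> d" and ud: "u + d \<le> 1"
  defines "\<tau> \<equiv> sqrt ((u + d)\<^sup>2 - u\<^sup>2)"
  shows "\<bar>\<phi> (u + d) - \<phi> u\<bar> \<le> d * err + d\<^sup>2 * m2 + \<tau> ^ 3 * m3"
proof -
  interpret P: pair_prob_space M \<nu> ..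
  interpret PN: pair_prob_space \<nu> \<nu> ..
  define r where "r = sqrt (1 - (u + d)\<^sup>2)"
  have \<tau>2: "\<tau>\<^sup>2 = 2 * u * d + d\<^sup>2" "0 \<le> \<tau>"
    using u d by (auto simp: \<tau>_def power2_eq_square algebra_simps)
  have "(u + d)\<^sup>2 \<le> 1" using u d ud by (intro power_le_one) auto
  hence r2: "r\<^sup>2 = 1 - (u + d)\<^sup>2" by (simp add: r_def)
  have "u\<^sup>2 \<le> 1" using u d ud by (intro power_le_one) auto
  hence rot: "r\<^sup>2 + \<tau>\<^sup>2 = (sqrt (1 - u\<^sup>2))\<^sup>2"
    unfolding r2 \<tau>2 by (simp add: power2_eq_square algebra_simps)
  define a where "a t = (LINT \<omega>|M. h (\<lambda>j. (u + d) * S \<omega> j + r * t j))" for t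
  define b where "b t = (LINT \<omega>|M. LINT t'|\<nu>. h (\<lambda>j. u * S \<omega> j + r * t j + \<tau> * t' j))" for t
  have ab: "\<bar>a t - b t\<bar> \<le> d * err + d\<^sup>2 * m2 + \<tau> ^ 3 * m3" for t
  proof -
    let ?W = "\<lambda>\<omega> j. u * S \<omega> j + r * t j"
    define I where "I = (LINT \<omega>|M. (\<Sum>j<p. \<Sum>k<p. H (?W \<omega>) j k * Sig j k))"
    define a0 where "a0 = (LINT \<omega>|M. h (?W \<omega>))"
    have i0: "integrable M (\<lambda>\<omega>. h (?W \<omega>))" by (rule integrable_h[OF prob_space_axioms]) auto
    have iI: "integrable M (\<lambda>\<omega>. (\<Sum>j<p. \<Sum>k<p. H (?W \<omega>) j k * Sig j k))"
      by (rule integrable_HSig[OF prob_space_axioms]) auto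
    have I: "\<bar>I\<bar> \<le> A2 * K"
    proof -
      have "\<bar>I\<bar> \<le> (LINT \<omega>|M. A2 * K)" unfolding I_def
        by (rule abs_integral_le[OF iI]) (auto simp: HSig_bound)
      thus ?thesis by (simp add: prob_space)
    qed
    have s1: "\<bar>a t - a0 - d * u * I\<bar> \<le> d * err + d\<^sup>2 * A2 * (LINT \<omega>|M. (vmax (S \<omega>))\<^sup>2)"
      unfolding a_def a0_def I_def using u d ud by (intro step_sum) auto
    have ib: "integrable M (\<lambda>\<omega>. LINT t'|\<nu>. h (\<lambda>j. ?W \<omega> j + \<tau> * t' j))"
      by (rule P.integrable_fst'[of "\<lambda>(\<omega>, t'). h (\<lambda>j. ?W \<omega> j + \<tau> * t' j)", simplified])
        (auto intro!: integrable_h[OF P.prob_space_axioms] simp: split_beta')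
    have "\<bar>LINT \<omega>|M. (LINT t'|\<nu>. h (\<lambda>j. ?W \<omega> j + \<tau> * t' j)) - h (?W \<omega>) - \<tau>\<^sup>2 / 2 * (\<Sum>j<p. \<Sum>k<p. H (?W \<omega>) j k * Sig j k)\<bar>
       \<le> (LINT \<omega>|M. A3 * \<tau> ^ 3 * (LINT t|\<nu>. vmax t ^ 3))"

      by (rule abs_integral_le)
        (use ib i0 iI step_normal[OF \<tau>2(2)] in \<open>auto intro!: Bochner_Integration.integrable_diff integrable_mult_right\<close>)
    also have "\<dots> = \<tau> ^ 3 * m3" by (simp add: prob_space m3_def mult_ac)
    also have "(LINT \<omega>|M. (LINT t'|\<nu>. h (\<lambda>j. ?W \<omega> j + \<tau> * t' j)) - h (?W \<omega>) - \<tau>\<^sup>2 / 2 * (\<Sum>j<p. \<Sum>k<p. H (?W \<omega>) j k * Sig j k))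
       = b t - a0 - \<tau>\<^sup>2 / 2 * I"
      unfolding b_def a0_def I_def using ib i0 iI
      by (simp only: Bochner_Integration.integral_diff Bochner_Integration.integrable_diff integrable_mult_right integral_mult_right_zero)
    finally have s2: "\<bar>b t - a0 - \<tau>\<^sup>2 / 2 * I\<bar> \<le> \<tau> ^ 3 * m3" .
    have "\<tau>\<^sup>2 / 2 * I = d * u * I + d\<^sup>2 / 2 * I" unfolding \<tau>2 by (simp add: field_simps)
    moreover have "\<bar>d\<^sup>2 / 2 * I\<bar> \<le> d\<^sup>2 * (A2 * K)"
      unfolding abs_mult using I by (intro mult_mono) auto
    moreover have "d\<^sup>2 * m2 = d\<^sup>2 * A2 * (LINT \<omega>|M. (vmax (S \<omega>))\<^sup>2) + d\<^sup>2 * (A2 * K)"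
      by (simp add: m2_def distrib_left mult.assoc)
    ultimately show ?thesis using s1 s2 by linarith
  qed
  have ia: "integrable (M \<Otimes>\<^sub>M \<nu>) (\<lambda>(\<omega>, t). h (\<lambda>j. (u + d) * S \<omega> j + r * t j))"
    unfolding split_beta' by (rule integrable_h[OF P.prob_space_axioms]) auto
  have a_int: "integrable \<nu> a" "integral\<^sup>L \<nu> a = \<phi> (u + d)"
    unfolding a_def[abs_def] \<phi>_def r_def[symmetric]
    using P.integrable_snd[OF ia] P.Fubini_integral[OF ia] by auto
  have bm: "(\<lambda>z. LINT t'|\<nu>. h (\<lambda>j. u * S (fst z) j + r * snd z j + \<tau> * t' j)) \<in> borel_measurable (M \<Otimes>\<^sub>M \<nu>)"
  proof (rule N.borel_measurable_lebesgue_integral)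
    have "(\<lambda>y. h (\<lambda>j. u * S (fst (fst y)) j + r * snd (fst y) j + \<tau> * snd y j)) \<in> borel_measurable ((M \<Otimes>\<^sub>M \<nu>) \<Otimes>\<^sub>M \<nu>)"
      by (rule measurable_h) auto
    thus "(\<lambda>(z, t'). h (\<lambda>j. u * S (fst z) j + r * snd z j + \<tau> * t' j)) \<in> borel_measurable ((M \<Otimes>\<^sub>M \<nu>) \<Otimes>\<^sub>M \<nu>)"
      by (simp add: split_beta')
  qed
  have bb: "\<bar>LINT t'|\<nu>. h (\<lambda>j. u * S \<omega> j + r * t j + \<tau> * t' j)\<bar> \<le> 1" for \<omega> t
  proof -
    have "\<bar>LINT t'|\<nu>. h (\<lambda>j. u * S \<omega> j + r * t j + \<tau> * t' j)\<bar> \<le> (LINT t'|\<nu>. 1)"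

      by (rule abs_integral_le) (auto intro!: integrable_h[OF N.prob_space_axioms] simp: h_bound)
    thus ?thesis by (simp add: N.prob_space)
  qed
  have ib: "integrable (M \<Otimes>\<^sub>M \<nu>) (\<lambda>(\<omega>, t). LINT t'|\<nu>. h (\<lambda>j. u * S \<omega> j + r * t j + \<tau> * t' j))"
    unfolding split_beta' by (rule integrable_bounded[OF P.prob_space_axioms bm]) (rule bb)
  have b_int: "integrable \<nu> b" "integral\<^sup>L \<nu> b = \<phi> u"
  proof -
    show "integrable \<nu> b" unfolding b_def[abs_def] using P.integrable_snd[OF ib] by simp
    have "integral\<^sup>L \<nu> b = (LINT \<omega>|M. LINT t|\<nu>. LINT t'|\<nu>. h (\<lambda>j. u * S \<omega> j + r * t j + \<tau> * t' j))"
      unfolding b_def[abs_def] by (rule P.Fubini_integral[OF ib])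
    also have "\<dots> = \<phi> u"
    proof -
      have "(LINT t|\<nu>. LINT t'|\<nu>. h (\<lambda>j. u * S \<omega> j + r * t j + \<tau> * t' j)) =
        (LINT t|\<nu>. h (\<lambda>j. u * S \<omega> j + sqrt (1 - u\<^sup>2) * t j))" for \<omega>
        unfolding add.assoc
      proof (rule N.integral_rotation[OF rot, of "\<lambda>y. h (\<lambda>j. u * S \<omega> j + y j)"])
        show "(\<lambda>y. h (\<lambda>j. u * S \<omega> j + y j)) \<in> borel_measurable (borel_vec p)"
          by (rule measurable_h) (intro borel_measurable_add borel_measurable_const measurable_component_singleton, auto)
        show "\<bar>h (\<lambda>j. u * S \<omega> j + y j)\<bar> \<le> 1" for y by (rule h_bound)
        show "h (\<lambda>j. u * S \<omega> j + restrict y {..<p} j) = h (\<lambda>j. u * S \<omega> j + y j)" for y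
          by (rule h_cong) simp
      qed
      thus ?thesis by (simp add: \<phi>_def)
    qed
    finally show "integral\<^sup>L \<nu> b = \<phi> u" .
  qed
  have "\<bar>LINT t|\<nu>. a t - b t\<bar> \<le> (LINT t|\<nu>. d * err + d\<^sup>2 * m2 + \<tau> ^ 3 * m3)"

    by (rule abs_integral_le) (use a_int b_int ab in auto)
  thus ?thesis using a_int b_int by (simp add: N.prob_space)
qed

theorem normal_comparison:
  "\<bar>(LINT \<omega>|M. h (S \<omega>)) - (LINT t|\<nu>. h t)\<bar> \<le> err"
proof -
  have ends: "\<phi> 1 = (LINT \<omega>|M. h (S \<omega>))" "\<phi> 0 = (LINT t|\<nu>. h t)"
    by (simp_all add: \<phi>_def prob_space N.prob_space)
  have K: "\<bar>\<phi> 1 - \<phi> 0\<bar> \<le> err + (m2 * (1 / real (Suc N)) + 3 * sqrt 3 * m3 * sqrt (1 / real (Suc N)))" for N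
  proof -
    define k where "k = real (Suc N)"
    have k: "1 \<le> k" by (simp add: k_def)
    have avg: "(\<Sum>m<Suc N. c / k) = c" for c
    proof -
      have "(\<Sum>m<Suc N. c / k) = real (card {..<Suc N}) * (c / k)" by (rule sum_constant)
      also have "\<dots> = k * (c / k)" by (simp only: card_lessThan k_def)
      finally show ?thesis using k by simp
    qed
    have step: "\<bar>\<phi> (real (Suc m) / k) - \<phi> (real m / k)\<bar> \<le> (err + (m2 * (1 / k) + 3 * sqrt 3 * m3 * sqrt (1 / k))) / k"
      if m: "m < Suc N" for m
    proof -
      have mk: "real m + 1 \<le> k" using m by (simp add: k_def)
      have e: "real m / k + 1 / k = real (Suc m) / k" by (simp add: add_divide_distrib)
      let ?t = "sqrt ((real m / k + 1 / k)\<^sup>2 - (real m / k)\<^sup>2)"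
      have "\<bar>\<phi> (real m / k + 1 / k) - \<phi> (real m / k)\<bar> \<le> 1 / k * err + (1 / k)\<^sup>2 * m2 + ?t ^ 3 * m3"
        using k mk by (intro phi_step) (auto simp: field_simps)
      also have "?t ^ 3 \<le> (sqrt (3 * (1 / k))) ^ 3"
      proof (intro power_mono real_sqrt_le_mono)
        have "(real m / k + 1 / k)\<^sup>2 - (real m / k)\<^sup>2 = (2 * (real m / k) + 1 / k) * (1 / k)"
          by (simp add: power2_eq_square algebra_simps)
        also have "\<dots> \<le> 3 * (1 / k)"
        proof (rule mult_right_mono)
          have "real m / k \<le> 1" "1 / k \<le> 1" using k mk by auto
          thus "2 * (real m / k) + 1 / k \<le> 3" by linarith
        qed (use k in auto)
        finally show "(real m / k + 1 / k)\<^sup>2 - (real m / k)\<^sup>2 \<le> 3 * (1 / k)" .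
        have "(real m / k)\<^sup>2 \<le> (real m / k + 1 / k)\<^sup>2" using k by (intro power_mono) auto
        thus "0 \<le> ?t" by simp
      qed
      also have "(sqrt (3 * (1 / k))) ^ 3 = 3 * sqrt 3 * (1 / k) * sqrt (1 / k)"
        using k by (simp add: power3_eq_cube real_sqrt_mult real_sqrt_divide field_simps)
      finally have "\<bar>\<phi> (real m / k + 1 / k) - \<phi> (real m / k)\<bar> \<le>
        1 / k * err + (1 / k)\<^sup>2 * m2 + 3 * sqrt 3 * (1 / k) * sqrt (1 / k) * m3"
        using m_nonneg by (simp add: mult_right_mono)
      thus ?thesis unfolding e using k by (simp add: power2_eq_square field_simps)
    qed
    have tel: "\<phi> 1 - \<phi> 0 = (\<Sum>m<Suc N. \<phi> (real (Suc m) / k) - \<phi> (real m / k))"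
      using k sum_lessThan_telescope[of "\<lambda>m. \<phi> (real m / k)" "Suc N"] by (simp add: k_def)
    have "\<bar>\<phi> 1 - \<phi> 0\<bar> \<le> (\<Sum>m<Suc N. (err + (m2 * (1 / k) + 3 * sqrt 3 * m3 * sqrt (1 / k))) / k)"
      unfolding tel by (intro order_trans[OF sum_abs] sum_mono step) (simp only: lessThan_iff)
    also have "\<dots> = err + (m2 * (1 / k) + 3 * sqrt 3 * m3 * sqrt (1 / k))"
      by (rule avg)
    finally show ?thesis by (simp only: k_def)
  qed
  have "(\<lambda>N. 1 / real (Suc N)) \<longlonglongrightarrow> 0" using LIMSEQ_inverse_real_of_nat by (simp add: inverse_eq_divide)
  moreover from tendsto_real_sqrt[OF this] have "(\<lambda>N. sqrt (1 / real (Suc N))) \<longlonglongrightarrow> 0" by simp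
  ultimately have "(\<lambda>N. err + (m2 * (1 / real (Suc N)) + 3 * sqrt 3 * m3 * sqrt (1 / real (Suc N))))
      \<longlonglongrightarrow> err + (m2 * 0 + 3 * sqrt 3 * m3 * 0)"
    by (intro tendsto_intros)
  hence "\<bar>\<phi> 1 - \<phi> 0\<bar> \<le> err + (m2 * 0 + 3 * sqrt 3 * m3 * 0)"
    by (rule LIMSEQ_le_const) (intro exI[of _ 0] allI impI K)
  thus ?thesis by (simp add: ends)
qed

end

section \<open>The coupling with an explicit constant\<close>

lemma floor_abs_diff_less:
  fixes x y :: real
  assumes "0 < \<eta>" "\<bar>\<lfloor>x / \<eta>\<rfloor> - \<lfloor>y / \<eta>\<rfloor>\<bar> \<le> m"
  shows "\<bar>x - y\<bar> < (of_int m + 1) * \<eta>"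
proof -
  have "\<bar>x / \<eta> - y / \<eta>\<bar> < of_int m + 1" using assms(2) by linarith
  hence "\<bar>x - y\<bar> / \<eta> < of_int m + 1" using assms(1) by (simp add: diff_divide_distrib[symmetric])
  thus ?thesis using assms(1) by (simp add: pos_divide_less_eq)
qed

lemma (in real_distribution) floor_tail:
  assumes "0 < e"
  shows "\<exists>K0::nat. \<forall>K\<ge>K0. measure M {x. \<bar>\<lfloor>x / \<eta>\<rfloor>\<bar> > int K} < e"
proof -
  let ?A = "\<lambda>K::nat. {x::real. \<bar>\<lfloor>x / \<eta>\<rfloor>\<bar> > int K}"
  have m: "?A K \<in> sets M" for K
  proof -
    have "?A K = {x. real_of_int \<bar>\<lfloor>x / \<eta>\<rfloor>\<bar> > real K}" by (auto simp: of_nat_less_iff)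
    also have "\<dots> \<in> sets M" by simp
    finally show ?thesis .
  qed
  have "(\<lambda>K. measure M (?A K)) \<longlonglongrightarrow> measure M (\<Inter>K. ?A K)"
    by (rule finite_Lim_measure_decseq) (use m in \<open>auto simp: decseq_def\<close>)
  moreover have "(\<Inter>K. ?A K) = {}"
  proof -
    have "x \<notin> ?A (nat \<bar>\<lfloor>x / \<eta>\<rfloor>\<bar>)" for x by simp
    thus ?thesis by blast
  qed
  ultimately have "(\<lambda>K. measure M (?A K)) \<longlonglongrightarrow> 0" by simp
  from order_tendstoD(2)[OF this assms] show ?thesis by (simp add: eventually_sequentially)
qed

lemma max_sum_measurable:
  assumes "\<And>i j. i < n \<Longrightarrow> j < p \<Longrightarrow> (\<lambda>\<omega>. X i \<omega> j) \<in> borel_measurable M"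
  shows "max_sum n p X \<in> borel_measurable M"
  unfolding max_sum_def[abs_def]
  by (intro borel_measurable_Max borel_measurable_sum) (use assms in auto)

context comparison
begin

definition vtop :: "(nat \<Rightarrow> real) \<Rightarrow> real" where "vtop x = (MAX j\<in>{..<p}. x j)"

lemma vtop_measurable:
  assumes "\<And>j. j < p \<Longrightarrow> (\<lambda>\<omega>. Y \<omega> j) \<in> borel_measurable P"
  shows "(\<lambda>\<omega>. vtop (Y \<omega>)) \<in> borel_measurable P"
  unfolding vtop_def by (intro borel_measurable_Max) (use assms in auto)

lemma vtop_le_smax: "vtop x \<le> smax x"
proof -
  have "vtop x \<in> x ` {..<p}" unfolding vtop_def by (rule Max_in) (use p_nonempty in blast)+
  thus ?thesis using smax_ge by auto
qed

lemma smax_le_vtop: "smax x \<le> vtop x + ln (real p) / \<beta>"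
  by (rule smax_le) (auto simp: vtop_def)

lemma max_sum_eq: "max_sum n p X \<omega> = vtop (S \<omega>)"
  by (simp add: max_sum_def vtop_def S_def)

lemma law_comparison:
  assumes fA: "\<And>x. vtop x \<in> A \<Longrightarrow> 1 \<le> f (smax x)" and f0: "\<And>y. 0 \<le> f y"
    and fB: "\<And>x. f (smax x) \<noteq> 0 \<Longrightarrow> vtop x \<in> B" and AB: "A \<in> sets borel" "B \<in> sets borel"
  shows "prob {\<omega> \<in> space M. max_sum n p X \<omega> \<in> A} \<le> measure (distr \<nu> borel vtop) B + err"
proof -
  have mS: "(\<lambda>\<omega>. vtop (S \<omega>)) \<in> borel_measurable M" by (rule vtop_measurable) auto
  have m\<nu>: "vtop \<in> borel_measurable \<nu>" using vtop_measurable[of "\<lambda>x. x" \<nu>] by simp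
  have eA: "{\<omega> \<in> space M. max_sum n p X \<omega> \<in> A} \<in> events"
    using measurable_sets[OF mS AB(1)] by (simp add: max_sum_eq vimage_def Int_def conj_commute)
  have eB: "vtop -` B \<inter> space \<nu> \<in> sets \<nu>" by (rule measurable_sets[OF m\<nu> AB(2)])
  have "prob {\<omega> \<in> space M. max_sum n p X \<omega> \<in> A} = (LINT \<omega>|M. indicator {\<omega> \<in> space M. max_sum n p X \<omega> \<in> A} \<omega>)"
    using eA by simp
  also have "\<dots> \<le> (LINT \<omega>|M. h (S \<omega>))"
  proof (rule integral_mono)
    show "integrable M (\<lambda>\<omega>. h (S \<omega>))" by (rule integrable_h[OF prob_space_axioms]) auto
    show "integrable M (\<lambda>\<omega>. indicator {\<omega> \<in> space M. max_sum n p X \<omega> \<in> A} \<omega> :: real)"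
      using eA by (intro integrable_bounded[OF prob_space_axioms, of _ 1]) (auto simp: indicator_def)
    show "indicator {\<omega> \<in> space M. max_sum n p X \<omega> \<in> A} \<omega> \<le> h (S \<omega>)" for \<omega>
      using fA[of "S \<omega>"] f0[of "smax (S \<omega>)"] by (auto simp: indicator_def max_sum_eq h_def)
  qed
  also have "\<dots> \<le> (LINT t|\<nu>. h t) + err" using normal_comparison by linarith
  also have "(LINT t|\<nu>. h t) \<le> (LINT t|\<nu>. indicator (vtop -` B \<inter> space \<nu>) t)"
  proof (rule integral_mono)
    show "integrable \<nu> h" using integrable_h[OF N.prob_space_axioms, of "\<lambda>t. t"] by simp
    show "integrable \<nu> (indicator (vtop -` B \<inter> space \<nu>) :: _ \<Rightarrow> real)"
      using eB by (intro integrable_bounded[OF N.prob_space_axioms, of _ 1]) (auto simp: indicator_def)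
    fix t assume "t \<in> space \<nu>"
    thus "h t \<le> indicator (vtop -` B \<inter> space \<nu>) t"
      using fB[of t] h_bound[of t] by (cases "h t = 0") (auto simp: indicator_def h_def)
  qed
  also have "\<dots> = measure (distr \<nu> borel vtop) B"
    using eB m\<nu> AB by (subst measure_distr) auto
  finally show ?thesis by simp
qed

end

lemma smoothing_constants:
  assumes \<beta>: "0 < \<beta>" and \<delta>: "1 / \<beta> < \<delta>" and b: "0 \<le> (b1::real)" "0 \<le> b2" "0 \<le> b3"
  defines "c \<equiv> \<lambda>r::nat. 2000 / (\<delta> / 2) ^ r"
  shows "(c 2 + 2 * \<beta> * c 1) * b1 + (c 3 + 3 * \<beta> * c 2 + 6 * \<beta>\<^sup>2 * c 1) * (exp 2 * b2 + b3) \<le>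
    64000 * exp 2 * \<beta> * inverse \<delta> * (b1 + \<beta> * (b2 + b3))"
proof -
  define i where "i = inverse \<delta>"
  have \<delta>0: "0 < \<delta>" using \<beta> \<delta> by (smt (verit) divide_pos_pos)
  have i: "0 < i" "i \<le> \<beta>" using \<beta> \<delta> \<delta>0 by (auto simp: i_def field_simps)
  have c: "c r = 2000 * 2 ^ r * i ^ r" for r
    using \<delta>0 by (simp add: c_def i_def power_divide power_inverse field_simps)
  have ii: "i * i \<le> \<beta> * i" "i * (i * i) \<le> \<beta> * (\<beta> * i)" "\<beta> * (i * i) \<le> \<beta> * (\<beta> * i)"
  proof -
    show 1: "i * i \<le> \<beta> * i" using i by simp
    have "i * (i * i) \<le> \<beta> * (i * i)" using i by simp
    also show "\<beta> * (i * i) \<le> \<beta> * (\<beta> * i)" using 1 \<beta> by simp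
    finally show "i * (i * i) \<le> \<beta> * (\<beta> * i)" .
  qed
  have nn: "0 \<le> \<beta> * i" "0 \<le> \<beta> * (\<beta> * i)" using \<beta> i by auto
  have "c 2 + 2 * \<beta> * c 1 \<le> 64000 * (\<beta> * i)" using ii(1) nn by (simp add: c power2_eq_square)
  also have "\<dots> \<le> 64000 * exp 2 * (\<beta> * i)" using i \<beta> by simp
  finally have e1: "(c 2 + 2 * \<beta> * c 1) * b1 \<le> 64000 * exp 2 * (\<beta> * i) * b1"
    using b(1) by (rule mult_right_mono)
  have e2: "c 3 + 3 * \<beta> * c 2 + 6 * \<beta>\<^sup>2 * c 1 \<le> 64000 * (\<beta> * (\<beta> * i))"
    using ii(2,3) nn by (simp add: c power2_eq_square power3_eq_cube)
  have e3: "exp 2 * b2 + b3 \<le> exp 2 * (b2 + b3)"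
    using b mult_right_mono[of 1 "exp 2 :: real" b3] by (simp add: distrib_left)
  have "(c 3 + 3 * \<beta> * c 2 + 6 * \<beta>\<^sup>2 * c 1) * (exp 2 * b2 + b3) \<le> (64000 * (\<beta> * (\<beta> * i))) * (exp 2 * (b2 + b3))"
    using e2 e3 b i \<beta> by (intro mult_mono) auto
  with e1 show ?thesis by (simp add: i_def algebra_simps)
qed

lemma max_sum_indep:
  assumes "prob_space M"
    and X: "\<And>i. i < n \<Longrightarrow> X i \<in> measurable M (borel_vec p)"
    and U: "U \<in> borel_measurable M"
    and ind: "prob_space.indep_set M (sets (vimage_algebra (space M) U borel))
      (sets (vimage_algebra (space M) (\<lambda>\<omega>. \<lambda>i\<in>{..<n}. X i \<omega>) (Pi\<^sub>M {..<n} (\<lambda>_. borel_vec p))))"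
    and A: "A \<in> sets borel" and B: "B \<in> sets borel"
  shows "measure M {\<omega> \<in> space M. max_sum n p X \<omega> \<in> A \<and> U \<omega> \<in> B} =
    measure M {\<omega> \<in> space M. max_sum n p X \<omega> \<in> A} * measure M {\<omega> \<in> space M. U \<omega> \<in> B}"
proof -
  interpret prob_space M by fact
  let ?P = "Pi\<^sub>M {..<n} (\<lambda>_. borel_vec p)"
  let ?X = "\<lambda>\<omega>. \<lambda>i\<in>{..<n}. X i \<omega>"
  let ?m = "\<lambda>F. MAX j\<in>{..<p}. \<Sum>i<n. F i j :: real"
  have m: "?m \<in> borel_measurable ?P"
  proof (intro borel_measurable_Max borel_measurable_sum)
    fix j i assume ij: "j \<in> {..<p}" "i \<in> {..<n}"
    show "(\<lambda>F. F i j) \<in> borel_measurable ?P"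
      using measurable_compose[OF measurable_component_singleton[of i "{..<n}" "\<lambda>_. borel_vec p"]
          measurable_component_singleton[of j "{..<p}" "\<lambda>_. borel :: real measure"]] ij by simp
  qed auto
  have XP: "?X \<omega> \<in> space ?P" if "\<omega> \<in> space M" for \<omega>
    using measurable_space[OF X that] by (auto simp: space_PiM)
  have "{\<omega> \<in> space M. max_sum n p X \<omega> \<in> A} = ?X -` (?m -` A \<inter> space ?P) \<inter> space M"
  proof (rule set_eqI)
    fix \<omega>
    have "?m (?X \<omega>) = max_sum n p X \<omega>"
      unfolding max_sum_def by (intro arg_cong[of _ _ Max] image_cong refl sum.cong) simp
    thus "\<omega> \<in> {\<omega> \<in> space M. max_sum n p X \<omega> \<in> A} \<longleftrightarrow> \<omega> \<in> ?X -` (?m -` A \<inter> space ?P) \<inter> space M"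
      using XP[of \<omega>] by (simp only: vimage_eq mem_Collect_eq Int_iff) blast
  qed
  also have "\<dots> \<in> sets (vimage_algebra (space M) ?X ?P)"
    by (rule in_vimage_algebra[OF measurable_sets[OF m A]])
  finally have eA: "{\<omega> \<in> space M. max_sum n p X \<omega> \<in> A} \<in> sets (vimage_algebra (space M) ?X ?P)" .
  have "{\<omega> \<in> space M. U \<omega> \<in> B} = U -` B \<inter> space M" by auto
  also have "\<dots> \<in> sets (vimage_algebra (space M) U borel)" by (rule in_vimage_algebra[OF B])
  finally have eB: "{\<omega> \<in> space M. U \<omega> \<in> B} \<in> sets (vimage_algebra (space M) U borel)" .
  have "{\<omega> \<in> space M. max_sum n p X \<omega> \<in> A \<and> U \<omega> \<in> B} = {\<omega> \<in> space M. U \<omega> \<in> B} \<inter> {\<omega> \<in> space M. max_sum n p X \<omega> \<in> A}"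
    by auto
  thus ?thesis using indep_setD[OF ind eB eA] by (simp add: mult.commute)
qed

definition cell :: "real \<Rightarrow> nat \<Rightarrow> real \<Rightarrow> int" where
  "cell \<eta> K x = (if \<bar>\<lfloor>x / \<eta>\<rfloor>\<bar> \<le> int K then \<lfloor>x / \<eta>\<rfloor> else int K + 1)"

definition near :: "real \<Rightarrow> real \<Rightarrow> (int \<times> int) set" where
  "near \<eta> e = {(\<lfloor>x / \<eta>\<rfloor>, \<lfloor>y / \<eta>\<rfloor>) | x y. \<bar>x - y\<bar> \<le> e}"

text \<open>
  The function \<open>f\<close> of \<open>smooth_max\<close> is a cutoff adapted to the cells that \<open>smax\<close> can reach from the
  cells of index in \<open>A\<close>, given \<open>0 \<le> smax - max \<le> ln p / \<beta>\<close>.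
\<close>

lemma cell_comparison:
  fixes \<beta> \<delta> :: real
  assumes M: "prob_space M" and p: "1 \<le> p" and \<beta>: "0 < \<beta>" and \<delta>: "1 / \<beta> < \<delta>"
    and indep: "prob_space.indep_vars M (\<lambda>_. borel_vec p) X {..<n}"
    and X: "\<And>i j. i < n \<Longrightarrow> j < p \<Longrightarrow> integrable M (\<lambda>\<omega>. \<bar>X i \<omega> j\<bar> ^ 3) \<and> (LINT \<omega>|M. X i \<omega> j) = 0"
    and normal: "centred_normal \<nu> p (\<lambda>j k. \<Sum>i<n. LINT \<omega>|M. X i \<omega> j * X i \<omega> k)"
    and A: "finite A"
  defines "\<eta> \<equiv> \<delta> / 2"
  shows "measure M {\<omega> \<in> space M. \<lfloor>max_sum n p X \<omega> / \<eta>\<rfloor> \<in> A} \<le>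
    measure (distr \<nu> borel (\<lambda>t. MAX j\<in>{..<p}. t j)) {y. \<lfloor>y / \<eta>\<rfloor> \<in> near \<eta> (ln (real p) / \<beta> + 2 * \<eta>) `` A} +
    64000 * exp 2 * \<beta> * inverse \<delta> * (B1 M n p X + \<beta> * (B2 M n p X + B3 M n p X \<beta>))"
proof -
  define e where "e = ln (real p) / \<beta>"
  have e: "0 \<le> e" using p \<beta> by (simp add: e_def)
  have \<delta>0: "0 < \<delta>" using \<beta> \<delta> by (smt (verit) divide_pos_pos)
  have \<eta>: "0 < \<eta>" using \<delta>0 by (simp add: \<eta>_def)
  define B0 where "B0 = {\<lfloor>b / \<eta>\<rfloor> | b z. \<lfloor>z / \<eta>\<rfloor> \<in> A \<and> z \<le> b \<and> b \<le> z + e}"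
  have "B0 \<subseteq> (\<Union>k\<in>A. {k..k + \<lceil>e / \<eta>\<rceil> + 1})"
  proof
    fix k assume "k \<in> B0"
    then obtain b z where bz: "k = \<lfloor>b / \<eta>\<rfloor>" "\<lfloor>z / \<eta>\<rfloor> \<in> A" "z \<le> b" "b \<le> z + e" by (auto simp: B0_def)
    have "\<lfloor>z / \<eta>\<rfloor> \<le> k" unfolding bz(1) using bz \<eta> by (intro floor_mono divide_right_mono) auto
    moreover have "b / \<eta> \<le> z / \<eta> + e / \<eta>" using bz \<eta> by (simp add: add_divide_distrib[symmetric] divide_right_mono)
    hence "k \<le> \<lfloor>z / \<eta>\<rfloor> + \<lceil>e / \<eta>\<rceil> + 1" unfolding bz(1) by linarith
    ultimately show "k \<in> (\<Union>k\<in>A. {k..k + \<lceil>e / \<eta>\<rceil> + 1})" using bz(2) by auto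
  qed
  hence "finite B0" by (rule finite_subset) (use A in auto)
  define B where "B = B0 \<union> (\<lambda>k. k - 1) ` B0"
  have B: "finite B" using \<open>finite B0\<close> by (simp add: B_def)
  interpret comparison \<beta> p "cutoff B \<eta> 0" "cutoff B \<eta> 1" "cutoff B \<eta> 2" "cutoff B \<eta> 3"
    "2000 / \<eta> ^ 1" "2000 / \<eta> ^ 2" "2000 / \<eta> ^ 3" M n X \<nu>
  proof (intro comparison.intro comparison_axioms.intro smooth_max.intro M)
    show "(cutoff B \<eta> 0 has_real_derivative cutoff B \<eta> 1 y) (at y)"
      "(cutoff B \<eta> 1 has_real_derivative cutoff B \<eta> 2 y) (at y)"
      "(cutoff B \<eta> 2 has_real_derivative cutoff B \<eta> 3 y) (at y)" for y
      using DERIV_cutoff[of 0 \<eta> B y] DERIV_cutoff[of 1 \<eta> B y] DERIV_cutoff[of 2 \<eta> B y] \<eta>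
      by (simp_all add: numeral_2_eq_2 numeral_3_eq_3)
    show "\<bar>cutoff B \<eta> 0 y\<bar> \<le> 1" for y using cutoff_range[OF B, of \<eta> y] by simp
    show "\<bar>cutoff B \<eta> 1 y\<bar> \<le> 2000 / \<eta> ^ 1" "\<bar>cutoff B \<eta> 2 y\<bar> \<le> 2000 / \<eta> ^ 2"
      "\<bar>cutoff B \<eta> 3 y\<bar> \<le> 2000 / \<eta> ^ 3" for y by (rule cutoff_bound[OF B \<eta>])+
  qed (use \<beta> p indep X normal in auto)
  have vtop_eq: "vtop = (\<lambda>t. MAX j\<in>{..<p}. t j)" by (simp add: vtop_def[abs_def])
  have fl: "{y. \<lfloor>y / \<eta>\<rfloor> \<in> I} \<in> sets borel" for I
  proof -
    have "(\<lambda>y. \<lfloor>y / \<eta>\<rfloor>) \<in> measurable borel (count_space UNIV)" by measurable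
    from measurable_sets[OF this, of I] show ?thesis by (simp add: vimage_def)
  qed
  have "measure M {\<omega> \<in> space M. max_sum n p X \<omega> \<in> {z. \<lfloor>z / \<eta>\<rfloor> \<in> A}} \<le>
    measure (distr \<nu> borel vtop) {y. \<lfloor>y / \<eta>\<rfloor> \<in> near \<eta> (e + 2 * \<eta>) `` A} + err"
  proof (rule law_comparison)
    fix x assume "vtop x \<in> {z. \<lfloor>z / \<eta>\<rfloor> \<in> A}"
    hence "\<lfloor>smax x / \<eta>\<rfloor> \<in> B0"
      unfolding B0_def mem_Collect_eq using vtop_le_smax[of x] smax_le_vtop[of x]
      by (intro exI[of _ "smax x"] exI[of _ "vtop x"]) (simp add: e_def)
    thus "1 \<le> cutoff B \<eta> 0 (smax x)" using cutoff_eq_1[OF B, of "smax x" \<eta>] by (simp add: B_def)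
  next
    show "0 \<le> cutoff B \<eta> 0 y" for y by (rule cutoff_range[OF B])
  next
    fix x assume "cutoff B \<eta> 0 (smax x) \<noteq> 0"
    hence "\<lfloor>smax x / \<eta>\<rfloor> \<in> B \<or> \<lfloor>smax x / \<eta>\<rfloor> - 1 \<in> B" by (rule cutoff_neq_0[OF B])
    then obtain k where k: "k \<in> B0" "\<bar>\<lfloor>smax x / \<eta>\<rfloor> - k\<bar> \<le> 1" by (force simp: B_def)
    then obtain b z where bz: "k = \<lfloor>b / \<eta>\<rfloor>" "\<lfloor>z / \<eta>\<rfloor> \<in> A" "z \<le> b" "b \<le> z + e" by (auto simp: B0_def)
    have "\<bar>smax x - b\<bar> < 2 * \<eta>" using floor_abs_diff_less[OF \<eta> k(2)[unfolded bz(1)]] by simp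
    hence "\<bar>z - vtop x\<bar> \<le> e + 2 * \<eta>" using bz vtop_le_smax[of x] smax_le_vtop[of x] by (simp add: e_def)
    hence "(\<lfloor>z / \<eta>\<rfloor>, \<lfloor>vtop x / \<eta>\<rfloor>) \<in> near \<eta> (e + 2 * \<eta>)" by (auto simp: near_def)
    thus "vtop x \<in> {y. \<lfloor>y / \<eta>\<rfloor> \<in> near \<eta> (e + 2 * \<eta>) `` A}" using bz(2) by blast
  qed (rule fl)+
  moreover have "err \<le> 64000 * exp 2 * \<beta> * inverse \<delta> * (B1 M n p X + \<beta> * (B2 M n p X + B3 M n p X \<beta>))"
    unfolding err_def A2_def A3_def unfolding \<eta>_def
  proof (rule smoothing_constants[OF \<beta> \<delta>])
    have "0 \<le> V \<omega>" for \<omega>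
    proof -
      have "\<bar>\<Sum>i<n. (X i \<omega> 0 * X i \<omega> 0 - (LINT \<omega>'|M. X i \<omega>' 0 * X i \<omega>' 0))\<bar> \<le> V \<omega>"
        unfolding V_def using p by (intro Max_ge finite_imageI image_eqI[of _ _ "(0, 0)"]) auto
      thus ?thesis by linarith
    qed
    thus "0 \<le> B1 M n p X" unfolding integral_bounds[symmetric] by (intro Bochner_Integration.integral_nonneg) auto
    have "0 \<le> T \<omega>" for \<omega>
    proof -
      have "(\<Sum>i<n. \<bar>X i \<omega> 0\<bar> ^ 3) \<le> T \<omega>"
        unfolding T_def using p by (intro Max_ge finite_imageI image_eqI[of _ _ 0]) auto
      moreover have "0 \<le> (\<Sum>i<n. \<bar>X i \<omega> 0\<bar> ^ 3)" by (intro sum_nonneg) auto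
      ultimately show ?thesis by linarith
    qed
    thus "0 \<le> B2 M n p X" unfolding integral_bounds[symmetric] by (intro Bochner_Integration.integral_nonneg) auto
    show "0 \<le> B3 M n p X \<beta>" unfolding integral_bounds[symmetric]
      by (intro sum_nonneg Bochner_Integration.integral_nonneg R_nonneg)
  qed
  ultimately show ?thesis by (simp add: vtop_eq e_def)
qed

theorem coupling_bound_explicit:
  fixes M :: "'a measure" and N :: "'b measure"
  assumes M: "prob_space M" and N: "prob_space N"
  shows "coupling_bound (64000 * exp 2) M N"
  unfolding coupling_bound_def
proof (intro allI impI, goal_cases)
  case (1 n p X Y \<beta> \<delta>)
  note p = 1(2) and indep = 1(3) and mom = 1(4) and rich = 1(5) and indepY = 1(6) and normY = 1(7)
    and \<beta> = 1(8) and \<delta> = 1(9)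
  interpret M: prob_space M by fact
  interpret N: prob_space N by fact
  define \<eta> where "\<eta> = \<delta> / 2"
  define e where "e = ln (real p) / \<beta>"
  define C where "C = 64000 * exp 2 * \<beta> * inverse \<delta> * (B1 M n p X + \<beta> * (B2 M n p X + B3 M n p X \<beta>))"
  define \<alpha> where "\<alpha> = \<beta>\<^sup>2 * \<delta>\<^sup>2 - 1"
  define \<epsilon> where "\<epsilon> = sqrt (exp (- \<alpha>) * (1 + \<alpha>))"
  have \<delta>0: "0 < \<delta>" using \<beta> \<delta> by (smt (verit) divide_pos_pos)
  have \<eta>: "0 < \<eta>" using \<delta>0 by (simp add: \<eta>_def)
  have e: "0 \<le> e" using p \<beta> by (simp add: e_def)
  have "1 < \<beta> * \<delta>" using \<beta> \<delta> by (simp add: field_simps)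
  hence "1 < (\<beta> * \<delta>)\<^sup>2" by (intro one_less_power) auto
  hence \<alpha>: "0 < \<alpha>" by (simp add: \<alpha>_def power_mult_distrib)
  have "1 + \<alpha> < exp \<alpha>"
  proof -
    have "1 + \<alpha> < (1 + \<alpha> / 2)\<^sup>2" using \<alpha> by (simp add: power2_eq_square algebra_simps)
    also have "\<dots> \<le> (exp (\<alpha> / 2))\<^sup>2" using \<alpha> by (intro power_mono exp_ge_add_one_self) auto
    also have "\<dots> = exp \<alpha>" by (simp flip: exp_double)
    finally show ?thesis .
  qed
  hence \<epsilon>: "0 < \<epsilon>" "\<epsilon> < 1" using \<alpha> by (auto simp: \<epsilon>_def exp_minus field_simps)
  have Xm: "X i \<in> measurable M (borel_vec p)" if "i < n" for i
    using indep that by (auto simp: M.indep_vars_def)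
  have Xc: "(\<lambda>\<omega>. X i \<omega> j) \<in> borel_measurable M" if "i < n" "j < p" for i j
    using measurable_compose[OF Xm[OF that(1)] measurable_component_singleton[of j "{..<p}"]] that by simp
  have Yc: "(\<lambda>\<omega>. Y i \<omega> j) \<in> borel_measurable N" if "i < n" "j < p" for i j
  proof -
    have "Y i \<in> measurable N (borel_vec p)" using indepY that by (auto simp: N.indep_vars_def)
    from measurable_compose[OF this measurable_component_singleton[of j "{..<p}"]] show ?thesis using that by simp
  qed
  define \<nu> where "\<nu> = distr N (borel_vec p) (\<lambda>\<omega>. \<lambda>j\<in>{..<p}. \<Sum>i<n. Y i \<omega> j)"
  have ym: "(\<lambda>\<omega>. \<lambda>j\<in>{..<p}. \<Sum>i<n. Y i \<omega> j) \<in> measurable N (borel_vec p)"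
    and normal: "centred_normal \<nu> p (\<lambda>j k. \<Sum>i<n. LINT \<omega>|M. X i \<omega> j * X i \<omega> k)"
    unfolding \<nu>_def
    using N.centred_normal_sum[OF indepY, of "\<lambda>i j k. LINT \<omega>|M. X i \<omega> j * X i \<omega> k"] normY
    by (simp_all add: mult.commute)
  have topm: "(\<lambda>t. MAX j\<in>{..<p}. t j :: real) \<in> borel_measurable (borel_vec p)"
    by (intro borel_measurable_Max measurable_component_singleton) auto
  have law: "distr \<nu> borel (\<lambda>t. MAX j\<in>{..<p}. t j) = distr N borel (max_sum n p Y)"
  proof -
    have "(\<lambda>t. MAX j\<in>{..<p}. t j) \<circ> (\<lambda>\<omega>. \<lambda>j\<in>{..<p}. \<Sum>i<n. Y i \<omega> j) = max_sum n p Y"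
      unfolding comp_def max_sum_def by (intro ext arg_cong[of _ _ Max] image_cong refl) simp
    thus ?thesis unfolding \<nu>_def distr_distr[OF topm ym] by (rule arg_cong)
  qed
  define \<tau> where "\<tau> = distr N borel (max_sum n p Y)"
  have Ym: "max_sum n p Y \<in> borel_measurable N" by (rule max_sum_measurable[OF Yc])
  have Zm: "max_sum n p X \<in> borel_measurable M" by (rule max_sum_measurable[OF Xc])
  have \<tau>: "real_distribution \<tau>"
    unfolding \<tau>_def real_distribution_def real_distribution_axioms_def using N.prob_space_distr[OF Ym] by simp
  have \<zeta>: "real_distribution (distr M borel (max_sum n p X))"
    unfolding real_distribution_def real_distribution_axioms_def using M.prob_space_distr[OF Zm] by simp
  interpret \<tau>: real_distribution \<tau> by fact
  obtain K1 K2 :: nat where K1: "\<And>K. K \<ge> K1 \<Longrightarrow> measure (distr M borel (max_sum n p X)) {x. \<bar>\<lfloor>x / \<eta>\<rfloor>\<bar> > int K} < \<epsilon> / 2"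
    and K2: "\<And>K. K \<ge> K2 \<Longrightarrow> measure \<tau> {x. \<bar>\<lfloor>x / \<eta>\<rfloor>\<bar> > int K} < \<epsilon> / 2"
    using real_distribution.floor_tail[OF \<zeta>, of "\<epsilon> / 2" \<eta>] \<tau>.floor_tail[of "\<epsilon> / 2" \<eta>] \<epsilon> by (meson half_gt_zero)
  define K where "K = max K1 K2"
  have fl: "{y. P \<lfloor>y / \<eta>\<rfloor>} \<in> sets borel" for P
  proof -
    have "(\<lambda>y. \<lfloor>y / \<eta>\<rfloor>) \<in> measurable borel (count_space UNIV)" by measurable
    from measurable_sets[OF this, of "{k. P k}"] show ?thesis by (simp add: vimage_def)
  qed
  note flK = fl[of "\<lambda>k. \<bar>k\<bar> > int K"]
  have cm: "cell \<eta> K \<in> measurable borel (count_space UNIV)"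
  proof -
    have "(\<lambda>y. \<lfloor>y / \<eta>\<rfloor>) \<in> measurable borel (count_space UNIV)" by measurable
    from measurable_compose[OF this, of "\<lambda>k. if \<bar>k\<bar> \<le> int K then k else int K + 1" "count_space UNIV"]
    show ?thesis by (simp add: cell_def[abs_def])
  qed
  have cellm: "{t. cell \<eta> K t \<in> I} \<in> sets borel" for I
    using measurable_sets[OF cm, of I] by (simp add: vimage_def)
  have flM: "{\<omega> \<in> space M. P \<lfloor>max_sum n p X \<omega> / \<eta>\<rfloor>} \<in> M.events" for P
    using measurable_sets[OF Zm fl[of P]] by (simp add: vimage_def Int_def conj_commute)
  have tailX: "measure M {\<omega> \<in> space M. \<bar>\<lfloor>max_sum n p X \<omega> / \<eta>\<rfloor>\<bar> > int K} < \<epsilon> / 2"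
  proof -
    have "measure (distr M borel (max_sum n p X)) {x. \<bar>\<lfloor>x / \<eta>\<rfloor>\<bar> > int K} =
      measure M {\<omega> \<in> space M. \<bar>\<lfloor>max_sum n p X \<omega> / \<eta>\<rfloor>\<bar> > int K}"
      using Zm flK by (subst measure_distr) (auto intro!: arg_cong[of _ _ "measure M"])
    thus ?thesis using K1[of K] by (simp add: K_def)
  qed
  have tail\<tau>: "measure \<tau> {x. \<bar>\<lfloor>x / \<eta>\<rfloor>\<bar> > int K} < \<epsilon> / 2" using K2[of K] by (simp add: K_def)
  define R where "R = near \<eta> (e + 2 * \<eta>) \<inter> ({- int K..int K} \<times> {- int K..int K})"
  have C0: "0 \<le> C"
  proof -
    have "measure M {\<omega> \<in> space M. \<lfloor>max_sum n p X \<omega> / \<eta>\<rfloor> \<in> {}} \<le>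
      measure (distr \<nu> borel (\<lambda>t. MAX j\<in>{..<p}. t j)) {y. \<lfloor>y / \<eta>\<rfloor> \<in> near \<eta> (e + 2 * \<eta>) `` {}} + C"
      unfolding C_def \<eta>_def e_def using mom by (intro cell_comparison[OF M p \<beta> \<delta> indep _ normal]) auto
    thus ?thesis by simp
  qed
  obtain U :: "'a \<Rightarrow> real" where U: "U \<in> borel_measurable M" "distr M lborel U = uniform_measure lborel {0<..<1}"
    and indU: "M.indep_set (sets (vimage_algebra (space M) U borel))
          (sets (vimage_algebra (space M) (\<lambda>\<omega>. \<lambda>i\<in>{..<n}. X i \<omega>) (Pi\<^sub>M {..<n} (\<lambda>_. borel_vec p))))"
    using rich by (auto simp: rich_enough_def)
  have "\<exists>Z'\<in>borel_measurable M. distr M borel Z' = \<tau> \<and>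
    {\<omega> \<in> space M. (cell \<eta> K (max_sum n p X \<omega>), cell \<eta> K (Z' \<omega>)) \<notin> R} \<in> M.events \<and>
    M.prob {\<omega> \<in> space M. (cell \<eta> K (max_sum n p X \<omega>), cell \<eta> K (Z' \<omega>)) \<notin> R} \<le> C + \<epsilon>"
  proof (rule M.strassen_coupling[OF U Zm _ \<tau>, where D = "{- int K..int K + 1}"])
    show "cell \<eta> K \<in> measurable borel (count_space UNIV)" by (rule cm)
    show "cell \<eta> K x \<in> {- int K..int K + 1}" for x by (auto simp: cell_def)
    show "0 \<le> C + \<epsilon>" using C0 \<epsilon> by simp
    fix A assume A: "A \<subseteq> {- int K..int K + 1}"
    let ?A = "A \<inter> {- int K..int K}"
    have i1: "M.prob {\<omega> \<in> space M. cell \<eta> K (max_sum n p X \<omega>) \<in> A} \<le>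
      M.prob ({\<omega> \<in> space M. \<lfloor>max_sum n p X \<omega> / \<eta>\<rfloor> \<in> ?A} \<union> {\<omega> \<in> space M. \<bar>\<lfloor>max_sum n p X \<omega> / \<eta>\<rfloor>\<bar> > int K})"
      using flM by (intro M.finite_measure_mono sets.Un) (auto simp: cell_def split: if_splits)
    have i2: "M.prob ({\<omega> \<in> space M. \<lfloor>max_sum n p X \<omega> / \<eta>\<rfloor> \<in> ?A} \<union> {\<omega> \<in> space M. \<bar>\<lfloor>max_sum n p X \<omega> / \<eta>\<rfloor>\<bar> > int K}) \<le>
        M.prob {\<omega> \<in> space M. \<lfloor>max_sum n p X \<omega> / \<eta>\<rfloor> \<in> ?A} +
        M.prob {\<omega> \<in> space M. \<bar>\<lfloor>max_sum n p X \<omega> / \<eta>\<rfloor>\<bar> > int K}"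
      using flM by (intro measure_Un_le) auto
    have i3: "M.prob {\<omega> \<in> space M. \<lfloor>max_sum n p X \<omega> / \<eta>\<rfloor> \<in> ?A} \<le>
      measure \<tau> {y. \<lfloor>y / \<eta>\<rfloor> \<in> near \<eta> (e + 2 * \<eta>) `` ?A} + C"
      unfolding C_def \<eta>_def e_def \<tau>_def law[symmetric] using mom
      by (intro cell_comparison[OF M p \<beta> \<delta> indep _ normal]) auto
    have i4: "measure \<tau> {y. \<lfloor>y / \<eta>\<rfloor> \<in> near \<eta> (e + 2 * \<eta>) `` ?A} \<le>
      measure \<tau> ({t. cell \<eta> K t \<in> R `` A} \<union> {x. \<bar>\<lfloor>x / \<eta>\<rfloor>\<bar> > int K})"
    proof (rule \<tau>.finite_measure_mono)
      show "{y. \<lfloor>y / \<eta>\<rfloor> \<in> near \<eta> (e + 2 * \<eta>) `` ?A} \<subseteq> {t. cell \<eta> K t \<in> R `` A} \<union> {x. \<bar>\<lfloor>x / \<eta>\<rfloor>\<bar> > int K}"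
        by (force simp: cell_def R_def)
      show "{t. cell \<eta> K t \<in> R `` A} \<union> {x. \<bar>\<lfloor>x / \<eta>\<rfloor>\<bar> > int K} \<in> sets \<tau>"
        using flK cellm by (intro sets.Un) auto
    qed
    have i5: "measure \<tau> ({t. cell \<eta> K t \<in> R `` A} \<union> {x. \<bar>\<lfloor>x / \<eta>\<rfloor>\<bar> > int K}) \<le>
        measure \<tau> {t. cell \<eta> K t \<in> R `` A} + measure \<tau> {x. \<bar>\<lfloor>x / \<eta>\<rfloor>\<bar> > int K}"
      using flK cellm by (intro measure_Un_le) auto
    show "M.prob {\<omega> \<in> space M. cell \<eta> K (max_sum n p X \<omega>) \<in> A} \<le> measure \<tau> {t. cell \<eta> K t \<in> R `` A} + (C + \<epsilon>)"
      using i1 i2 i3 i4 i5 tailX tail\<tau> by linarith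
  qed (use max_sum_indep[OF M Xm U(1) indU] in auto)
  then obtain Z' where Z': "Z' \<in> borel_measurable M" "distr M borel Z' = \<tau>"
    and ev: "{\<omega> \<in> space M. (cell \<eta> K (max_sum n p X \<omega>), cell \<eta> K (Z' \<omega>)) \<notin> R} \<in> M.events"
    and le: "M.prob {\<omega> \<in> space M. (cell \<eta> K (max_sum n p X \<omega>), cell \<eta> K (Z' \<omega>)) \<notin> R} \<le> C + \<epsilon>"
    by blast
  have close: "\<bar>z - t\<bar> \<le> 2 * inverse \<beta> * ln (real p) + 3 * \<delta>" if zt: "(cell \<eta> K z, cell \<eta> K t) \<in> R" for z t
  proof -
    have "cell \<eta> K z = \<lfloor>z / \<eta>\<rfloor>" "cell \<eta> K t = \<lfloor>t / \<eta>\<rfloor>" using zt by (auto simp: cell_def R_def split: if_splits)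
    then obtain x y where xy: "\<lfloor>z / \<eta>\<rfloor> = \<lfloor>x / \<eta>\<rfloor>" "\<lfloor>t / \<eta>\<rfloor> = \<lfloor>y / \<eta>\<rfloor>" "\<bar>x - y\<bar> \<le> e + 2 * \<eta>"
      using zt by (auto simp: R_def near_def)
    have "\<bar>z - x\<bar> < \<eta>" "\<bar>t - y\<bar> < \<eta>"
      using floor_abs_diff_less[OF \<eta>, of z x 0] floor_abs_diff_less[OF \<eta>, of t y 0] xy by auto
    hence "\<bar>z - t\<bar> \<le> e + 4 * \<eta>" using xy(3) by linarith
    also have "\<dots> \<le> 2 * e + 3 * \<delta>" using e \<delta>0 by (simp add: \<eta>_def)
    finally show ?thesis by (simp add: e_def divide_inverse mult_ac)
  qed
  have "M.prob {\<omega> \<in> space M. \<bar>max_sum n p X \<omega> - Z' \<omega>\<bar> > 2 * inverse \<beta> * ln (real p) + 3 * \<delta>} \<le>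
    M.prob {\<omega> \<in> space M. (cell \<eta> K (max_sum n p X \<omega>), cell \<eta> K (Z' \<omega>)) \<notin> R}"
    using close by (intro M.finite_measure_mono ev) (auto simp: not_le[symmetric])
  also have "\<dots> \<le> \<epsilon> + C" using le by simp
  also have "\<dots> \<le> (\<epsilon> + C) / (1 - \<epsilon>)"
    using \<epsilon> C0 mult_left_mono[of "1 - \<epsilon>" 1 "\<epsilon> + C"] by (simp add: pos_le_divide_eq)
  finally show ?case
    using Z' unfolding Let_def \<alpha>_def[symmetric] \<epsilon>_def[symmetric] C_def[symmetric] \<tau>_def by blast
qed

section \<open>Transfer from the canonical sample space\<close>

context
  fixes M :: "'a measure" and K :: "'c measure" and \<Phi> :: "'a \<Rightarrow> 'c" and n p :: nat
    and X :: "nat \<Rightarrow> 'a \<Rightarrow> nat \<Rightarrow> real" and X' :: "nat \<Rightarrow> 'c \<Rightarrow> nat \<Rightarrow> real"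
  assumes M: "prob_space M" and \<Phi>: "\<Phi> \<in> measurable M K"
    and X': "\<And>i. i < n \<Longrightarrow> X' i \<in> measurable K (borel_vec p)"
    and X: "\<And>i \<omega>. i < n \<Longrightarrow> X' i (\<Phi> \<omega>) = X i \<omega>"
begin

lemma X'_coord: "i < n \<Longrightarrow> j < p \<Longrightarrow> (\<lambda>z. X' i z j) \<in> borel_measurable K"
  using measurable_compose[OF X' measurable_component_singleton[of j "{..<p}" "\<lambda>_. borel :: real measure"], of i] by simp

lemma X_measurable: "i < n \<Longrightarrow> X i \<in> measurable M (borel_vec p)"
  using measurable_compose[OF \<Phi> X'] by (simp add: X)

lemma prob_space_image: "prob_space (distr M K \<Phi>)"
  by (rule prob_space.prob_space_distr[OF M \<Phi>])

lemma second_moment_image: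
  "i < n \<Longrightarrow> j < p \<Longrightarrow> k < p \<Longrightarrow> (LINT z|distr M K \<Phi>. X' i z j * X' i z k) = (LINT \<omega>|M. X i \<omega> j * X i \<omega> k)"
  using X'_coord by (subst integral_distr[OF \<Phi>]) (auto simp: X)

lemma moments_image:
  assumes "i < n" "j < p" "integrable M (\<lambda>\<omega>. \<bar>X i \<omega> j\<bar> ^ 3) \<and> (LINT \<omega>|M. X i \<omega> j) = 0"
  shows "integrable (distr M K \<Phi>) (\<lambda>z. \<bar>X' i z j\<bar> ^ 3) \<and> (LINT z|distr M K \<Phi>. X' i z j) = 0"
  using assms X'_coord[OF assms(1,2)]
  by (subst integrable_distr_eq[OF \<Phi>], simp, subst integral_distr[OF \<Phi>]) (auto simp: X)

lemma B1_image: "B1 (distr M K \<Phi>) n p X' = B1 M n p X"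
proof -
  have e: "(\<lambda>(j, k). \<bar>\<Sum>i<n. (X' i z j * X' i z k - (LINT \<omega>'|distr M K \<Phi>. X' i \<omega>' j * X' i \<omega>' k))\<bar>) ` ({..<p} \<times> {..<p}) =
    (\<lambda>jk. \<bar>\<Sum>i<n. (X' i z (fst jk) * X' i z (snd jk) - (LINT \<omega>'|M. X i \<omega>' (fst jk) * X i \<omega>' (snd jk)))\<bar>) ` ({..<p} \<times> {..<p})" for z
    by (intro image_cong refl) (auto simp: second_moment_image intro!: arg_cong[of _ _ abs] sum.cong)
  have "(\<lambda>z. MAX jk\<in>{..<p} \<times> {..<p}. \<bar>\<Sum>i<n. (X' i z (fst jk) * X' i z (snd jk) - (LINT \<omega>'|M. X i \<omega>' (fst jk) * X i \<omega>' (snd jk)))\<bar>) \<in> borel_measurable K"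
    by (intro borel_measurable_Max borel_measurable_abs borel_measurable_sum borel_measurable_diff
        borel_measurable_times borel_measurable_const X'_coord) auto
  from integral_distr[OF \<Phi> this] show ?thesis unfolding B1_def e
    by (simp add: X split_beta')
qed

lemma B2_image: "B2 (distr M K \<Phi>) n p X' = B2 M n p X"
proof -
  have "(\<lambda>z. MAX j\<in>{..<p}. \<Sum>i<n. \<bar>X' i z j\<bar> ^ 3) \<in> borel_measurable K"
    by (intro borel_measurable_Max borel_measurable_sum borel_measurable_power borel_measurable_abs X'_coord) auto
  from integral_distr[OF \<Phi> this] show ?thesis unfolding B2_def by (simp add: X)
qed

lemma B3_image: "B3 (distr M K \<Phi>) n p X' \<beta> = B3 M n p X \<beta>"
  unfolding B3_def
proof (rule sum.cong[OF refl])
  fix i assume i: "i \<in> {..<n}"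
  have m: "(\<lambda>z. MAX j\<in>{..<p}. \<bar>X' i z j\<bar> ^ k) \<in> borel_measurable K" for k
    using i by (intro borel_measurable_Max borel_measurable_power borel_measurable_abs X'_coord) auto
  have "(\<lambda>z. (MAX j\<in>{..<p}. \<bar>X' i z j\<bar> ^ 3) * indicator {\<omega>'. (MAX j\<in>{..<p}. \<bar>X' i \<omega>' j\<bar>) > inverse \<beta> / 2} z) \<in> borel_measurable K"
  proof (rule borel_measurable_times[OF m])
    have "{z \<in> space K. (MAX j\<in>{..<p}. \<bar>X' i z j\<bar>) > inverse \<beta> / 2} \<in> sets K"
      using m[of 1] by simp
    thus "(indicator {\<omega>'. (MAX j\<in>{..<p}. \<bar>X' i \<omega>' j\<bar>) > inverse \<beta> / 2} :: _ \<Rightarrow> real) \<in> borel_measurable K"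
      by (simp add: borel_measurable_indicator_iff Int_def conj_commute)
  qed
  from integral_distr[OF \<Phi> this]
  show "(LINT z|distr M K \<Phi>. (MAX j\<in>{..<p}. \<bar>X' i z j\<bar> ^ 3) * indicator {\<omega>'. (MAX j\<in>{..<p}. \<bar>X' i \<omega>' j\<bar>) > inverse \<beta> / 2} z) =
    (LINT \<omega>|M. (MAX j\<in>{..<p}. \<bar>X i \<omega> j\<bar> ^ 3) * indicator {\<omega>'. (MAX j\<in>{..<p}. \<bar>X i \<omega>' j\<bar>) > inverse \<beta> / 2} \<omega>)"
    using i by (simp add: X indicator_def)
qed

lemma max_sum_image: "max_sum n p X' (\<Phi> \<omega>) = max_sum n p X \<omega>"
  by (simp add: max_sum_def X)

lemma family_image:
  "(\<lambda>z. \<lambda>i\<in>{..<n}. X' i z) \<in> measurable K (Pi\<^sub>M {..<n} (\<lambda>_. borel_vec p))"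
  "(\<lambda>i\<in>{..<n}. X' i (\<Phi> \<omega>)) = (\<lambda>i\<in>{..<n}. X i \<omega>)"
proof -
  show "(\<lambda>z. \<lambda>i\<in>{..<n}. X' i z) \<in> measurable K (Pi\<^sub>M {..<n} (\<lambda>_. borel_vec p))"
    by (rule measurable_restrict) (use X' in auto)
  show "(\<lambda>i\<in>{..<n}. X' i (\<Phi> \<omega>)) = (\<lambda>i\<in>{..<n}. X i \<omega>)"
    by (auto simp: X restrict_def)
qed

lemma indep_vars_image:
  assumes n: "1 \<le> n" and indep: "prob_space.indep_vars M (\<lambda>_. borel_vec p) X {..<n}"
  shows "prob_space.indep_vars (distr M K \<Phi>) (\<lambda>_. borel_vec p) X' {..<n}"
proof -
  interpret M: prob_space M by (rule M)
  interpret D: prob_space "distr M K \<Phi>" by (rule prob_space_image)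
  have ne: "{..<n} \<noteq> {}" using n by (auto simp: lessThan_empty_iff)
  have d: "distr (distr M K \<Phi>) (borel_vec p) (X' i) = distr M (borel_vec p) (X i)" if "i \<in> {..<n}" for i
    using that X' by (subst distr_distr[OF _ \<Phi>]) (auto simp: comp_def X)
  have "distr (distr M K \<Phi>) (Pi\<^sub>M {..<n} (\<lambda>_. borel_vec p)) (\<lambda>z. \<lambda>i\<in>{..<n}. X' i z) =
    distr M (Pi\<^sub>M {..<n} (\<lambda>_. borel_vec p)) (\<lambda>\<omega>. \<lambda>i\<in>{..<n}. X i \<omega>)"
    by (subst distr_distr[OF family_image(1) \<Phi>]) (simp add: comp_def family_image(2))
  also have "\<dots> = Pi\<^sub>M {..<n} (\<lambda>i. distr M (borel_vec p) (X i))"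
    using M.indep_vars_iff_distr_eq_PiM'[OF ne, of X "\<lambda>_. borel_vec p"] X_measurable indep by auto
  also have "\<dots> = Pi\<^sub>M {..<n} (\<lambda>i. distr (distr M K \<Phi>) (borel_vec p) (X' i))"
    using d by (intro PiM_cong) auto
  finally show ?thesis
    using D.indep_vars_iff_distr_eq_PiM'[OF ne, of X' "\<lambda>_. borel_vec p"] X' by auto
qed

lemma centred_normal_vec_image:
  assumes i: "i < n" and "centred_normal_vec M p (X i) C" and C: "\<And>j k. j < p \<Longrightarrow> k < p \<Longrightarrow> C' j k = C j k"
  shows "centred_normal_vec (distr M K \<Phi>) p (X' i) C'"
  unfolding centred_normal_vec_def
proof (intro conjI allI)
  show "X' i \<in> measurable (distr M K \<Phi>) (borel_vec p)" using X'[OF i] by simp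
  fix t
  have "(\<lambda>z. \<Sum>j<p. t j * X' i z j) \<in> borel_measurable K"
    using X'_coord i by (intro borel_measurable_sum borel_measurable_times) auto
  hence "(\<lambda>z. iexp (\<Sum>j<p. t j * X' i z j)) \<in> borel_measurable K" by measurable
  from integral_distr[OF \<Phi> this]
  have "(CLINT z|distr M K \<Phi>. iexp (\<Sum>j<p. t j * X' i z j)) = (CLINT \<omega>|M. iexp (\<Sum>j<p. t j * X i \<omega> j))"
    by (simp only: X[OF i])
  also have "\<dots> = complex_of_real (exp (- (\<Sum>j<p. \<Sum>k<p. t j * C j k * t k) / 2))"
    using assms(2) by (simp add: centred_normal_vec_def)
  also have "(\<Sum>j<p. \<Sum>k<p. t j * C j k * t k) = (\<Sum>j<p. \<Sum>k<p. t j * C' j k * t k)"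
    by (intro sum.cong refl) (simp add: C)
  finally show "(CLINT z|distr M K \<Phi>. iexp (\<Sum>j<p. t j * X' i z j)) =
    complex_of_real (exp (- (\<Sum>j<p. \<Sum>k<p. t j * C' j k * t k) / 2))" .
qed

lemma rich_enough_image:
  fixes U :: "'a \<Rightarrow> real"
  assumes U': "U' \<in> borel_measurable K" "\<And>\<omega>. U' (\<Phi> \<omega>) = U \<omega>"
    and unif: "distr M lborel U = uniform_measure lborel {0<..<1}"
    and ind: "prob_space.indep_set M (sets (vimage_algebra (space M) U borel))
      (sets (vimage_algebra (space M) (\<lambda>\<omega>. \<lambda>i\<in>{..<n}. X i \<omega>) (Pi\<^sub>M {..<n} (\<lambda>_. borel_vec p))))"
  shows "rich_enough (distr M K \<Phi>) n p X'"
  unfolding rich_enough_def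
proof (intro exI[of _ U'] conjI)
  interpret M: prob_space M by (rule M)
  interpret D: prob_space "distr M K \<Phi>" by (rule prob_space_image)
  let ?P = "Pi\<^sub>M {..<n} (\<lambda>_. borel_vec p)"
  let ?X' = "\<lambda>z. \<lambda>i\<in>{..<n}. X' i z"
  let ?X = "\<lambda>\<omega>. \<lambda>i\<in>{..<n}. X i \<omega>"
  show "U' \<in> borel_measurable (distr M K \<Phi>)" using U' by simp
  have "distr (distr M K \<Phi>) lborel U' = distr M lborel U"
    using U' by (subst distr_distr[OF _ \<Phi>]) (auto simp: comp_def)
  thus "distr (distr M K \<Phi>) lborel U' = uniform_measure lborel {0<..<1}" using unif by simp
  have XP: "?X \<in> measurable M ?P" using X_measurable by (auto intro: measurable_restrict)
  have X'P: "?X' \<in> measurable (distr M K \<Phi>) ?P" using family_image(1) by simp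
  have sU: "sets (vimage_algebra (space (distr M K \<Phi>)) U' borel) = {U' -` A \<inter> space K | A. A \<in> sets borel}"
    by (subst sets_vimage_algebra2) auto
  have sX: "sets (vimage_algebra (space (distr M K \<Phi>)) ?X' ?P) = {?X' -` A \<inter> space K | A. A \<in> sets ?P}"
    using measurable_space[OF X'P] by (subst sets_vimage_algebra2) auto
  show "D.indep_set (sets (vimage_algebra (space (distr M K \<Phi>)) U' borel))
      (sets (vimage_algebra (space (distr M K \<Phi>)) ?X' ?P))"
    unfolding D.indep_sets2_eq sU sX
  proof (intro conjI ballI subsetI)
    fix E assume "E \<in> {U' -` A \<inter> space K | A. A \<in> sets borel}"
    thus "E \<in> D.events" using measurable_sets[OF U'(1)] by auto
  next
    fix E assume "E \<in> {?X' -` A \<inter> space K | A. A \<in> sets ?P}"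
    thus "E \<in> D.events" using measurable_sets[OF family_image(1)] by auto
  next
    fix E F assume "E \<in> {U' -` A \<inter> space K | A. A \<in> sets borel}" "F \<in> {?X' -` A \<inter> space K | A. A \<in> sets ?P}"
    then obtain A B where AB: "E = U' -` A \<inter> space K" "A \<in> sets borel" "F = ?X' -` B \<inter> space K" "B \<in> sets ?P"
      by blast
    have E: "E \<in> sets K" unfolding AB by (rule measurable_sets[OF U'(1) AB(2)])
    have F: "F \<in> sets K" unfolding AB by (rule measurable_sets[OF family_image(1) AB(4)])
    have pE: "\<Phi> -` E \<inter> space M = U -` A \<inter> space M"
      using measurable_space[OF \<Phi>] U'(2) by (auto simp: AB)
    have pF: "\<Phi> -` F \<inter> space M = ?X -` B \<inter> space M"
      using measurable_space[OF \<Phi>] family_image(2) by (auto simp: AB simp del: restrict_apply)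
    have pEF: "\<Phi> -` (E \<inter> F) \<inter> space M = (U -` A \<inter> space M) \<inter> (?X -` B \<inter> space M)"
      using pE pF by blast
    have "D.prob (E \<inter> F) = M.prob ((U -` A \<inter> space M) \<inter> (?X -` B \<inter> space M))"
      using E F by (subst measure_distr[OF \<Phi>]) (auto simp only: pEF intro: sets.Int)
    also have "\<dots> = M.prob (U -` A \<inter> space M) * M.prob (?X -` B \<inter> space M)"
      by (rule M.indep_setD[OF ind]) (rule in_vimage_algebra AB)+
    also have "\<dots> = D.prob E * D.prob F"
      using E F by (simp only: measure_distr[OF \<Phi>] pE pF)
    finally show "D.prob (E \<inter> F) = D.prob E * D.prob F" .
  qed
qed

end

lemma coupling_bound_transfer:
  fixes M :: "'a measure" and N :: "'b measure"
  assumes C: "\<And>(M' :: canonical measure) (N' :: canonical measure).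
      prob_space M' \<Longrightarrow> prob_space N' \<Longrightarrow> coupling_bound C M' N'"
    and M: "prob_space M" and N: "prob_space N"
  shows "coupling_bound C M N"
  unfolding coupling_bound_def
proof (intro allI impI, goal_cases)
  case (1 n p X Y \<beta> \<delta>)
  note n = 1(1) and p = 1(2) and indep = 1(3) and mom = 1(4) and rich = 1(5) and indepY = 1(6) and normY = 1(7)
    and \<beta> = 1(8) and \<delta> = 1(9)
  interpret M: prob_space M by fact
  interpret N: prob_space N by fact
  obtain U :: "'a \<Rightarrow> real" where U: "U \<in> borel_measurable M" "distr M lborel U = uniform_measure lborel {0<..<1}"
    and indU: "M.indep_set (sets (vimage_algebra (space M) U borel))
          (sets (vimage_algebra (space M) (\<lambda>\<omega>. \<lambda>i\<in>{..<n}. X i \<omega>) (Pi\<^sub>M {..<n} (\<lambda>_. borel_vec p))))"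
    using rich by (auto simp: rich_enough_def)
  let ?P = "Pi\<^sub>M {..<n} (\<lambda>_. borel_vec p)"
  define K :: "canonical measure" where "K = ?P \<Otimes>\<^sub>M borel"
  define \<Phi> where "\<Phi> \<omega> = ((\<lambda>i\<in>{..<n}. X i \<omega>), U \<omega>)" for \<omega>
  define \<Psi> where "\<Psi> \<omega> = ((\<lambda>i\<in>{..<n}. Y i \<omega>), 0 :: real)" for \<omega>
  define X' where "X' i z = fst z i" for i and z :: canonical
  have X'm: "X' i \<in> measurable K (borel_vec p)" if "i < n" for i
    unfolding X'_def[abs_def] K_def
    using measurable_compose[OF measurable_fst measurable_component_singleton[of i "{..<n}" "\<lambda>_. borel_vec p"]] that by simp
  have Xm: "(\<lambda>\<omega>. \<lambda>i\<in>{..<n}. X i \<omega>) \<in> measurable M ?P"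
    using indep by (auto simp: M.indep_vars_def intro!: measurable_restrict)
  have Ym: "(\<lambda>\<omega>. \<lambda>i\<in>{..<n}. Y i \<omega>) \<in> measurable N ?P"
    using indepY by (auto simp: N.indep_vars_def intro!: measurable_restrict)
  have \<Phi>: "\<Phi> \<in> measurable M K" unfolding \<Phi>_def[abs_def] K_def using Xm U by (intro measurable_Pair)
  have \<Psi>: "\<Psi> \<in> measurable N K" unfolding \<Psi>_def[abs_def] K_def using Ym by (intro measurable_Pair) auto
  have X'\<Phi>: "X' i (\<Phi> \<omega>) = X i \<omega>" if "i < n" for i \<omega> using that by (simp add: X'_def \<Phi>_def)
  have X'\<Psi>: "X' i (\<Psi> \<omega>) = Y i \<omega>" if "i < n" for i \<omega> using that by (simp add: X'_def \<Psi>_def)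
  note img = M \<Phi> X'm X'\<Phi>
  note imgY = N \<Psi> X'm X'\<Psi>
  let ?M = "distr M K \<Phi>"
  let ?N = "distr N K \<Psi>"
  have rich': "rich_enough ?M n p X'"
    by (rule rich_enough_image[OF img _ _ U(2) indU, of snd]) (auto simp: K_def \<Phi>_def)
  have norm': "centred_normal_vec ?N p (X' i) (\<lambda>j k. LINT z|?M. X' i z j * X' i z k)" if "i < n" for i
  proof (rule centred_normal_vec_image[where X = Y, OF N \<Psi> X'm X'\<Psi> that])
    show "centred_normal_vec N p (Y i) (\<lambda>j k. LINT \<omega>|M. X i \<omega> j * X i \<omega> k)" using normY that by blast
    show "(LINT z|?M. X' i z j * X' i z k) = (LINT \<omega>|M. X i \<omega> j * X i \<omega> k)" if "j < p" "k < p" for j k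
      by (rule second_moment_image[OF img \<open>i < n\<close> that])
  qed
  have ind': "prob_space.indep_vars ?M (\<lambda>_. borel_vec p) X' {..<n}"
    by (rule indep_vars_image[OF img n indep])
  have indY': "prob_space.indep_vars ?N (\<lambda>_. borel_vec p) X' {..<n}"
    by (rule indep_vars_image[OF imgY n indepY])
  have B: "B1 ?M n p X' = B1 M n p X" "B2 ?M n p X' = B2 M n p X" "B3 ?M n p X' \<beta> = B3 M n p X \<beta>"
    by (rule B1_image[OF img] B2_image[OF img] B3_image[OF img]; assumption)+
  have maxX: "max_sum n p X' (\<Phi> \<omega>) = max_sum n p X \<omega>" for \<omega> by (rule max_sum_image[OF img])
  have maxY: "max_sum n p X' (\<Psi> \<omega>) = max_sum n p Y \<omega>" for \<omega> by (rule max_sum_image[OF imgY])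
  have pM: "prob_space ?M" and pN: "prob_space ?N"
    by (rule M.prob_space_distr[OF \<Phi>] N.prob_space_distr[OF \<Psi>])+
  have "coupling_bound C ?M ?N" by (rule C[OF pM pN])
  note cb = this[unfolded coupling_bound_def, THEN spec[of _ n], THEN spec[of _ p], THEN spec[of _ X'],
      THEN spec[of _ X'], THEN spec[of _ \<beta>], THEN spec[of _ \<delta>], THEN mp, OF n, THEN mp, OF p]
  have "\<forall>i<n. \<forall>j<p. integrable ?M (\<lambda>z. \<bar>X' i z j\<bar> ^ 3) \<and> (LINT z|?M. X' i z j) = 0"
    by (intro allI impI moments_image[OF img]) (use mom in auto)
  note cb = cb[THEN mp, OF ind', THEN mp, OF this, THEN mp, OF rich',
      THEN mp, OF indY']
  have "\<forall>i<n. centred_normal_vec ?N p (X' i) (\<lambda>j k. LINT z|?M. X' i z j * X' i z k)"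
    by (intro allI impI norm')
  from cb[THEN mp, OF this, THEN mp, OF \<beta>, THEN mp, OF \<delta>]
  obtain Z where Z: "Z \<in> borel_measurable ?M" "distr ?M borel Z = distr ?N borel (max_sum n p X')"
    and le: "let \<alpha> = \<beta>\<^sup>2 * \<delta>\<^sup>2 - 1; \<epsilon> = sqrt (exp (- \<alpha>) * (1 + \<alpha>))
      in measure ?M {z \<in> space ?M. \<bar>max_sum n p X' z - Z z\<bar> > 2 * inverse \<beta> * ln (real p) + 3 * \<delta>}
         \<le> (\<epsilon> + C * \<beta> * inverse \<delta> * (B1 ?M n p X' + \<beta> * (B2 ?M n p X' + B3 ?M n p X' \<beta>))) / (1 - \<epsilon>)"
    by (elim exE conjE) (rule that; assumption)
  have ZK: "Z \<in> borel_measurable K" using Z(1) by simp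
  have mK: "max_sum n p X' \<in> borel_measurable K"
    by (rule max_sum_measurable) (rule X'_coord[OF img])
  show ?case
  proof (intro exI[of _ "\<lambda>\<omega>. Z (\<Phi> \<omega>)"] conjI)
    show "(\<lambda>\<omega>. Z (\<Phi> \<omega>)) \<in> borel_measurable M" by (rule measurable_compose[OF \<Phi> ZK])
    have "distr M borel (\<lambda>\<omega>. Z (\<Phi> \<omega>)) = distr ?M borel Z"
      by (subst distr_distr[OF ZK \<Phi>]) (simp add: comp_def)
    also have "\<dots> = distr N borel (max_sum n p Y)"
      unfolding Z(2) by (subst distr_distr[OF mK \<Psi>]) (simp add: comp_def maxY)
    finally show "distr M borel (\<lambda>\<omega>. Z (\<Phi> \<omega>)) = distr N borel (max_sum n p Y)" .
    let ?b = "2 * inverse \<beta> * ln (real p) + 3 * \<delta>"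
    have ev: "{z \<in> space K. \<bar>max_sum n p X' z - Z z\<bar> > ?b} \<in> sets K" using ZK mK by measurable
    have "measure ?M {z \<in> space ?M. \<bar>max_sum n p X' z - Z z\<bar> > ?b} =
      measure M {\<omega> \<in> space M. \<bar>max_sum n p X \<omega> - Z (\<Phi> \<omega>)\<bar> > ?b}"
      using ev measurable_space[OF \<Phi>]
      by (subst measure_distr[OF \<Phi>]) (auto simp: maxX intro!: arg_cong[of _ _ "measure M"])
    with le show "let \<alpha> = \<beta>\<^sup>2 * \<delta>\<^sup>2 - 1; \<epsilon> = sqrt (exp (- \<alpha>) * (1 + \<alpha>))
      in measure M {\<omega> \<in> space M. \<bar>max_sum n p X \<omega> - Z (\<Phi> \<omega>)\<bar> > 2 * inverse \<beta> * ln (real p) + 3 * \<delta>}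
         \<le> (\<epsilon> + C * \<beta> * inverse \<delta> * (B1 M n p X + \<beta> * (B2 M n p X + B3 M n p X \<beta>))) / (1 - \<epsilon>)"
      by (simp only: B)
  qed
qed

theorem theorem4p1:
  shows "(\<exists>C. canonical_constant C) \<and>
    (\<forall>C. canonical_constant C \<longrightarrow>
       (\<forall>(M :: 'a measure) (N :: 'b measure).
          prob_space M \<longrightarrow> prob_space N \<longrightarrow> coupling_bound C M N))"
proof (intro conjI allI impI)
  show "\<exists>C. canonical_constant C"
    unfolding canonical_constant_def using coupling_bound_explicit
    by (intro exI[of _ "64000 * exp 2"]) auto
next
  fix C and M :: "'a measure" and N :: "'b measure"
  assume "canonical_constant C" and M: "prob_space M" and N: "prob_space N"
  hence "coupling_bound C M' N'" if "prob_space M'" "prob_space N'" for M' N' :: "canonical measure"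
    using that by (simp add: canonical_constant_def)
  from this M N show "coupling_bound C M N" by (rule coupling_bound_transfer)
qed

end
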